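(* Let $p\equiv 1\pmod 8$ be a prime, written (uniquely) as $p=a^2+4b^2$ with integers $a\equiv -1\pmod 4$ and $b>0$. For a primitive root $g$ modulo $p$, let $\tau_p(g)$ be the permutation carrying the sequence $\{a_1^2\}_p,\dots,\{a_{(p-1)/4}^2\}_p$ to the sequence $\{g^4\}_p,\{g^8\}_p,\dots,\{g^{p-1}\}_p$, and let $\chi_4,\lambda_p,\beta_p,\gamma_p,\delta_p(g),\mu_p(g)$ be as defined in the context. Then: (i) If $p\equiv 9\pmod{16}$, then $\operatorname{sgn}(\tau_p(g))$ does not depend on the choice of the primitive root $g$, and $$\operatorname{sgn}(\tau_p(g))=\begin{cases}(-1)^{\lambda_p+\beta_p+\frac{3p+11-2a+8b}{32}}&\text{if }\chi_4(2)=1,\\(-1)^{\lambda_p+\gamma_p+\frac{3p-21-2a-8b}{32}}&\text{if }\chi_4(2)=-1.\end{cases}$$ (ii) If $p\equiv 1\pmod{16}$, then $$\operatorname{sgn}(\tau_p(g))=\begin{cases}(-1)^{\lambda_p+\delta_p(g)+\frac{3p-5-2a+8b}{32}}&\text{if }\chi_4(2)=1,\\(-1)^{\lambda_p+\mu_p(g)+\frac{3p+27-2a-8b}{32}}&\text{if }\chi_4(2)=-1.\end{cases}$$ Moreover, in this case, with $\mathcal P=\{0<g<p:\ g\text{ is a primitive root modulo }p\}$, $$\#\{g\in\mathcal P:\operatorname{sgn}(\tau_p(g))=1\}=\#\{g\in\mathcal P:\operatorname{sgn}(\tau_p(g))=-1\}.$$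
   Context: Let $p\equiv1\pmod 8$ be a prime with $p=a^2+4b^2$, $a\equiv-1\pmod4$, $b>0$. For an integer $x$, $\{x\}_p$ denotes the least nonnegative residue of $x$ modulo $p$. Fractions appearing in congruences modulo $p$ (such as $2b/a$) are interpreted using inverses modulo $p$; note $(2b/a)^2\equiv-1\pmod p$. $\#S$ is the cardinality of a finite set $S$. Let $0<a_1<a_2<\dots<a_{(p-1)/4}<p/2$ be all the quadratic residues modulo $p$ in the interval $(0,p/2)$. Then $\{a_1^2\}_p,\dots,\{a_{(p-1)/4}^2\}_p$ are exactly all the biquadratic ($4$-th power) residues modulo $p$ in $(0,p)$, each occurring once. For a primitive root $g\in\mathbb Z$ modulo $p$, the sequence $\{g^4\}_p,\{g^8\}_p,\dots,\{g^{p-1}\}_p$ is a rearrangement of this sequence; $\tau_p(g)$ denotes the corresponding permutation and $\operatorname{sgn}(\tau_p(g))$ its sign. The rational $4$-th power residue symbol $\chi_4(x)=\left(\frac{x}{p}\right)_4$ is $0$ if $p\mid x$, $1$ if $p\nmid x$ and $x$ is a $4$-th power modulo $p$, and $-1$ otherwise. Set $\Omega_1=\{0<x<p/2: x^{(p-1)/4}\equiv1\pmod p\}$, $\Omega_{-1}=\{0<x<p/2: x^{(p-1)/4}\equiv-1\pmod p\}$ ($x$ integers), $A_p=\prod_{t\in\Omega_1}t$, $B_p=\prod_{t\in\Omega_{-1}}t$. One has $A_p^2\equiv(-1)^{(p+7)/8}$ and $B_p^2\equiv(-1)^{(p-1)/8}\pmod p$, so the following elements of $\{0,1\}$ are well defined: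 - if $p\equiv9\pmod{16}$: $\beta_p$ with $(-1)^{\beta_p}\equiv A_p\pmod p$, and $\gamma_p$ with $(-1)^{\gamma_p}\equiv 2bB_p/a\pmod p$; - if $p\equiv1\pmod{16}$ and $g$ is a primitive root modulo $p$: $\delta_p(g)$ with $(-1)^{\delta_p(g)}\equiv A_p/g^{(p-1)/4}\pmod p$, and $\mu_p(g)$ with $(-1)^{\mu_p(g)}\equiv 2bB_p/(a\,g^{(p-1)/4})\pmod p$. Let $U_p=\prod_{1\le i<j\le (p-1)/4}\sin\frac{2\pi(a_j^2-a_i^2)}{p}$ (a nonzero real number), and let $\lambda_p=0$ if $U_p>0$ and $\lambda_p=1$ if $U_p<0$. *)

theory Defs
  imports Complex_Main "HOL-Number_Theory.Number_Theory" "HOL-Combinatorics.Permutations"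
begin

text \<open>The library's \<open>residue_primroot\<close> lives on natural numbers; an integer is a primitive root
  iff its least nonnegative residue is.\<close>

definition int_primroot :: "nat \<Rightarrow> int \<Rightarrow> bool" where
  "int_primroot p g \<longleftrightarrow> residue_primroot p (nat (g mod int p))"

text \<open>\<open>half_qr p i\<close> is the \<open>i\<close>-th smallest quadratic residue in \<open>(0, p/2)\<close>, counted from \<open>i = 1\<close>;
  it is only meaningful for \<open>1 \<le> i \<le> (p - 1) div 4\<close>.\<close>

definition half_qr :: "nat \<Rightarrow> nat \<Rightarrow> int" where
  "half_qr p i = sorted_list_of_set {x. 0 < x \<and> 2 * x < int p \<and> QuadRes (int p) x} ! (i - 1)"

definition tau :: "nat \<Rightarrow> int \<Rightarrow> int \<Rightarrow> int" where
  "tau p g = (THE \<sigma>.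
     \<sigma> permutes (\<lambda>i. (half_qr p i)\<^sup>2 mod int p) ` {1..(p - 1) div 4} \<and>
     (\<forall>i\<in>{1..(p - 1) div 4}. \<sigma> ((half_qr p i)\<^sup>2 mod int p) = g ^ (4 * i) mod int p))"

definition chi4 :: "nat \<Rightarrow> int \<Rightarrow> int" where
  "chi4 p x = (if int p dvd x then 0
               else if \<exists>y. [y ^ 4 = x] (mod int p) then 1
               else -1)"

definition Omega :: "nat \<Rightarrow> int \<Rightarrow> int set" where
  "Omega p \<epsilon> = {x. 0 < x \<and> 2 * x < int p \<and> [x ^ ((p - 1) div 4) = \<epsilon>] (mod int p)}"

definition A_prod :: "nat \<Rightarrow> int" where
  "A_prod p = \<Prod>(Omega p 1)"

definition B_prod :: "nat \<Rightarrow> int" where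
  "B_prod p = \<Prod>(Omega p (-1))"

text \<open>The exponent \<open>e \<in> {0, 1}\<close> with \<open>(-1) ^ e\<close> congruent to \<open>x\<close>; it exists (and is unique for
  \<open>p > 2\<close>) exactly when \<open>x\<close> is congruent to \<open>1\<close> or \<open>-1\<close>.\<close>

definition sign_exponent :: "nat \<Rightarrow> int \<Rightarrow> nat" where
  "sign_exponent p x = (THE e. e \<in> {0, 1} \<and> [(-1) ^ e = x] (mod int p))"

definition beta :: "nat \<Rightarrow> nat" where
  "beta p = sign_exponent p (A_prod p)"

definition gamma :: "nat \<Rightarrow> int \<Rightarrow> int \<Rightarrow> nat" where
  "gamma p a b = sign_exponent p (2 * b * B_prod p * modular_inverse (int p) a)"

definition delta :: "nat \<Rightarrow> int \<Rightarrow> nat" where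
  "delta p g = sign_exponent p (A_prod p * modular_inverse (int p) (g ^ ((p - 1) div 4)))"

definition mu :: "nat \<Rightarrow> int \<Rightarrow> int \<Rightarrow> int \<Rightarrow> nat" where
  "mu p a b g =
     sign_exponent p (2 * b * B_prod p * modular_inverse (int p) (a * g ^ ((p - 1) div 4)))"

definition U_prod :: "nat \<Rightarrow> real" where
  "U_prod p = (\<Prod>(i, j) | 1 \<le> i \<and> i < j \<and> j \<le> (p - 1) div 4.
     sin (2 * pi * real_of_int ((half_qr p j)\<^sup>2 - (half_qr p i)\<^sup>2) / real p))"

text \<open>\<open>U_prod p\<close> is nonzero for the primes under consideration.\<close>

definition lam :: "nat \<Rightarrow> nat" where
  "lam p = (if U_prod p > 0 then 0 else 1)"

text \<open>\<open>s = (-1) ^ (e + n / 32)\<close>, including the assertion that \<open>n / 32\<close> is an integer. The base is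
  real because \<open>powi\<close> requires a type with inverses.\<close>

definition is_sign_power :: "int \<Rightarrow> nat \<Rightarrow> int \<Rightarrow> bool" where
  "is_sign_power s e n \<longleftrightarrow> 32 dvd n \<and> real_of_int s = (-1) powi (int e + n div 32)"

end

theory Submission
  imports Defs "HOL-Computational_Algebra.Polynomial"
begin

text \<open>Write \<open>p = 8 * m + 1\<close>. Since the sign of a permutation is the quotient of two difference
  products, \<open>sgn \<tau>\<close> times \<open>\<Prod> (a\<^sub>j\<^sup>2 - a\<^sub>i\<^sup>2)\<close> is congruent modulo \<open>p\<close> to the Vandermonde product of the
  powers of \<open>g\<^sup>4\<close>, a primitive root of unity of order \<open>2 * m\<close>; the latter has a closed form in
  \<open>2 ^ (2 * m)\<close> and \<open>g ^ (2 * m)\<close>.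

  Reducing each \<open>a\<^sub>j\<^sup>2 - a\<^sub>i\<^sup>2\<close> to its absolutely least residue costs the sign of the corresponding
  sine, so the remaining product is \<open>(-1) ^ \<lambda>\<close> times the product of \<open>k ^ N k\<close> over \<open>0 < k < p / 2\<close>,
  where \<open>N k\<close> counts the representations of \<open>k\<close> as a difference of two biquadratic residues. This
  number depends only on the class \<open>k ^ (2 * m)\<close>; it is expressed through the Jacobsthal sum
  \<open>\<phi> k = \<Sum>x. \<psi> x * \<psi> (x\<^sup>2 + k)\<close>, which equals \<open>2 * a\<close> at \<open>k = 1\<close> and \<open>4 * b\<close> where \<open>k ^ (2 * m)\<close> is
  \<open>2 * b / a\<close>. The product of the elements of a class is a square root of the class up to sign, and
  the parity of \<open>N 1\<close> decides whether 2 is a biquadratic residue.\<close>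

subsection \<open>Permutation signs and difference products\<close>

text \<open>Class products are known modulo \<open>p\<close> only up to sign, so the four cases
  arise from parities of exponents. On the classes of \<open>J = 2 * b / a\<close> and
  \<open>- J\<close> the counts \<open>N\<close> are even: only squares of these class products
  enter, and since \<open>J * (- J)\<close> is congruent to 1 they collapse, up to sign, to
  \<open>J ^ (b / 2)\<close>. On the classes of 1 and -1 the counts have opposite parities, decided
  by \<open>b / 2\<close>, so exactly one of \<open>A_prod p\<close> and \<open>B_prod p\<close>
  survives to an odd power. The same parity decides whether 2 is a biquadratic residue, which ties
  \<open>beta\<close> and \<open>delta\<close> to \<open>chi4 p 2 = 1\<close>, and
  \<open>gamma\<close> and \<open>mu\<close> to \<open>chi4 p 2 = -1\<close>. The surviving factor,
  \<open>A_prod p\<close> or \<open>J * B_prod p\<close>, has square \<open>(-1) ^ (m + 1)\<close>.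
  For odd \<open>m\<close> it is a sign; for even \<open>m\<close> it is a sign times
  \<open>g ^ (2 * m)\<close>, matched by an odd power of \<open>g ^ (2 * m)\<close> in the
  Vandermonde product. Moments give the Jacobsthal sums only up to sign. The sign of
  \<open>\<phi> 1\<close> comes from the integrality of \<open>N 1\<close>, which is why
  \<open>a\<close> is normalised modulo 4; the sign at a nonresidue comes from a congruence modulo
  \<open>p\<close>.\<close>

lemma prod_pairs_insert:
  fixes key :: "'a \<Rightarrow> 'b::linorder" and G :: "'a \<Rightarrow> 'a \<Rightarrow> 'c::comm_monoid_mult"
  assumes "finite S" "c \<notin> S" "inj_on key (insert c S)"
  shows "(\<Prod>(x, y) | x \<in> insert c S \<and> y \<in> insert c S \<and> key x < key y. G x y) =
    (\<Prod>x\<in>S. if key x < key c then G x c else G c x) *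
    (\<Prod>(x, y) | x \<in> S \<and> y \<in> S \<and> key x < key y. G x y)"
proof -
  let ?P = "{(x, y). x \<in> S \<and> y \<in> S \<and> key x < key y}"
  let ?h = "\<lambda>x. if key x < key c then (x, c) else (c, x)"
  have ne: "key x \<noteq> key c" if "x \<in> S" for x
    using assms that by (auto simp: inj_on_def)
  have eq: "{(x, y). x \<in> insert c S \<and> y \<in> insert c S \<and> key x < key y} = ?h ` S \<union> ?P"
    using ne by (force simp: image_iff)
  have fin: "finite ?P"
    by (rule finite_subset[of _ "S \<times> S"]) (use assms in auto)
  have disj: "?h ` S \<inter> ?P = {}"
    using assms(2) by (auto split: if_splits)
  have inj: "inj_on ?h S"
    using assms(2) by (auto simp: inj_on_def split: if_splits)
  have "(\<Prod>(x, y)\<in>?h ` S. G x y) = (\<Prod>x\<in>S. if key x < key c then G x c else G c x)"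
    by (subst prod.reindex[OF inj]) (auto intro: prod.cong)
  then show ?thesis
    unfolding eq using prod.union_disjoint[OF _ fin disj, of "\<lambda>(x, y). G x y"] assms(1) by simp
qed

text \<open>The pair formed by \<open>a\<close> and \<open>b\<close> contributes the minus sign. For
  any other \<open>x\<close>, the two factors joining it to \<open>a\<close> and \<open>b\<close>
  are interchanged, with either both signs changed or none.\<close>

lemma prod_pairs_transpose:
  fixes key :: "'a \<Rightarrow> 'b::linorder" and f :: "'a \<Rightarrow> 'c::comm_ring_1"
  assumes "finite S" "inj_on key S" "a \<in> S" "b \<in> S" "a \<noteq> b"
  shows "(\<Prod>(x, y) | x \<in> S \<and> y \<in> S \<and> key x < key y.
            f (Transposition.transpose a b y) - f (Transposition.transpose a b x)) =
    - (\<Prod>(x, y) | x \<in> S \<and> y \<in> S \<and> key x < key y. f y - f x)"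
proof -
  have *: "(\<Prod>(x, y) | x \<in> S \<and> y \<in> S \<and> key x < key y.
            f (Transposition.transpose a b y) - f (Transposition.transpose a b x)) =
    - (\<Prod>(x, y) | x \<in> S \<and> y \<in> S \<and> key x < key y. f y - f x)"
    if "a \<in> S" "b \<in> S" "a \<noteq> b" "key a < key b" for a b
  proof -
    let ?t = "Transposition.transpose a b"
    define T where "T = S - {a, b}"
    have T: "finite T" "a \<notin> T" "b \<notin> T" "a \<notin> insert b T" and S: "S = insert a (insert b T)"
      using that assms(1) by (auto simp: T_def)
    have inj: "inj_on key (insert a (insert b T))" "inj_on key (insert b T)"
      using assms(2) unfolding S by (auto intro: inj_on_subset)
    have t: "?t x = x" if "x \<in> T" for x
      using that T by (intro transpose_apply_other) auto
    have ne: "key x \<noteq> key a" "key x \<noteq> key b" if "x \<in> T" for x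
      using that T inj by (auto simp: inj_on_def)
    have finT: "finite (insert b T)" using T by simp
    \<comment> \<open>An \<open>x\<close> strictly between \<open>a\<close> and \<open>b\<close> in
      the order of \<open>key\<close> reverses both of its factors; any other \<open>x\<close> only
      swaps them.\<close>
    have mid: "(\<Prod>x\<in>T. if key x < key a then f (?t a) - f (?t x) else f (?t x) - f (?t a)) *
        (\<Prod>x\<in>T. if key x < key b then f (?t b) - f (?t x) else f (?t x) - f (?t b)) =
        (\<Prod>x\<in>T. if key x < key a then f a - f x else f x - f a) *
        (\<Prod>x\<in>T. if key x < key b then f b - f x else f x - f b)"
      unfolding prod.distrib[symmetric]
    proof (rule prod.cong)
      fix x assume "x \<in> T"
      with t ne[of x] show "(if key x < key a then f (?t a) - f (?t x) else f (?t x) - f (?t a)) *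
        (if key x < key b then f (?t b) - f (?t x) else f (?t x) - f (?t b)) =
        (if key x < key a then f a - f x else f x - f a) *
        (if key x < key b then f b - f x else f x - f b)"
        using that(4) by (auto simp: algebra_simps)
    qed simp
    have low: "(\<Prod>(x, y) | x \<in> T \<and> y \<in> T \<and> key x < key y. f (?t y) - f (?t x)) =
        (\<Prod>(x, y) | x \<in> T \<and> y \<in> T \<and> key x < key y. f y - f x)"
      by (rule prod.cong) (auto simp: t)
    have ab: "\<not> key b < key a"
      using that(4) by simp
    have W: "(\<Prod>(x, y) | x \<in> S \<and> y \<in> S \<and> key x < key y. G x y) =
        G a b * ((\<Prod>x\<in>T. if key x < key a then G x a else G a x) *
        (\<Prod>x\<in>T. if key x < key b then G x b else G b x)) *
        (\<Prod>(x, y) | x \<in> T \<and> y \<in> T \<and> key x < key y. G x y)" for G :: "'a \<Rightarrow> 'a \<Rightarrow> 'c"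
      unfolding S prod_pairs_insert[OF finT T(4) inj(1)] prod_pairs_insert[OF T(1,3) inj(2)]
        prod.insert[OF T(1,3)]
      using ab by (simp add: mult_ac)
    show ?thesis
      unfolding W mid low by (simp flip: mult_minus_left)
  qed
  have "key a < key b \<or> key b < key a"
    using assms by (meson inj_onD linorder_less_linear)
  then show ?thesis
    using *[of a b] *[of b a] assms by (auto simp: transpose_commute)
qed

text \<open>Transpositions are peeled off on the right, each costing one sign by the previous lemma
  applied to \<open>f \<circ> q\<close>. The order \<open>key\<close> is separate from the values of
  \<open>f\<close> because the biquadratic residues will be ordered by index, not by size.\<close>

lemma sign_eq_prod_differences:
  fixes key :: "'a \<Rightarrow> 'b::linorder" and f :: "'a \<Rightarrow> int"
  assumes "finite S" "inj_on key S" "\<sigma> permutes S"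
  shows "(\<Prod>(x, y) | x \<in> S \<and> y \<in> S \<and> key x < key y. f (\<sigma> y) - f (\<sigma> x)) =
    sign \<sigma> * (\<Prod>(x, y) | x \<in> S \<and> y \<in> S \<and> key x < key y. f y - f x)"
  using assms(1,3)
proof (induction rule: permutes_rev_induct)
  case id
  then show ?case by simp
next
  case (swap a b q)
  have "sign (q \<circ> Transposition.transpose a b) = - sign q"
    using swap assms(1)
    by (subst sign_compose)
       (auto simp: sign_swap_id permutation_swap_id intro: permutation_permutes[THEN iffD2])
  then show ?case
    using prod_pairs_transpose[OF assms(1,2) swap(1-3), of "f \<circ> q"] swap
    by (simp add: comp_def)
qed

text \<open>Lagrange's bound on roots modulo a prime, kept with integer polynomials: synthetic
  division by one root lowers the degree, and primality makes the quotient inherit the other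
  roots.\<close>

lemma poly_vanishes_mod_prime:
  fixes e :: "int poly" and q :: int
  assumes "prime q" "finite X" "X \<noteq> {}" "degree e < card X"
    and "\<And>x y. x \<in> X \<Longrightarrow> y \<in> X \<Longrightarrow> [x = y] (mod q) \<Longrightarrow> x = y"
    and "\<And>x. x \<in> X \<Longrightarrow> q dvd poly e x"
  shows "q dvd poly e y"
  using assms(2-)
proof (induction X arbitrary: e y rule: finite_ne_induct)
  case (singleton x)
  then have "degree e = 0" by simp
  then obtain c where "e = [:c:]" by (rule degree_eq_zeroE)
  then show ?case using singleton(3)[of x] by simp
next
  case (insert x X)
  define r where "r = synthetic_div e x"
  have "degree e < Suc (card X)"
    using insert by simp
  moreover have "card X > 0"
    using insert by (simp add: card_gt_0_iff)
  ultimately have "degree r < card X"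
    by (simp add: r_def degree_synthetic_div)
  have e: "poly e z = poly r z * (z - x) + poly e x" for z
    unfolding r_def using arg_cong[OF synthetic_div_correct'[of x e], of "\<lambda>u. poly u z"]
    by (simp add: algebra_simps)
  have ex: "q dvd poly e x" using insert by simp
  have "q dvd poly r z" if "z \<in> X" for z
  proof -
    have "q dvd poly r z * (z - x)"
      using ex insert.prems(3)[of z] that e[of z] by (metis dvd_add_left_iff insertI2)
    moreover have "\<not> q dvd z - x"
      using insert.prems(2)[of z x] that insert.hyps by (auto simp: cong_iff_dvd_diff)
    ultimately show ?thesis
      using \<open>prime q\<close> prime_dvd_mult_iff by blast
  qed
  then have "q dvd poly r y"
    using insert.IH[of r y] \<open>degree r < card X\<close> insert.prems(2) by simp
  then show ?case
    using ex e[of y] by simp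
qed

subsection \<open>Sums over residues modulo a prime congruent to 1 modulo 8\<close>

text \<open>With \<open>m = (p - 1) / 8\<close> the quadratic character is
  \<open>x ^ (4 * m)\<close> and the quartic one \<open>x ^ (2 * m)\<close>. There are
  \<open>2 * m\<close> biquadratic residues, and each quartic class meets the half interval in
  \<open>m\<close> elements.\<close>

locale prime_1_mod_8 =
  fixes p m :: nat
  assumes prime_p: "prime p" and p_eq: "p = 8 * m + 1"
begin

abbreviation P :: int where "P \<equiv> int p"
abbreviation cg :: "int \<Rightarrow> int \<Rightarrow> bool" (infix "\<simeq>" 50) where "x \<simeq> y \<equiv> [x = y] (mod P)"
abbreviation \<psi> :: "int \<Rightarrow> int" where "\<psi> x \<equiv> Legendre x P"
abbreviation F :: "int set" where "F \<equiv> {0..<P}"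

lemma m_pos: "m > 0"
  using prime_p p_eq by (cases m) auto

lemma P_ge: "P \<ge> 9" and P_eq: "P = 8 * int m + 1"
  using m_pos p_eq by linarith+

lemma prime_P: "prime P"
  using prime_p by simp

lemma cong_imp_eq: "x \<simeq> y \<Longrightarrow> \<bar>x - y\<bar> < P \<Longrightarrow> x = y"
  using dvd_imp_le_int[of "x - y" P] by (auto simp: cong_iff_dvd_diff)

lemma dvd_small: "P dvd x \<Longrightarrow> \<bar>x\<bar> < P \<Longrightarrow> x = 0"
  using dvd_imp_le_int[of x P] by auto

lemma dvd_mult_iff: "P dvd x * y \<longleftrightarrow> P dvd x \<or> P dvd y"
  using prime_P by (rule prime_dvd_mult_iff)

lemma dvd_power_iff: "n > 0 \<Longrightarrow> P dvd x ^ n \<longleftrightarrow> P dvd x"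
  using prime_P by (simp add: prime_dvd_power_iff)

lemma not_dvd_small: "x \<noteq> 0 \<Longrightarrow> \<bar>x\<bar> < P \<Longrightarrow> \<not> P dvd x"
  using dvd_small by blast

lemma cong_mult_cancel: "\<not> P dvd c \<Longrightarrow> c * x \<simeq> c * y \<longleftrightarrow> x \<simeq> y"
  by (simp add: cong_iff_dvd_diff dvd_mult_iff flip: right_diff_distrib)

lemma cong_dvd: "x \<simeq> y \<Longrightarrow> P dvd x \<longleftrightarrow> P dvd y"
  by (rule cong_dvd_iff)

lemma cong_square_iff: "x\<^sup>2 \<simeq> y\<^sup>2 \<longleftrightarrow> x \<simeq> y \<or> x \<simeq> - y"
proof -
  have "x\<^sup>2 - y\<^sup>2 = (x - y) * (x + y)" by (simp add: power2_eq_square algebra_simps)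
  then show ?thesis by (simp add: cong_iff_dvd_diff dvd_mult_iff)
qed

lemma \<psi>_cong: "x \<simeq> y \<Longrightarrow> \<psi> x = \<psi> y"
  by (simp add: Legendre_def QuadRes_def cong_def)

lemma \<psi>_eq_0_iff: "\<psi> x = 0 \<longleftrightarrow> P dvd x"
  by (auto simp: Legendre_def cong_0_iff)

lemma \<psi>_cases: "\<psi> x \<in> {-1, 0, 1}"
  by (auto simp: Legendre_def)

lemma \<psi>_euler: "\<psi> x \<simeq> x ^ (4 * m)"
proof -
  have "(p - 1) div 2 = 4 * m" "2 < p" using p_eq m_pos by auto
  then show ?thesis using euler_criterion[of p x] prime_p by simp
qed

lemma \<psi>_mult: "\<psi> (x * y) = \<psi> x * \<psi> y"
proof (rule cong_imp_eq)
  have "\<psi> (x * y) \<simeq> (x * y) ^ (4 * m)" by (rule \<psi>_euler)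
  also have "(x * y) ^ (4 * m) = x ^ (4 * m) * y ^ (4 * m)" by (rule power_mult_distrib)
  also have "\<dots> \<simeq> \<psi> x * \<psi> y" by (intro cong_mult cong_sym[OF \<psi>_euler])
  finally show "\<psi> (x * y) \<simeq> \<psi> x * \<psi> y" .
  show "\<bar>\<psi> (x * y) - \<psi> x * \<psi> y\<bar> < P"
    using \<psi>_cases[of x] \<psi>_cases[of y] \<psi>_cases[of "x * y"] P_ge by auto
qed

lemma \<psi>_square: "\<not> P dvd x \<Longrightarrow> \<psi> (x\<^sup>2) = 1"
  using \<psi>_cases[of x] \<psi>_eq_0_iff[of x] by (auto simp: power2_eq_square \<psi>_mult)

lemma \<psi>_0 [simp]: "\<psi> 0 = 0"
  by (simp add: Legendre_def)

lemma \<psi>_1 [simp]: "\<psi> 1 = 1"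
  using \<psi>_square[of 1] not_dvd_small[of 1] P_ge by simp

lemma \<psi>_mult_self: "\<psi> x * \<psi> x = (if P dvd x then 0 else 1)"
  using \<psi>_cases[of x] \<psi>_eq_0_iff[of x] by auto

text \<open>An affine map with unit slope permutes the residue classes, and \<open>f\<close> sees
  only classes. All changes of variable in character sums rest on this.\<close>

lemma sum_affine:
  fixes f :: "int \<Rightarrow> int"
  assumes f: "\<And>x y. x \<simeq> y \<Longrightarrow> f x = f y" and c: "\<not> P dvd c"
  shows "(\<Sum>x\<in>F. f (c * x + d)) = (\<Sum>x\<in>F. f x)"
proof -
  let ?h = "\<lambda>x. (c * x + d) mod P"
  have inj: "inj_on ?h F"
  proof (rule inj_onI)
    fix x y assume xy: "x \<in> F" "y \<in> F" "?h x = ?h y"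
    then have "c * x + d \<simeq> c * y + d" by (simp add: cong_def)
    then have "x \<simeq> y" using cong_mult_cancel[OF c] by (simp add: cong_add_rcancel)
    then show "x = y" by (rule cong_imp_eq) (use xy in auto)
  qed
  have "?h ` F \<subseteq> F" using P_ge by auto
  then have "?h ` F = F" using inj by (intro endo_inj_surj) auto
  then have "(\<Sum>x\<in>F. f x) = (\<Sum>x\<in>F. f (?h x))"
    using sum.reindex[OF inj, of f] by simp
  also have "\<dots> = (\<Sum>x\<in>F. f (c * x + d))"
    by (intro sum.cong f) auto
  finally show ?thesis by simp
qed

lemma sum_scale:
  fixes f :: "int \<Rightarrow> int"
  assumes "\<And>x y. x \<simeq> y \<Longrightarrow> f x = f y" "\<not> P dvd c"
  shows "(\<Sum>x\<in>F. f (c * x)) = (\<Sum>x\<in>F. f x)"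
  using sum_affine[OF assms, where d = 0] by simp

lemma sum_shift:
  fixes f :: "int \<Rightarrow> int"
  assumes "\<And>x y. x \<simeq> y \<Longrightarrow> f x = f y"
  shows "(\<Sum>x\<in>F. f (x + d)) = (\<Sum>x\<in>F. f x)"
  using sum_affine[OF assms, where c = 1 and d = d] not_dvd_small[of 1] P_ge by simp

lemma F_mod: "x mod P \<in> F" "x mod P \<simeq> x"
  using P_ge by auto

lemma F_cong_eq: "x \<in> F \<Longrightarrow> y \<in> F \<Longrightarrow> x \<simeq> y \<Longrightarrow> x = y"
  by (rule cong_imp_eq) auto

lemma F_cong_iff: "x \<in> F \<and> x \<simeq> y \<longleftrightarrow> x = y mod P"
  using F_mod[of y] by (auto simp: cong_def)

lemma F_dvd_iff: "x \<in> F \<Longrightarrow> P dvd x \<longleftrightarrow> x = 0"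
  using dvd_small by auto

section \<open>Integer primitive roots and their powers\<close>

lemma primroot_not_dvd:
  assumes "int_primroot p g"
  shows "\<not> P dvd g"
proof
  assume "P dvd g"
  then have "nat (g mod P) = 0" by simp
  then show False using assms prime_p by (auto simp: int_primroot_def)
qed

text \<open>The order of \<open>g\<close> is \<open>totient p = 8 * m\<close>. In this form every
  later comparison of powers of \<open>g\<close> becomes arithmetic on exponents.\<close>

lemma primroot_power_cong_iff:
  assumes "int_primroot p g"
  shows "g ^ d \<simeq> g ^ e \<longleftrightarrow> [d = e] (mod 8 * m)"
proof -
  define g' where "g' = nat (g mod P)"
  have g': "int g' \<simeq> g" using P_ge by (simp add: g'_def)
  have r: "coprime p g'" "ord p g' = totient p"
    using assms by (auto simp: int_primroot_def residue_primroot_def g'_def)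
  have "totient p = 8 * m" using prime_p p_eq by (simp add: totient_prime)
  then have "[g' ^ d = g' ^ e] (mod p) \<longleftrightarrow> [d = e] (mod 8 * m)"
    using order_divides_expdiff[OF r(1)] r(2) by simp
  moreover have "[g' ^ d = g' ^ e] (mod p) \<longleftrightarrow> int g' ^ d \<simeq> int g' ^ e"
    by (simp flip: cong_int_iff)
  moreover have "int g' ^ d \<simeq> int g' ^ e \<longleftrightarrow> g ^ d \<simeq> g ^ e"
    using cong_pow[OF g', of d] cong_pow[OF g', of e] by (simp add: cong_def)
  ultimately show ?thesis by blast
qed

lemma primroot_exists: "\<exists>g. int_primroot p g"
proof -
  obtain x where "residue_primroot p x"
    using prime_primitive_root_exists[of p] prime_p prime_gt_1_nat by blast
  then have "int_primroot p (int x)"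
    by (simp add: int_primroot_def nat_mod_distrib)
  then show ?thesis ..
qed

lemma primroot_generates:
  assumes "int_primroot p g" "\<not> P dvd x"
  obtains e where "e < 8 * m" "x \<simeq> g ^ e"
proof -
  define g' where "g' = nat (g mod P)"
  have g': "int g' \<simeq> g" using P_ge by (simp add: g'_def)
  have "residue_primroot p g'" using assms by (auto simp: int_primroot_def g'_def)
  then have bij: "bij_betw (\<lambda>i. g' ^ i mod p) {..<totient p} (totatives p)"
    using prime_p prime_gt_1_nat by (intro residue_primroot_is_generator) auto
  have tot: "totient p = 8 * m" using prime_p p_eq by (simp add: totient_prime)
  have "x mod P \<noteq> 0" using assms by (auto simp: dvd_eq_mod_eq_0)
  moreover have "0 \<le> x mod P" "x mod P < P" using P_ge by auto
  ultimately have "nat (x mod P) \<in> totatives p"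
    using prime_p by (auto simp: totatives_prime)
  then obtain e where e: "e < 8 * m" "g' ^ e mod p = nat (x mod P)"
    using bij tot unfolding bij_betw_def by (metis (no_types, lifting) imageE lessThan_iff)
  have "int (g' ^ e mod p) = x mod P"
    using e(2) \<open>0 \<le> x mod P\<close> by simp
  then have "int g' ^ e \<simeq> x"
    by (simp add: cong_def zmod_int)
  then have "x \<simeq> g ^ e"
    using cong_pow[OF g', of e] by (simp add: cong_def)
  then show thesis using that e by blast
qed

lemma primroot_power_4m:
  assumes "int_primroot p g"
  shows "g ^ (4 * m) \<simeq> -1"
proof -
  have "(g ^ (4 * m))\<^sup>2 \<simeq> 1\<^sup>2"
    using primroot_power_cong_iff[OF assms, of "8 * m" 0]
    by (simp add: cong_0_iff flip: power_mult)
  moreover have "\<not> g ^ (4 * m) \<simeq> 1"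
    using primroot_power_cong_iff[OF assms, of "4 * m" 0] m_pos
    by (auto simp: cong_0_iff dest: dvd_imp_le)
  ultimately show ?thesis by (simp only: cong_square_iff) simp
qed

lemma \<psi>_primroot: "int_primroot p g \<Longrightarrow> \<psi> g = -1"
  using cong_trans[OF \<psi>_euler primroot_power_4m] \<psi>_cases[of g] P_ge
  by (intro cong_imp_eq) auto

section \<open>Character sums and the fibres of the squaring map\<close>

lemma sum_\<psi>: "(\<Sum>x\<in>F. \<psi> x) = 0"
proof -
  obtain g where g: "int_primroot p g" using primroot_exists ..
  have "(\<Sum>x\<in>F. \<psi> (g * x)) = (\<Sum>x\<in>F. \<psi> x)"
    using \<psi>_cong primroot_not_dvd[OF g] by (rule sum_scale)
  then show ?thesis by (simp add: \<psi>_mult \<psi>_primroot[OF g] sum_negf)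
qed

lemma \<psi>_eq_1_imp_square:
  assumes "\<psi> x = 1"
  obtains y where "\<not> P dvd y" "x \<simeq> y\<^sup>2"
proof -
  obtain y where y: "y\<^sup>2 \<simeq> x" and "\<not> P dvd x"
    using assms by (auto simp: Legendre_def QuadRes_def cong_0_iff split: if_splits)
  then have "\<not> P dvd y" using cong_dvd[OF y] by (simp add: dvd_power_iff)
  then show thesis using that y cong_sym by blast
qed

lemma card_square_roots: "int (card {v \<in> F. v\<^sup>2 \<simeq> c}) = 1 + \<psi> c"
proof -
  consider "\<psi> c = 0" | "\<psi> c = 1" | "\<psi> c = -1" using \<psi>_cases by blast
  then show ?thesis
  proof cases
    case 1
    then have "P dvd c" by (simp add: \<psi>_eq_0_iff)
    then have "v\<^sup>2 \<simeq> c \<longleftrightarrow> v\<^sup>2 \<simeq> 0" for v by (simp add: cong_def)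
    then have "v\<^sup>2 \<simeq> c \<longleftrightarrow> P dvd v" for v by (simp add: cong_0_iff dvd_power_iff)
    then have "{v \<in> F. v\<^sup>2 \<simeq> c} = {v \<in> F. v = 0}"
      using F_dvd_iff by blast
    also have "{v \<in> F. v = 0} = {0}"
      using P_ge by auto
    finally have "{v \<in> F. v\<^sup>2 \<simeq> c} = {0}" .
    then show ?thesis using 1 by simp
  next
    case 2
    then obtain r where r: "\<not> P dvd r" "c \<simeq> r\<^sup>2" by (rule \<psi>_eq_1_imp_square)
    have "\<not> r \<simeq> - r"
    proof
      assume "r \<simeq> - r"
      then have "P dvd 2 * r" by (simp add: cong_iff_dvd_diff)
      then show False using r not_dvd_small[of 2] P_ge by (simp add: dvd_mult_iff)
    qed
    then have ne: "r mod P \<noteq> (- r) mod P" by (simp add: cong_def)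
    have "{v \<in> F. v\<^sup>2 \<simeq> c} = {r mod P, (- r) mod P}"
    proof (rule Set.set_eqI)
      fix v
      have "v\<^sup>2 \<simeq> c \<longleftrightarrow> v\<^sup>2 \<simeq> r\<^sup>2" using r(2) by (simp add: cong_def)
      then have "v\<^sup>2 \<simeq> c \<longleftrightarrow> v \<simeq> r \<or> v \<simeq> - r" by (simp only: cong_square_iff)
      then show "v \<in> {v \<in> F. v\<^sup>2 \<simeq> c} \<longleftrightarrow> v \<in> {r mod P, (- r) mod P}"
        unfolding mem_Collect_eq insert_iff empty_iff F_cong_iff[symmetric] by blast
    qed
    then show ?thesis using 2 ne by simp
  next
    case 3
    have *: "{v \<in> F. v\<^sup>2 \<simeq> c} = {}"
    proof (rule ccontr)
      assume "{v \<in> F. v\<^sup>2 \<simeq> c} \<noteq> {}"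
      then obtain v where "v\<^sup>2 \<simeq> c" by blast
      then have "\<psi> v * \<psi> v = -1" using 3 \<psi>_cong[of "v\<^sup>2" c] by (simp add: \<psi>_mult power2_eq_square)
      then show False by (auto simp: \<psi>_mult_self split: if_splits)
    qed
    show ?thesis unfolding * using 3 by simp
  qed
qed

lemma sum_squares:
  fixes f :: "int \<Rightarrow> int"
  assumes f: "\<And>x y. x \<simeq> y \<Longrightarrow> f x = f y"
  shows "(\<Sum>w\<in>F. f (w\<^sup>2)) = (\<Sum>y\<in>F. (1 + \<psi> y) * f y)"
proof -
  have "f (w\<^sup>2) = (\<Sum>y\<in>F. if w\<^sup>2 \<simeq> y then f y else 0)" for w
  proof -
    have "(\<Sum>y\<in>F. if w\<^sup>2 \<simeq> y then f y else 0) = (\<Sum>y\<in>F. if y = w\<^sup>2 mod P then f (w\<^sup>2) else 0)"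
      using F_mod by (intro sum.cong) (auto simp: cong_def intro: f)
    then show ?thesis using F_mod[of "w\<^sup>2"] by simp
  qed
  then have "(\<Sum>w\<in>F. f (w\<^sup>2)) = (\<Sum>w\<in>F. \<Sum>y\<in>F. if w\<^sup>2 \<simeq> y then f y else 0)"
    by simp
  also have "\<dots> = (\<Sum>y\<in>F. \<Sum>w\<in>F. if w\<^sup>2 \<simeq> y then f y else 0)"
    by (rule sum.swap)
  also have "\<dots> = (\<Sum>y\<in>F. (1 + \<psi> y) * f y)"
    by (simp flip: sum.inter_filter card_square_roots)
  finally show ?thesis .
qed

lemma sum_F_split: "(\<Sum>x\<in>F. f x) = f 0 + (\<Sum>x\<in>F - {0}. f x)"
  using P_ge by (intro sum.remove) auto

lemma card_F_0: "int (card (F - {0})) = P - 1"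
  using P_ge by (simp add: of_nat_diff)

text \<open>The values \<open>k * w\<^sup>2\<close> run twice through the square class of
  \<open>k\<close>, where \<open>f\<close> is constant. So \<open>f\<close> is determined off 0 by
  two moments, the plain sum and the sum twisted by \<open>\<psi>\<close>; this evaluates both
  \<open>\<phi>\<^sup>2\<close> and \<open>diff_sum\<close>.\<close>

lemma sum_over_class:
  fixes f :: "int \<Rightarrow> int"
  assumes f: "\<And>x y. x \<simeq> y \<Longrightarrow> f x = f y" and sq: "\<And>w. \<not> P dvd w \<Longrightarrow> f (k * w\<^sup>2) = f k"
    and k: "\<not> P dvd k"
  shows "(P - 1) * f k = (\<Sum>x\<in>F - {0}. f x) + \<psi> k * (\<Sum>x\<in>F. \<psi> x * f x)"
proof -
  have fk: "f (k * x) = f (k * y)" if "x \<simeq> y" for x y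
    using that by (intro f cong_mult) auto
  have "(\<Sum>w\<in>F. f (k * w\<^sup>2)) = f 0 + (\<Sum>w\<in>F - {0}. f (k * w\<^sup>2))"
    by (subst sum_F_split) simp
  also have "(\<Sum>w\<in>F - {0}. f (k * w\<^sup>2)) = (\<Sum>w\<in>F - {0}. f k)"
    by (intro sum.cong sq) (auto simp: F_dvd_iff)
  also have "\<dots> = (P - 1) * f k"
    using card_F_0 by simp
  finally have "(\<Sum>w\<in>F. f (k * w\<^sup>2)) = f 0 + (P - 1) * f k" .
  moreover have "(\<Sum>w\<in>F. f (k * w\<^sup>2)) = (\<Sum>y\<in>F. (1 + \<psi> y) * f (k * y))"
    using fk by (rule sum_squares)
  \<comment> \<open>Since \<open>\<psi> k * \<psi> k = 1\<close>, the weight can be written in terms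
    of \<open>k * y\<close>, which prepares the rescaling by \<open>k\<close>.\<close>
  moreover have "\<dots> = (\<Sum>y\<in>F. (1 + \<psi> k * \<psi> (k * y)) * f (k * y))"
    using \<psi>_mult_self[of k] k by (simp add: \<psi>_mult flip: mult.assoc)
  moreover have "\<dots> = (\<Sum>y\<in>F. (1 + \<psi> k * \<psi> y) * f y)"
  proof (rule sum_scale[OF _ k, of "\<lambda>y. (1 + \<psi> k * \<psi> y) * f y"])
    fix x y assume "x \<simeq> y"
    then show "(1 + \<psi> k * \<psi> x) * f x = (1 + \<psi> k * \<psi> y) * f y"
      using f[of x y] \<psi>_cong[of x y] by simp
  qed
  moreover have "\<dots> = (\<Sum>y\<in>F. f y) + \<psi> k * (\<Sum>y\<in>F. \<psi> y * f y)"
    by (simp add: algebra_simps sum.distrib sum_distrib_left)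
  moreover have "(\<Sum>y\<in>F. f y) = f 0 + (\<Sum>x\<in>F - {0}. f x)"
    by (rule sum_F_split)
  ultimately show ?thesis by simp
qed

text \<open>Only the difference \<open>d\<close> of the shifts matters. Rescaling by
  \<open>d\<close> shows that all nonzero \<open>d\<close> give the same value \<open>T 1\<close>,
  and this value follows from \<open>T 0 = P - 1\<close> because the \<open>T d\<close> sum to
  0.\<close>

lemma sum_\<psi>_shifts:
  "(\<Sum>k\<in>F. \<psi> (k + A) * \<psi> (k + B)) = (if A \<simeq> B then P - 1 else -1)"
proof -
  define T where "T = (\<lambda>d. \<Sum>k\<in>F. \<psi> k * \<psi> (k + d))"
  have Tc: "T d = T e" if "d \<simeq> e" for d e
    unfolding T_def by (intro sum.cong refl arg_cong2[where f = "(*)"] \<psi>_cong cong_add) (use that in auto)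
  have T0: "T 0 = P - 1"
  proof -
    have "T 0 = (\<Sum>k\<in>F. if k = 0 then 0 else 1)"
      unfolding T_def by (intro sum.cong) (auto simp: \<psi>_mult_self F_dvd_iff)
    also have "\<dots> = (\<Sum>k\<in>F - {0}. 1)"
      by (subst sum_F_split) simp
    finally show ?thesis using card_F_0 by simp
  qed
  have T1: "T d = T 1" if "\<not> P dvd d" for d
  proof -
    have "T d = (\<Sum>k\<in>F. \<psi> (d * k) * \<psi> (d * k + d))"
      unfolding T_def
      by (rule sum_scale[OF _ that, symmetric, of "\<lambda>k. \<psi> k * \<psi> (k + d)"])
         (intro arg_cong2[where f = "(*)"] \<psi>_cong cong_add; simp)
    also have "\<dots> = (\<Sum>k\<in>F. (\<psi> d * \<psi> d) * (\<psi> k * \<psi> (k + 1)))"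
    proof (rule sum.cong)
      fix k
      have "d * k + d = d * (k + 1)" by (simp add: distrib_left)
      then show "\<psi> (d * k) * \<psi> (d * k + d) = (\<psi> d * \<psi> d) * (\<psi> k * \<psi> (k + 1))"
        by (simp only: \<psi>_mult mult_ac)
    qed simp
    finally show ?thesis using that by (simp add: \<psi>_mult_self T_def)
  qed
  have "(\<Sum>d\<in>F. T d) = (\<Sum>k\<in>F. \<Sum>d\<in>F. \<psi> k * \<psi> (k + d))"
    unfolding T_def by (rule sum.swap)
  also have "\<dots> = (\<Sum>k\<in>F. \<psi> k * (\<Sum>d\<in>F. \<psi> (d + k)))"
    by (simp add: sum_distrib_left add.commute)
  also have "\<dots> = 0"
    by (simp add: sum_shift[of \<psi>, OF \<psi>_cong] sum_\<psi>)
  finally have "T 0 + (\<Sum>d\<in>F - {0}. T d) = 0"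
    by (simp add: sum_F_split[of T])
  moreover have "(\<Sum>d\<in>F - {0}. T d) = (\<Sum>d\<in>F - {0}. T 1)"
    by (intro sum.cong T1) (auto simp: F_dvd_iff)
  ultimately have "(P - 1) * (T 1 + 1) = 0"
    using card_F_0 T0 by (simp add: algebra_simps)
  then have T1': "T 1 = -1" using P_ge by simp
  have "(\<Sum>k\<in>F. \<psi> (k + A) * \<psi> (k + B)) = T (B - A)"
  proof -
    have "(\<Sum>k\<in>F. \<psi> (k + A) * \<psi> (k + A + (B - A))) = T (B - A)"
      unfolding T_def
      by (rule sum_shift[of "\<lambda>k. \<psi> k * \<psi> (k + (B - A))"])
         (intro arg_cong2[where f = "(*)"] \<psi>_cong cong_add; simp)
    then show ?thesis by simp
  qed
  then show ?thesis
    using T0 T1 T1' Tc[of "B - A" 0] by (auto simp: cong_iff_dvd_diff dvd_diff_commute)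
qed

end

subsection \<open>Jacobsthal sums\<close>

context prime_1_mod_8 begin

text \<open>Equivalently the sum of \<open>\<psi> (x ^ 3 + k * x)\<close>: for a unit
  \<open>k\<close>, the negative of the Frobenius trace of the curve
  \<open>y\<^sup>2 = x ^ 3 + k * x\<close>.\<close>

definition \<phi> :: "int \<Rightarrow> int" where
  "\<phi> k = (\<Sum>x\<in>F. \<psi> x * \<psi> (x\<^sup>2 + k))"

text \<open>For a nonzero square \<open>k\<close> this is twice its quartic character, both square
  roots having the same \<open>\<psi>\<close>; otherwise it is 0. It measures the boundary terms
  with a vanishing square when differences are counted.\<close>

definition root_sum :: "int \<Rightarrow> int" where
  "root_sum k = (\<Sum>v\<in>F. if v\<^sup>2 \<simeq> k then \<psi> v else 0)"

text \<open>The part with \<open>\<psi> u * \<psi> v\<close> when the indicators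
  \<open>1 + \<psi> u\<close> and \<open>1 + \<psi> v\<close> are multiplied out in the count of
  differences.\<close>

definition diff_sum :: "int \<Rightarrow> int" where
  "diff_sum k = (\<Sum>u\<in>F. \<Sum>v\<in>F. if u\<^sup>2 - v\<^sup>2 \<simeq> k then \<psi> u * \<psi> v else 0)"

lemma sqrt_minus_1_exists: "\<exists>J. J\<^sup>2 \<simeq> -1"
proof -
  obtain g where "int_primroot p g" using primroot_exists ..
  then have "(g ^ (2 * m))\<^sup>2 \<simeq> -1"
    using primroot_power_4m[of g] by (simp add: mult.commute flip: power_mult)
  then show ?thesis ..
qed

text \<open>The exponent \<open>2 * m\<close> is even because \<open>p\<close> is 1 modulo 8, so a
  square root of -1 is itself a square. Hence -1 is a biquadratic residue and \<open>\<phi>\<close>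
  is an even function.\<close>

lemma \<psi>_sqrt_minus_1:
  assumes "J\<^sup>2 \<simeq> -1"
  shows "\<psi> J = 1"
proof (rule cong_imp_eq)
  have "J ^ (4 * m) = (J\<^sup>2) ^ (2 * m)" by (simp flip: power_mult)
  moreover have "(J\<^sup>2) ^ (2 * m) \<simeq> (-1) ^ (2 * m)" by (intro cong_pow assms)
  ultimately have "J ^ (4 * m) \<simeq> 1" by simp
  then show "\<psi> J \<simeq> 1" using \<psi>_euler[of J] by (rule cong_trans[rotated])
  show "\<bar>\<psi> J - 1\<bar> < P" using \<psi>_cases[of J] P_ge by auto
qed

lemma \<psi>_minus_1: "\<psi> (-1) = 1"
proof -
  obtain J where J: "J\<^sup>2 \<simeq> -1" using sqrt_minus_1_exists ..
  then have "\<psi> (-1) = \<psi> J * \<psi> J" using \<psi>_cong[OF J] by (simp add: power2_eq_square \<psi>_mult)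
  then show ?thesis by (simp add: \<psi>_sqrt_minus_1[OF J])
qed

lemma \<psi>_minus [simp]: "\<psi> (- x) = \<psi> x"
  using \<psi>_mult[of "-1" x] by (simp add: \<psi>_minus_1)

lemma \<phi>_cong: "k \<simeq> l \<Longrightarrow> \<phi> k = \<phi> l"
  unfolding \<phi>_def by (intro sum.cong refl arg_cong2[where f = "(*)"] \<psi>_cong cong_add) auto

lemma \<phi>_scale:
  assumes "\<not> P dvd u"
  shows "\<phi> (k * u\<^sup>2) = \<psi> u * \<phi> k"
proof -
  have "\<phi> (k * u\<^sup>2) = (\<Sum>x\<in>F. \<psi> (u * x) * \<psi> ((u * x)\<^sup>2 + k * u\<^sup>2))"
    unfolding \<phi>_def
    by (rule sum_scale[OF _ assms, symmetric, of "\<lambda>x. \<psi> x * \<psi> (x\<^sup>2 + k * u\<^sup>2)"])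
       (intro arg_cong2[where f = "(*)"] \<psi>_cong cong_add cong_pow; simp)
  also have "\<dots> = (\<Sum>x\<in>F. \<psi> u * (\<psi> x * \<psi> (x\<^sup>2 + k)))"
  proof (rule sum.cong)
    fix x
    have "(u * x)\<^sup>2 + k * u\<^sup>2 = u\<^sup>2 * (x\<^sup>2 + k)" by (simp add: power2_eq_square algebra_simps)
    then show "\<psi> (u * x) * \<psi> ((u * x)\<^sup>2 + k * u\<^sup>2) = \<psi> u * (\<psi> x * \<psi> (x\<^sup>2 + k))"
      using \<psi>_square[OF assms] by (simp add: \<psi>_mult)
  qed simp
  finally show ?thesis by (simp add: \<phi>_def sum_distrib_left)
qed

lemma \<phi>_0: "\<phi> 0 = 0"
proof -
  have "\<phi> 0 = (\<Sum>x\<in>F. \<psi> x)"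
    unfolding \<phi>_def
    by (intro sum.cong) (auto simp: power2_eq_square \<psi>_mult \<psi>_mult_self \<psi>_eq_0_iff)
  then show ?thesis by (simp add: sum_\<psi>)
qed

lemma \<phi>_minus: "\<phi> (- k) = \<phi> k"
proof -
  obtain J where J: "J\<^sup>2 \<simeq> -1" using sqrt_minus_1_exists ..
  have "\<not> P dvd J" using \<psi>_sqrt_minus_1[OF J] \<psi>_eq_0_iff[of J] by auto
  then have "\<phi> (k * J\<^sup>2) = \<phi> k" by (simp add: \<phi>_scale \<psi>_sqrt_minus_1[OF J])
  moreover have "\<phi> (k * J\<^sup>2) = \<phi> (k * (-1))" by (intro \<phi>_cong cong_mult J) simp
  ultimately show ?thesis by simp
qed

lemma root_sum_square: "root_sum (x\<^sup>2) = (1 + \<psi> (x\<^sup>2)) * \<psi> x"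
proof -
  have "root_sum (x\<^sup>2) = (\<Sum>v\<in>F. if v\<^sup>2 \<simeq> x\<^sup>2 then \<psi> x else 0)"
    unfolding root_sum_def
  proof (rule sum.cong)
    fix v
    show "(if v\<^sup>2 \<simeq> x\<^sup>2 then \<psi> v else 0) = (if v\<^sup>2 \<simeq> x\<^sup>2 then \<psi> x else 0)"
      using \<psi>_cong[of v x] \<psi>_cong[of v "- x"] by (auto simp: cong_square_iff)
  qed simp
  also have "\<dots> = (1 + \<psi> (x\<^sup>2)) * \<psi> x"
    by (simp flip: sum.inter_filter card_square_roots)
  finally show ?thesis .
qed

lemma sum_root_sum_square: "(\<Sum>x\<in>F. \<psi> x * root_sum (x\<^sup>2)) = 2 * (P - 1)"
proof -
  have "(\<Sum>x\<in>F. \<psi> x * root_sum (x\<^sup>2)) = (\<Sum>x\<in>F - {0}. 2)"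
    unfolding sum_F_split[of "\<lambda>x. \<psi> x * root_sum (x\<^sup>2)"]
  proof (simp add: root_sum_square del: sum_constant, intro sum.cong refl)
    fix x assume "x \<in> F - {0}"
    then have "\<not> P dvd x" by (auto simp: F_dvd_iff)
    then show "\<psi> x * ((1 + \<psi> (x\<^sup>2)) * \<psi> x) = 2"
      using \<psi>_mult_self[of x] by (simp add: \<psi>_square)
  qed
  then show ?thesis using card_F_0 by simp
qed

text \<open>After expanding the square, the sum over \<open>k\<close> is a shifted character sum.
  Its constant part dies because \<open>\<psi>\<close> sums to 0, and the rest counts pairs with
  \<open>x\<^sup>2 \<simeq> y\<^sup>2\<close>, that is \<open>y \<simeq> x\<close> or
  \<open>y \<simeq> - x\<close>.\<close>

lemma sum_\<phi>_squares: "(\<Sum>k\<in>F. (\<phi> k)\<^sup>2) = 2 * P * (P - 1)"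
proof -
  have "(\<Sum>k\<in>F. (\<phi> k)\<^sup>2) =
      (\<Sum>k\<in>F. \<Sum>x\<in>F. \<Sum>y\<in>F. (\<psi> x * \<psi> y) * (\<psi> (k + x\<^sup>2) * \<psi> (k + y\<^sup>2)))"
    by (simp add: \<phi>_def power2_eq_square sum_product add.commute mult_ac)
  also have "\<dots> = (\<Sum>x\<in>F. \<Sum>k\<in>F. \<Sum>y\<in>F. (\<psi> x * \<psi> y) * (\<psi> (k + x\<^sup>2) * \<psi> (k + y\<^sup>2)))"
    by (rule sum.swap)
  also have "\<dots> = (\<Sum>x\<in>F. \<Sum>y\<in>F. \<Sum>k\<in>F. (\<psi> x * \<psi> y) * (\<psi> (k + x\<^sup>2) * \<psi> (k + y\<^sup>2)))"
    by (intro sum.cong refl sum.swap)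
  also have "\<dots> = (\<Sum>x\<in>F. \<Sum>y\<in>F. (\<psi> x * \<psi> y) * (if x\<^sup>2 \<simeq> y\<^sup>2 then P - 1 else -1))"
    by (simp add: sum_\<psi>_shifts flip: sum_distrib_left)
  \<comment> \<open>The value \<open>P - 1\<close> or \<open>-1\<close> is split as \<open>P\<close>
    times the indicator of \<open>x\<^sup>2 \<simeq> y\<^sup>2\<close>, minus 1.\<close>
  also have "\<dots> = (\<Sum>x\<in>F. \<Sum>y\<in>F. P * (\<psi> x * (if y\<^sup>2 \<simeq> x\<^sup>2 then \<psi> y else 0)) - \<psi> x * \<psi> y)"
    by (intro sum.cong refl) (auto simp: algebra_simps cong_sym_eq)
  also have "\<dots> = P * (\<Sum>x\<in>F. \<psi> x * root_sum (x\<^sup>2)) - (\<Sum>x\<in>F. \<psi> x) * (\<Sum>x\<in>F. \<psi> x)"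
    unfolding sum_product[of \<psi> F \<psi> F]
    by (simp add: sum_subtractf root_sum_def sum_distrib_left)
  finally show ?thesis by (simp add: sum_root_sum_square sum_\<psi>)
qed

text \<open>\<open>\<phi>\<^sup>2\<close> is constant on square classes. Applying the class formula
  to 1 and to \<open>k\<close> and adding cancels the twisted moment, so the second moment alone
  gives the answer.\<close>

lemma \<phi>_squares_nonresidue:
  assumes "\<psi> k = -1"
  shows "(\<phi> 1)\<^sup>2 + (\<phi> k)\<^sup>2 = 4 * P"
proof -
  have k: "\<not> P dvd k" using assms \<psi>_eq_0_iff[of k] by auto
  have 1: "\<not> P dvd 1" using not_dvd_small[of 1] P_ge by simp
  have c: "(\<phi> x)\<^sup>2 = (\<phi> y)\<^sup>2" if "x \<simeq> y" for x y
    using \<phi>_cong[OF that] by simp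
  have s: "(\<phi> (l * w\<^sup>2))\<^sup>2 = (\<phi> l)\<^sup>2" if "\<not> P dvd w" for l w
    using that \<psi>_mult_self[of w] by (simp add: \<phi>_scale power_mult_distrib) (simp add: power2_eq_square)
  have "(P - 1) * ((\<phi> 1)\<^sup>2 + (\<phi> k)\<^sup>2) = 2 * (\<Sum>x\<in>F - {0}. (\<phi> x)\<^sup>2)"
    using sum_over_class[of "\<lambda>x. (\<phi> x)\<^sup>2" 1, OF c s 1]
      sum_over_class[of "\<lambda>x. (\<phi> x)\<^sup>2" k, OF c s k] assms
    by (simp add: distrib_left)
  also have "\<dots> = (P - 1) * (4 * P)"
    using sum_\<phi>_squares \<phi>_0 sum_F_split[of "\<lambda>x. (\<phi> x)\<^sup>2"] by (simp add: mult_ac)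
  finally show ?thesis using P_ge by simp
qed

text \<open>Replacing \<open>x\<close> by \<open>g * x\<close> multiplies the sum by
  \<open>g ^ e\<close>, which is not 1 unless the order of \<open>g\<close> divides
  \<open>e\<close>. The auxiliary sum \<open>S\<close> has reduced terms because the substitution
  lemma needs a summand that depends on the class exactly.\<close>

lemma power_sum_cong_0:
  assumes "\<not> 8 * m dvd e"
  shows "(\<Sum>x\<in>F. x ^ e) \<simeq> 0"
proof -
  obtain g where g: "int_primroot p g" using primroot_exists ..
  define S where "S = (\<Sum>x\<in>F. x ^ e mod P)"
  have S: "S \<simeq> (\<Sum>x\<in>F. x ^ e)" unfolding S_def by (intro cong_sum) simp
  have "S = (\<Sum>x\<in>F. (g * x) ^ e mod P)"
    unfolding S_def
  proof (rule sum_scale[OF _ primroot_not_dvd[OF g], symmetric])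
    fix x y assume "x \<simeq> y"
    then show "x ^ e mod P = y ^ e mod P" using cong_pow by (simp add: cong_def)
  qed
  also have "\<dots> \<simeq> (\<Sum>x\<in>F. g ^ e * (x ^ e mod P))"
    by (intro cong_sum) (simp add: power_mult_distrib cong_def mod_mult_right_eq)
  finally have "P dvd S - g ^ e * S"
    by (simp add: S_def sum_distrib_left cong_iff_dvd_diff)
  then have "P dvd (1 - g ^ e) * S" by (simp add: algebra_simps)
  moreover have "\<not> P dvd 1 - g ^ e"
    using primroot_power_cong_iff[OF g, of e 0] assms
    by (simp add: cong_iff_dvd_diff cong_0_iff dvd_diff_commute)
  ultimately have "S \<simeq> 0" by (simp add: dvd_mult_iff cong_0_iff)
  then show ?thesis using S cong_sym cong_trans by blast
qed

text \<open>Only the power sum of exponent \<open>8 * m = p - 1\<close> survives in the binomial expansion of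
  \<open>x ^ (4 * m) * (x\<^sup>2 + k) ^ (4 * m)\<close>.\<close>

lemma \<phi>_cong_power: "\<phi> k \<simeq> k ^ (2 * m) * \<phi> 1"
proof -
  define C where "C = int (4 * m choose (2 * m)) * (\<Sum>x\<in>F. x ^ (8 * m))"
  have *: "\<phi> k \<simeq> k ^ (2 * m) * C" for k
  proof -
    let ?s = "\<lambda>r. int (4 * m choose r) * k ^ (4 * m - r) * (\<Sum>x\<in>F. x ^ (4 * m + 2 * r))"
    have "\<phi> k \<simeq> (\<Sum>x\<in>F. x ^ (4 * m) * (x\<^sup>2 + k) ^ (4 * m))"
      unfolding \<phi>_def by (intro cong_sum cong_mult \<psi>_euler)
    also have "(\<Sum>x\<in>F. x ^ (4 * m) * (x\<^sup>2 + k) ^ (4 * m)) =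
        (\<Sum>x\<in>F. \<Sum>r\<le>4 * m. int (4 * m choose r) * k ^ (4 * m - r) * x ^ (4 * m + 2 * r))"
    proof (intro sum.cong refl)
      fix x :: int
      have e: "x ^ (4 * m + 2 * r) = x ^ (4 * m) * (x\<^sup>2) ^ r" for r
        by (simp only: power_add power_mult[of x 2 r])
      have "x ^ (4 * m) * (int (4 * m choose r) * (x\<^sup>2) ^ r * k ^ (4 * m - r)) =
          int (4 * m choose r) * k ^ (4 * m - r) * x ^ (4 * m + 2 * r)" for r
        unfolding e by (simp only: mult_ac)
      then show "x ^ (4 * m) * (x\<^sup>2 + k) ^ (4 * m) =
          (\<Sum>r\<le>4 * m. int (4 * m choose r) * k ^ (4 * m - r) * x ^ (4 * m + 2 * r))"
        unfolding binomial_ring sum_distrib_left by (simp only: of_nat_id)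
    qed
    also have "\<dots> = (\<Sum>r\<le>4 * m. ?s r)"
      by (subst sum.swap) (simp add: sum_distrib_left)
    also have "\<dots> \<simeq> (\<Sum>r\<le>4 * m. if r = 2 * m then k ^ (2 * m) * C else 0)"
    proof (rule cong_sum)
      fix r assume r: "r \<in> {..4 * m}"
      show "?s r \<simeq> (if r = 2 * m then k ^ (2 * m) * C else 0)"
      proof (cases "r = 2 * m")
        case True
        then show ?thesis by (simp add: C_def mult_ac)
      next
        case False
        \<comment> \<open>The exponent lies between \<open>4 * m\<close> and \<open>12 * m\<close>,
          where the only multiple of \<open>8 * m\<close> is \<open>8 * m\<close> itself, attained
          at \<open>r = 2 * m\<close>.\<close>
        have "\<not> 8 * m dvd 4 * m + 2 * r"
        proof
          assume "8 * m dvd 4 * m + 2 * r"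
          then obtain q where q: "4 * m + 2 * r = 8 * m * q" by (auto simp: dvd_def)
          then have "q \<noteq> 0" using m_pos by (intro notI) simp
          moreover have "8 * m * q < 8 * m * 2"
            unfolding q[symmetric] using r m_pos by simp
          then have "q < 2" using mult_less_cancel1[of "8 * m" q 2] by blast
          ultimately have "q = 1" by simp
          then show False using q False by simp
        qed
        then have "?s r \<simeq> int (4 * m choose r) * k ^ (4 * m - r) * 0"
          by (intro cong_mult power_sum_cong_0) auto
        then show ?thesis using False by simp
      qed
    qed
    finally show ?thesis by simp
  qed
  \<comment> \<open>The instance \<open>k = 1\<close> identifies the constant \<open>C\<close> with
    \<open>\<phi> 1\<close> modulo \<open>p\<close>.\<close>
  have "k ^ (2 * m) * \<phi> 1 \<simeq> k ^ (2 * m) * C"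
    using *[of 1] by (intro cong_mult) auto
  then show ?thesis using * cong_sym cong_trans by blast
qed

section \<open>Evaluation of the twisted difference sum\<close>

lemma diff_sum_cong: "k \<simeq> l \<Longrightarrow> diff_sum k = diff_sum l"
  unfolding diff_sum_def by (intro sum.cong refl) (simp add: cong_def)

text \<open>Scaling \<open>u\<close> and \<open>v\<close> by \<open>w\<close> multiplies the summand
  by \<open>\<psi> w * \<psi> w = 1\<close>. This is the invariance that the class formula asks
  for.\<close>

lemma diff_sum_scale:
  assumes w: "\<not> P dvd w"
  shows "diff_sum (k * w\<^sup>2) = diff_sum k"
proof -
  define G where "G = (\<lambda>u v. if u\<^sup>2 - v\<^sup>2 \<simeq> k * w\<^sup>2 then \<psi> u * \<psi> v else 0)"
  have G: "G u v = G u' v'" if "u \<simeq> u'" "v \<simeq> v'" for u u' v v'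
  proof -
    have "u\<^sup>2 - v\<^sup>2 \<simeq> u'\<^sup>2 - v'\<^sup>2" using that by (intro cong_diff cong_pow)
    then show ?thesis
      using \<psi>_cong[OF that(1)] \<psi>_cong[OF that(2)] by (simp add: G_def cong_def)
  qed
  have "diff_sum (k * w\<^sup>2) = (\<Sum>u\<in>F. \<Sum>v\<in>F. G u v)" by (simp add: diff_sum_def G_def)
  also have "\<dots> = (\<Sum>u\<in>F. \<Sum>v\<in>F. G (w * u) v)"
    by (rule sum_scale[OF _ w, symmetric, of "\<lambda>u. \<Sum>v\<in>F. G u v"]) (intro sum.cong refl G; simp)
  also have "\<dots> = (\<Sum>u\<in>F. \<Sum>v\<in>F. G (w * u) (w * v))"
    by (intro sum.cong refl sum_scale[OF _ w, symmetric] G) auto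
  also have "\<dots> = diff_sum k"
    unfolding diff_sum_def
  proof (intro sum.cong refl)
    fix u v
    have "(w * u)\<^sup>2 - (w * v)\<^sup>2 = w\<^sup>2 * (u\<^sup>2 - v\<^sup>2)"
      by (simp add: power2_eq_square algebra_simps)
    moreover have "w\<^sup>2 * (u\<^sup>2 - v\<^sup>2) \<simeq> w\<^sup>2 * k \<longleftrightarrow> u\<^sup>2 - v\<^sup>2 \<simeq> k"
      using w by (intro cong_mult_cancel) (simp add: dvd_power_iff)
    moreover have "\<psi> (w * u) * \<psi> (w * v) = (\<psi> w * \<psi> w) * (\<psi> u * \<psi> v)"
      by (simp add: \<psi>_mult mult_ac)
    ultimately show "G (w * u) (w * v) = (if u\<^sup>2 - v\<^sup>2 \<simeq> k then \<psi> u * \<psi> v else 0)"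
      using w by (simp add: G_def \<psi>_mult_self mult.commute[of k])
  qed
  finally show ?thesis .
qed

lemma sum_delta_cong:
  fixes f :: "int \<Rightarrow> int"
  assumes "\<And>x y. x \<simeq> y \<Longrightarrow> f x = f y"
  shows "(\<Sum>k\<in>F. if c \<simeq> k then f k else 0) = f c"
proof -
  have "(\<Sum>k\<in>F. if c \<simeq> k then f k else 0) = (\<Sum>k\<in>F. if k = c mod P then f c else 0)"
    using F_mod by (intro sum.cong) (auto simp: cong_def intro: assms)
  then show ?thesis using F_mod[of c] by simp
qed

text \<open>Summing over \<open>k\<close> first removes the constraint. Without weight the double
  sum factors into sums of \<open>\<psi>\<close>; with weight \<open>\<psi> k\<close> the sum over
  \<open>u\<close> is \<open>\<phi> (- (v\<^sup>2))\<close>, which is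
  \<open>\<psi> v * \<phi> 1\<close> for a unit \<open>v\<close>.\<close>

lemma diff_sum_total: "(\<Sum>k\<in>F. diff_sum k) = 0" (is ?A)
  and diff_sum_total_\<psi>: "(\<Sum>k\<in>F. \<psi> k * diff_sum k) = (P - 1) * \<phi> 1" (is ?B)
proof -
  have *: "(\<Sum>k\<in>F. h k * diff_sum k) = (\<Sum>v\<in>F. \<psi> v * (\<Sum>u\<in>F. \<psi> u * h (u\<^sup>2 - v\<^sup>2)))"
    if h: "\<And>x y. x \<simeq> y \<Longrightarrow> h x = h y" for h :: "int \<Rightarrow> int"
  proof -
    have "(\<Sum>k\<in>F. h k * diff_sum k) =
        (\<Sum>k\<in>F. \<Sum>u\<in>F. \<Sum>v\<in>F. if u\<^sup>2 - v\<^sup>2 \<simeq> k then \<psi> u * \<psi> v * h k else 0)"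
      unfolding diff_sum_def sum_distrib_left by (intro sum.cong refl) (simp add: mult_ac)
    also have "\<dots> = (\<Sum>u\<in>F. \<Sum>k\<in>F. \<Sum>v\<in>F. if u\<^sup>2 - v\<^sup>2 \<simeq> k then \<psi> u * \<psi> v * h k else 0)"
      by (rule sum.swap)
    also have "\<dots> = (\<Sum>u\<in>F. \<Sum>v\<in>F. \<Sum>k\<in>F. if u\<^sup>2 - v\<^sup>2 \<simeq> k then \<psi> u * \<psi> v * h k else 0)"
      by (intro sum.cong refl sum.swap)
    also have "\<dots> = (\<Sum>u\<in>F. \<Sum>v\<in>F. \<psi> u * \<psi> v * h (u\<^sup>2 - v\<^sup>2))"
      by (intro sum.cong refl sum_delta_cong) (simp add: h)
    also have "\<dots> = (\<Sum>v\<in>F. \<Sum>u\<in>F. \<psi> u * \<psi> v * h (u\<^sup>2 - v\<^sup>2))"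
      by (rule sum.swap)
    finally show ?thesis by (simp add: sum_distrib_left mult_ac)
  qed
  show ?A using *[of "\<lambda>_. 1"] by (simp add: sum_\<psi>)
  have "(\<Sum>k\<in>F. \<psi> k * diff_sum k) = (\<Sum>v\<in>F. \<psi> v * \<phi> (- (v\<^sup>2)))"
    using *[of \<psi>, OF \<psi>_cong] by (simp add: \<phi>_def)
  also have "\<dots> = (\<Sum>v\<in>F - {0}. \<psi> v * \<phi> (- (v\<^sup>2)))"
    by (simp add: sum_F_split[of "\<lambda>v. \<psi> v * \<phi> (- (v\<^sup>2))"])
  also have "\<dots> = (\<Sum>v\<in>F - {0}. \<phi> 1)"
  proof (rule sum.cong)
    fix v assume "v \<in> F - {0}"
    then have "\<not> P dvd v" by (auto simp: F_dvd_iff)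
    then show "\<psi> v * \<phi> (- (v\<^sup>2)) = \<phi> 1"
      using \<phi>_scale[of v 1] \<psi>_mult_self[of v] by (simp add: \<phi>_minus flip: mult.assoc)
  qed simp
  finally show ?B using card_F_0 by simp
qed

text \<open>The class formula needs the total over nonzero \<open>k\<close>. As the full total
  vanishes, it is the negative of \<open>diff_sum 0\<close>, where \<open>u\<close> and
  \<open>v\<close> agree up to sign and the value is \<open>2 * (P - 1)\<close>.\<close>

lemma diff_sum_eq:
  assumes k: "\<not> P dvd k"
  shows "diff_sum k = \<psi> k * \<phi> 1 - 2"
proof -
  have "diff_sum 0 = (\<Sum>u\<in>F. \<psi> u * root_sum (u\<^sup>2))"
    unfolding diff_sum_def root_sum_def sum_distrib_left
    by (intro sum.cong refl) (auto simp: cong_iff_dvd_diff dvd_diff_commute)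
  then have "diff_sum 0 = 2 * (P - 1)" by (simp add: sum_root_sum_square)
  then have "(\<Sum>x\<in>F - {0}. diff_sum x) = - 2 * (P - 1)"
    using diff_sum_total sum_F_split[of diff_sum] by simp
  moreover have "(P - 1) * diff_sum k =
      (\<Sum>x\<in>F - {0}. diff_sum x) + \<psi> k * (\<Sum>x\<in>F. \<psi> x * diff_sum x)"
    by (rule sum_over_class[OF _ _ k]) (rule diff_sum_cong diff_sum_scale; assumption)+
  ultimately have "(P - 1) * diff_sum k = - 2 * (P - 1) + \<psi> k * ((P - 1) * \<phi> 1)"
    by (simp only: diff_sum_total_\<psi>)
  then have "(P - 1) * diff_sum k = (P - 1) * (\<psi> k * \<phi> 1 - 2)"
    by (simp add: algebra_simps)
  then show ?thesis using P_ge by simp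
qed

end

subsection \<open>Differences of biquadratic residues\<close>

context prime_1_mod_8 begin

text \<open>The set of the \<open>a\<^sub>i\<close>. Squaring maps it bijectively onto the
  biquadratic residues modulo \<open>p\<close>, since \<open>x\<close> and \<open>- x\<close> have
  the same quadratic character.\<close>

definition H :: "int set" where
  "H = {x. 0 < x \<and> 2 * x < P \<and> QuadRes P x}"

definition diff_count :: "int \<Rightarrow> nat" where
  "diff_count k = card {(u, v). u \<in> H \<and> v \<in> H \<and> u\<^sup>2 - v\<^sup>2 \<simeq> k}"

lemma H_subset: "H \<subseteq> F" "finite H"
proof -
  show "H \<subseteq> F" by (auto simp: H_def)
  then show "finite H" by (rule finite_subset) simp
qed

lemma H_iff: "x \<in> H \<longleftrightarrow> 0 < x \<and> 2 * x < P \<and> \<psi> x = 1"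
proof -
  have "\<not> P dvd x" if "0 < x" "2 * x < P" using that by (intro not_dvd_small) auto
  then show ?thesis by (auto simp: H_def Legendre_def cong_0_iff)
qed

lemma sum_half:
  fixes h :: "int \<Rightarrow> int"
  assumes "\<And>x y. x \<simeq> y \<Longrightarrow> h x = h y" "\<And>x. h (- x) = h x"
  shows "(\<Sum>x\<in>F - {0}. h x) = 2 * (\<Sum>x | 0 < x \<and> 2 * x < P. h x)"
proof -
  let ?A = "{x. 0 < x \<and> 2 * x < P}"
  have fin: "finite ?A" by (rule finite_subset[of _ F]) auto
  have eq: "F - {0} = ?A \<union> (\<lambda>x. P - x) ` ?A"
  proof -
    have "x \<in> (\<lambda>x. P - x) ` ?A" if "x \<in> F - {0}" "x \<notin> ?A" for x
      using that P_eq by (intro image_eqI[of _ _ "P - x"]) auto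
    then have "F - {0} \<subseteq> ?A \<union> (\<lambda>x. P - x) ` ?A" by blast
    moreover have "?A \<union> (\<lambda>x. P - x) ` ?A \<subseteq> F - {0}" by auto
    ultimately show ?thesis by (rule equalityI)
  qed
  have disj: "?A \<inter> (\<lambda>x. P - x) ` ?A = {}" by auto
  have "h (P - x) = h x" for x
    using assms(1)[of "P - x" "- x"] assms(2) by (simp add: cong_iff_dvd_diff)
  then have "(\<Sum>x\<in>(\<lambda>x. P - x) ` ?A. h x) = (\<Sum>x\<in>?A. h x)"
    by (subst sum.reindex) (auto simp: inj_on_def)
  then show ?thesis
    unfolding eq by (subst sum.union_disjoint[OF fin _ disj]) (use fin in auto)
qed

text \<open>One factor 2 comes from pairing \<open>x\<close> with \<open>P - x\<close>, the other
  from \<open>1 + \<psi> x\<close>, which on units is twice the indicator of the quadratic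
  residues.\<close>

lemma sum_H:
  fixes f :: "int \<Rightarrow> int"
  assumes f: "\<And>x y. x \<simeq> y \<Longrightarrow> f x = f y" "\<And>x. f (- x) = f x"
  shows "(\<Sum>x\<in>F - {0}. (1 + \<psi> x) * f x) = 4 * (\<Sum>x\<in>H. f x)"
proof -
  have "(\<Sum>x\<in>F - {0}. (1 + \<psi> x) * f x) = 2 * (\<Sum>x | 0 < x \<and> 2 * x < P. (1 + \<psi> x) * f x)"
  proof (rule sum_half)
    fix x y assume "x \<simeq> y"
    then show "(1 + \<psi> x) * f x = (1 + \<psi> y) * f y"
      using f(1)[of x y] \<psi>_cong[of x y] by simp
  qed (simp add: f)
  also have "(\<Sum>x | 0 < x \<and> 2 * x < P. (1 + \<psi> x) * f x) = (\<Sum>x\<in>H. 2 * f x)"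
  proof (rule sum.mono_neutral_cong_right)
    show "finite {x. 0 < x \<and> 2 * x < P}" by (rule finite_subset[of _ F]) auto
    show "H \<subseteq> {x. 0 < x \<and> 2 * x < P}" by (auto simp: H_def)
    show "\<forall>x\<in>{x. 0 < x \<and> 2 * x < P} - H. (1 + \<psi> x) * f x = 0"
    proof
      fix x assume x: "x \<in> {x. 0 < x \<and> 2 * x < P} - H"
      then have "\<not> P dvd x" by (intro not_dvd_small) auto
      then have "\<psi> x = -1" using x \<psi>_cases[of x] \<psi>_eq_0_iff[of x] by (auto simp: H_iff)
      then show "(1 + \<psi> x) * f x = 0" by simp
    qed
    show "(1 + \<psi> x) * f x = 2 * f x" if "x \<in> H" for x
      using that by (simp add: H_iff)
  qed
  finally show ?thesis by (simp flip: sum_distrib_left)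
qed

text \<open>Both indicators of \<open>H\<close> are replaced by character weights at a factor 4
  each. Expanding them leaves the number of solutions \<open>P - 1\<close>, two Jacobsthal sums and
  \<open>diff_sum k\<close>; the remaining terms remove \<open>u = 0\<close> and
  \<open>v = 0\<close>.\<close>

lemma diff_count_formula:
  assumes k: "\<not> P dvd k"
  shows "16 * int (diff_count k) =
    P - 5 - 2 * \<psi> k - root_sum k - root_sum (- k) + 2 * \<phi> k + \<psi> k * \<phi> 1"
proof -
  define g where "g = (\<lambda>u v. if u\<^sup>2 - v\<^sup>2 \<simeq> k then 1 else 0 :: int)"
  define G where "G = (\<lambda>u v. (1 + \<psi> u) * (1 + \<psi> v) * g u v)"
  have gc: "g u v = g u' v'" if "u \<simeq> u'" "v \<simeq> v'" for u u' v v'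
    using cong_diff[OF cong_pow[OF that(1), of 2] cong_pow[OF that(2), of 2]]
    by (simp add: g_def cong_def)
  have "int (diff_count k) = (\<Sum>u\<in>H. \<Sum>v\<in>H. g u v)"
  proof -
    have "{(u, v). u \<in> H \<and> v \<in> H \<and> u\<^sup>2 - v\<^sup>2 \<simeq> k} = {x \<in> H \<times> H. case x of (u, v) \<Rightarrow> u\<^sup>2 - v\<^sup>2 \<simeq> k}"
      by auto
    then have "int (diff_count k) = (\<Sum>x\<in>H \<times> H. if (case x of (u, v) \<Rightarrow> u\<^sup>2 - v\<^sup>2 \<simeq> k) then 1 else 0)"
      using H_subset unfolding diff_count_def by (simp flip: sum.inter_filter)
    also have "\<dots> = (\<Sum>(u, v)\<in>H \<times> H. g u v)"
      by (rule sum.cong) (auto simp: g_def)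
    finally show ?thesis by (simp add: sum.cartesian_product)
  qed
  then have "16 * int (diff_count k) = 4 * (\<Sum>u\<in>H. 4 * (\<Sum>v\<in>H. g u v))"
    by (simp flip: sum_distrib_left)
  also have "\<dots> = 4 * (\<Sum>u\<in>H. \<Sum>v\<in>F - {0}. (1 + \<psi> v) * g u v)"
  proof (intro arg_cong2[where f = "(*)"] sum.cong refl)
    fix u
    show "4 * (\<Sum>v\<in>H. g u v) = (\<Sum>v\<in>F - {0}. (1 + \<psi> v) * g u v)"
      by (rule sum_H[symmetric]) (rule gc, simp_all add: g_def)
  qed
  also have "\<dots> = (\<Sum>u\<in>F - {0}. (1 + \<psi> u) * (\<Sum>v\<in>F - {0}. (1 + \<psi> v) * g u v))"
    by (rule sum_H[symmetric])
       ((intro sum.cong refl arg_cong2[where f = "(*)"] gc; simp), simp add: g_def)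
  also have "\<dots> = (\<Sum>u\<in>F - {0}. \<Sum>v\<in>F - {0}. G u v)"
    by (simp add: G_def sum_distrib_left mult.assoc)
  \<comment> \<open>Inclusion and exclusion: the character sums run over all residues, whereas
    \<open>H\<close> contains only units.\<close>
  also have "\<dots> = (\<Sum>u\<in>F. \<Sum>v\<in>F. G u v) - (\<Sum>v\<in>F. G 0 v) - (\<Sum>u\<in>F. G u 0) + G 0 0"
  proof -
    have "(\<Sum>u\<in>F - {0}. \<Sum>v\<in>F. G u v) = (\<Sum>u\<in>F - {0}. G u 0 + (\<Sum>v\<in>F - {0}. G u v))"
      by (intro sum.cong refl sum_F_split)
    also have "\<dots> = (\<Sum>u\<in>F - {0}. G u 0) + (\<Sum>u\<in>F - {0}. \<Sum>v\<in>F - {0}. G u v)"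
      by (rule sum.distrib)
    finally show ?thesis
      using sum_F_split[of "\<lambda>u. \<Sum>v\<in>F. G u v"] sum_F_split[of "\<lambda>u. G u 0"]
      by linarith
  qed
  also have "G 0 0 = 0"
    using k by (simp add: G_def g_def cong_iff_dvd_diff)
  also have "(\<Sum>u\<in>F. G u 0) = 1 + \<psi> k + root_sum k"
  proof -
    have "(\<Sum>u\<in>F. G u 0) = (\<Sum>u\<in>F. (if u\<^sup>2 \<simeq> k then 1 else 0) + (if u\<^sup>2 \<simeq> k then \<psi> u else 0))"
      by (intro sum.cong) (auto simp: G_def g_def)
    then show ?thesis
      by (simp add: sum.distrib root_sum_def flip: sum.inter_filter card_square_roots)
  qed
  also have "(\<Sum>v\<in>F. G 0 v) = 1 + \<psi> k + root_sum (- k)"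
  proof -
    have "0\<^sup>2 - v\<^sup>2 \<simeq> k \<longleftrightarrow> v\<^sup>2 \<simeq> - k" for v
    proof -
      have "v\<^sup>2 - (- k) = - (0\<^sup>2 - v\<^sup>2 - k)" by simp
      then show ?thesis by (simp only: cong_iff_dvd_diff dvd_minus_iff)
    qed
    then have "(\<Sum>v\<in>F. G 0 v) = (\<Sum>v\<in>F. (if v\<^sup>2 \<simeq> - k then 1 else 0) + (if v\<^sup>2 \<simeq> - k then \<psi> v else 0))"
      by (intro sum.cong) (auto simp: G_def g_def)
    then show ?thesis using card_square_roots[of "- k"]
      by (simp add: sum.distrib root_sum_def flip: sum.inter_filter)
  qed
  also have "(\<Sum>u\<in>F. \<Sum>v\<in>F. G u v) = P - 1 + 2 * \<phi> k + diff_sum k"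
  proof -
    have g1: "(\<Sum>v\<in>F. g u v) = 1 + \<psi> (u\<^sup>2 - k)" for u
    proof -
      have "u\<^sup>2 - v\<^sup>2 \<simeq> k \<longleftrightarrow> v\<^sup>2 \<simeq> u\<^sup>2 - k" for v
      proof -
        have "v\<^sup>2 - (u\<^sup>2 - k) = - (u\<^sup>2 - v\<^sup>2 - k)" by simp
        then show ?thesis by (simp only: cong_iff_dvd_diff dvd_minus_iff)
      qed
      then show ?thesis using card_square_roots[of "u\<^sup>2 - k"]
        by (simp add: g_def flip: sum.inter_filter)
    qed
    have g2: "(\<Sum>u\<in>F. g u v) = 1 + \<psi> (v\<^sup>2 + k)" for v
    proof -
      have "u\<^sup>2 - v\<^sup>2 \<simeq> k \<longleftrightarrow> u\<^sup>2 \<simeq> v\<^sup>2 + k" for u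
        by (simp add: cong_iff_dvd_diff algebra_simps)
      then show ?thesis using card_square_roots[of "v\<^sup>2 + k"]
        by (simp add: g_def flip: sum.inter_filter)
    qed
    have e: "G u v = g u v + \<psi> u * g u v + \<psi> v * g u v + \<psi> u * \<psi> v * g u v" for u v
      by (simp add: G_def algebra_simps)
    have "(\<Sum>u\<in>F. \<Sum>v\<in>F. g u v) = (\<Sum>u\<in>F. 1 + \<psi> (u\<^sup>2 - k))"
      by (simp add: g1)
    also have "\<dots> = P + (\<Sum>u\<in>F. \<psi> (u\<^sup>2 - k))"
      by (simp add: sum.distrib)
    also have "(\<Sum>u\<in>F. \<psi> (u\<^sup>2 - k)) = (\<Sum>y\<in>F. (1 + \<psi> y) * \<psi> (y - k))"
      by (rule sum_squares) (intro \<psi>_cong cong_diff; simp)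
    also have "\<dots> = (\<Sum>y\<in>F. \<psi> (y + (- k))) + (\<Sum>y\<in>F. \<psi> (y + 0) * \<psi> (y + (- k)))"
      by (simp add: distrib_right sum.distrib)
    also have "\<dots> = - 1"
      using sum_shift[of \<psi> "- k", OF \<psi>_cong] k
      unfolding sum_\<psi>_shifts by (simp add: sum_\<psi> cong_iff_dvd_diff)
    finally have s1: "(\<Sum>u\<in>F. \<Sum>v\<in>F. g u v) = P - 1" by simp
    have s2: "(\<Sum>u\<in>F. \<Sum>v\<in>F. \<psi> u * g u v) = \<phi> k"
      using \<phi>_minus[of k]
      by (simp add: g1 \<phi>_def distrib_left sum.distrib sum_\<psi> flip: sum_distrib_left)
    have s3: "(\<Sum>u\<in>F. \<Sum>v\<in>F. \<psi> v * g u v) = \<phi> k"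
      by (subst sum.swap) (simp add: g2 \<phi>_def distrib_left sum.distrib sum_\<psi> flip: sum_distrib_left)
    have s4: "(\<Sum>u\<in>F. \<Sum>v\<in>F. \<psi> u * \<psi> v * g u v) = diff_sum k"
      unfolding diff_sum_def g_def by (intro sum.cong) auto
    show ?thesis by (simp add: e sum.distrib s1 s2 s3 s4)
  qed
  finally show ?thesis by (simp add: diff_sum_eq[OF k])
qed

text \<open>Here \<open>k \<simeq> y\<^sup>2\<close> with \<open>\<psi> y = s\<close>. Thus the
  quartic character of \<open>k\<close> is the quadratic character of its roots, and scaling by
  \<open>y\<close> transports \<open>\<phi> 1\<close> to \<open>\<phi> k\<close>.\<close>

lemma root_sum_eq:
  assumes "k ^ (2 * m) \<simeq> s" "s \<in> {1, -1}"
  shows "root_sum k = 2 * s" "\<psi> k = 1" "\<phi> k = s * \<phi> 1"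
proof -
  have "\<psi> k \<simeq> (k ^ (2 * m))\<^sup>2" using \<psi>_euler[of k] by (simp add: mult.commute flip: power_mult)
  also have "(k ^ (2 * m))\<^sup>2 \<simeq> s\<^sup>2" by (intro cong_pow assms)
  also have "s\<^sup>2 = 1" using assms(2) by auto
  finally show 1: "\<psi> k = 1" by (rule cong_imp_eq) (use \<psi>_cases[of k] P_ge in auto)
  then obtain y where y: "\<not> P dvd y" "k \<simeq> y\<^sup>2" by (rule \<psi>_eq_1_imp_square)
  have "\<psi> y \<simeq> (y\<^sup>2) ^ (2 * m)" using \<psi>_euler[of y] by (simp flip: power_mult)
  also have "(y\<^sup>2) ^ (2 * m) \<simeq> k ^ (2 * m)" by (intro cong_pow cong_sym[OF y(2)])
  also note assms(1)
  finally have s: "\<psi> y = s" by (rule cong_imp_eq) (use \<psi>_cases[of y] assms(2) P_ge in auto)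
  have "root_sum k = root_sum (y\<^sup>2)"
    unfolding root_sum_def using y(2) by (simp add: cong_def)
  then show "root_sum k = 2 * s"
    using s y by (simp add: root_sum_square \<psi>_square)
  have "\<phi> k = \<phi> (1 * y\<^sup>2)" by (rule \<phi>_cong) (simp add: y)
  also have "\<dots> = s * \<phi> 1" using \<phi>_scale[OF y(1), of 1] s by simp
  finally show "\<phi> k = s * \<phi> 1" .
qed

lemma root_sum_nonresidue: "\<psi> k = -1 \<Longrightarrow> root_sum k = 0"
proof -
  assume k: "\<psi> k = -1"
  have "\<not> v\<^sup>2 \<simeq> k" for v
    using \<psi>_cong[of "v\<^sup>2" k] k \<psi>_mult_self[of v] by (auto simp: power2_eq_square \<psi>_mult split: if_splits)
  then show "root_sum k = 0" by (simp add: root_sum_def)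
qed

lemma diff_count_1:
  assumes "k ^ (2 * m) \<simeq> 1"
  shows "16 * int (diff_count k) = P - 11 + 3 * \<phi> 1"
proof -
  have "\<not> P dvd k" using root_sum_eq(2)[OF assms] \<psi>_eq_0_iff[of k] by auto
  moreover have "(- k) ^ (2 * m) \<simeq> 1" using assms by simp
  ultimately show ?thesis
    using diff_count_formula[of k] root_sum_eq[OF assms] root_sum_eq(1)[of "- k" 1] by simp
qed

lemma diff_count_minus_1:
  assumes "k ^ (2 * m) \<simeq> -1"
  shows "16 * int (diff_count k) = P - 3 - \<phi> 1"
proof -
  have "\<not> P dvd k" using root_sum_eq(2)[OF assms] \<psi>_eq_0_iff[of k] by auto
  moreover have "(- k) ^ (2 * m) \<simeq> -1" using assms by simp
  ultimately show ?thesis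
    using diff_count_formula[of k] root_sum_eq[OF assms] root_sum_eq(1)[of "- k" "-1"] by simp
qed

lemma diff_count_nonresidue:
  assumes "\<psi> k = -1"
  shows "16 * int (diff_count k) = P - 3 - \<phi> 1 + 2 * \<phi> k"
proof -
  have "\<not> P dvd k" using assms \<psi>_eq_0_iff[of k] by auto
  then show ?thesis
    using diff_count_formula[of k] root_sum_nonresidue[of k] root_sum_nonresidue[of "- k"] assms
    by simp
qed

end

subsection \<open>The representation as a sum of two squares\<close>

text \<open>The prime divides \<open>(a * y - b * x) * (a * y + b * x)\<close>. Once it divides one
  factor, the Brahmagupta identity bounds the quotient by 1 in absolute value: quotient 0 makes the
  vectors \<open>(a, b)\<close> and \<open>(x, y)\<close> parallel, quotient 1 or -1 makes them
  orthogonal.\<close>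

lemma two_squares_unique:
  fixes a b x y q :: int
  assumes "prime q" "a\<^sup>2 + b\<^sup>2 = q" "x\<^sup>2 + y\<^sup>2 = q"
  shows "a\<^sup>2 = x\<^sup>2 \<or> a\<^sup>2 = y\<^sup>2"
proof -
  have q0: "q > 0" using assms(1) prime_gt_0_int by blast
  have *: "a\<^sup>2 = x\<^sup>2 \<or> a\<^sup>2 = y\<^sup>2"
    if xy: "x\<^sup>2 + y\<^sup>2 = q" and d: "q dvd a * y - b * x" for x y
  proof -
    obtain r where r: "a * y - b * x = q * r" using d by (auto simp: dvd_def)
    have "(a\<^sup>2 + b\<^sup>2) * (x\<^sup>2 + y\<^sup>2) = (a * x + b * y)\<^sup>2 + (a * y - b * x)\<^sup>2"
      by (simp add: power2_eq_square algebra_simps)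
    then have brahma: "q\<^sup>2 = (a * x + b * y)\<^sup>2 + (a * y - b * x)\<^sup>2"
      unfolding assms(2) xy by (simp only: power2_eq_square)
    then have "q\<^sup>2 * r\<^sup>2 \<le> q\<^sup>2 * 1"
      unfolding r power_mult_distrib using zero_le_power2[of "a * x + b * y"] by linarith
    then have "r\<^sup>2 \<le> 1" using q0 by simp
    then have "\<bar>r\<bar> \<le> 1" using abs_square_le_1 by blast
    then have "r = 0 \<or> r = 1 \<or> r = -1" by linarith
    then consider "r = 0" | "r\<^sup>2 = 1" by auto
    then show ?thesis
    proof cases
      case 1
      then have e: "a * y = b * x" using r by simp
      have "q * a\<^sup>2 = a\<^sup>2 * x\<^sup>2 + (a * y)\<^sup>2"
        unfolding xy[symmetric] by (simp add: power_mult_distrib algebra_simps)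
      also have "\<dots> = q * x\<^sup>2"
        unfolding e assms(2)[symmetric] by (simp add: power_mult_distrib algebra_simps)
      finally show ?thesis using q0 by simp
    next
      case 2
      then have "(a * x + b * y)\<^sup>2 = 0" using brahma unfolding r by (simp add: power_mult_distrib)
      then have e: "a * x = - (b * y)" by simp
      have "q * a\<^sup>2 = (a * x)\<^sup>2 + a\<^sup>2 * y\<^sup>2"
        unfolding xy[symmetric] by (simp add: power_mult_distrib algebra_simps)
      also have "\<dots> = q * y\<^sup>2"
        unfolding e assms(2)[symmetric] by (simp add: power_mult_distrib algebra_simps)
      finally show ?thesis using q0 by simp
    qed
  qed
  have "(a * y - b * x) * (a * y + b * x) = a\<^sup>2 * y\<^sup>2 - b\<^sup>2 * x\<^sup>2"
    by (simp add: power2_eq_square algebra_simps)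
  also have "\<dots> = q * (a\<^sup>2 - x\<^sup>2)"
  proof -
    have e: "b\<^sup>2 = q - a\<^sup>2" "y\<^sup>2 = q - x\<^sup>2" using assms by auto
    show ?thesis unfolding e by (simp add: algebra_simps)
  qed
  finally have "q dvd a * y - b * x \<or> q dvd a * y + b * x"
    using assms(1) by (metis dvd_triv_left prime_dvd_mult_iff)
  then show ?thesis using *[of x y] *[of "- x" y] assms(3) by auto
qed

lemma card_involution:
  fixes f :: "'a::linorder \<Rightarrow> 'a"
  assumes "finite S" "\<And>x. x \<in> S \<Longrightarrow> f x \<in> S" "\<And>x. x \<in> S \<Longrightarrow> f (f x) = x"
  shows "even (card S) \<longleftrightarrow> even (card {x \<in> S. f x = x})"
proof -
  let ?T = "{x \<in> S. x < f x}" and ?E = "{x \<in> S. f x = x}"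
  have "S = (?T \<union> f ` ?T) \<union> ?E"
  proof (intro equalityI subsetI)
    fix x assume x: "x \<in> S"
    consider "x < f x" | "f x = x" | "f x < x" by force
    then show "x \<in> (?T \<union> f ` ?T) \<union> ?E"
    proof cases
      case 3
      then have "f x \<in> ?T" "x = f (f x)" using assms x by auto
      then show ?thesis by blast
    qed (use x in auto)
  qed (use assms in auto)
  moreover have "card ((?T \<union> f ` ?T) \<union> ?E) = card (?T \<union> f ` ?T) + card ?E"
    using assms by (intro card_Un_disjoint) auto
  moreover have "card (?T \<union> f ` ?T) = card ?T + card (f ` ?T)"
    using assms by (intro card_Un_disjoint) auto
  moreover have "inj_on f ?T"
    by (intro inj_on_inverseI[where g = f]) (simp add: assms(3))
  then have "card (f ` ?T) = card ?T" by (rule card_image)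
  ultimately have "card S = card ?T + card ?T + card ?E" by simp
  then show ?thesis by simp
qed

context prime_1_mod_8 begin

section \<open>Half-interval representatives and the quartic character of 2\<close>

lemma odd_P: "odd P"
  unfolding P_eq by simp

lemma half_representative:
  assumes "\<not> P dvd x"
  obtains y where "0 < y" "2 * y < P" "x \<simeq> y \<or> x \<simeq> - y"
proof -
  have r: "0 < x mod P" "x mod P < P"
    using assms P_ge pos_mod_bound[of P x] pos_mod_sign[of P x]
    by (auto simp: dvd_eq_mod_eq_0 less_le)
  show thesis
  proof (cases "2 * (x mod P) < P")
    case True
    then show thesis using that[of "x mod P"] r by (simp add: cong_def)
  next
    case False
    have "2 * (x mod P) \<noteq> P"
    proof
      assume "2 * (x mod P) = P"
      then have "even P" by (metis dvd_triv_left)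
      then show False using odd_P by contradiction
    qed
    then have "2 * (P - x mod P) < P" using False by simp
    moreover have "x \<simeq> - (P - x mod P)"
      by (simp add: cong_def)
    ultimately show thesis using that[of "P - x mod P"] r by simp
  qed
qed

lemma half_square_inj:
  assumes "0 < x" "2 * x < P" "0 < y" "2 * y < P" "x\<^sup>2 \<simeq> y\<^sup>2"
  shows "x = y"
proof -
  consider "x \<simeq> y" | "x \<simeq> - y" using assms(5) by (auto simp: cong_square_iff)
  then show ?thesis
  proof cases
    case 1
    then show ?thesis by (rule cong_imp_eq) (use assms in auto)
  next
    case 2
    then have "x = - y" by (rule cong_imp_eq) (use assms in auto)
    then show ?thesis using assms by simp
  qed
qed

lemma H_square_power: "u \<in> H \<Longrightarrow> (u\<^sup>2) ^ (2 * m) \<simeq> 1"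
  using \<psi>_euler[of u] by (simp add: H_iff cong_sym_eq flip: power_mult)

text \<open>A square root of \<open>x\<close>, moved into the half interval by a change of sign, has
  quadratic character \<open>x ^ (2 * m)\<close>, so it lies in \<open>H\<close>.\<close>

lemma fourth_power_root:
  assumes "x ^ (2 * m) \<simeq> 1"
  obtains u where "u \<in> H" "u\<^sup>2 \<simeq> x"
proof -
  have "\<psi> x = 1" using assms by (rule root_sum_eq) simp
  then obtain y where y: "\<not> P dvd y" "x \<simeq> y\<^sup>2" by (rule \<psi>_eq_1_imp_square)
  obtain u where u: "0 < u" "2 * u < P" "y \<simeq> u \<or> y \<simeq> - u"
    using y(1) by (rule half_representative)
  have "y\<^sup>2 \<simeq> u\<^sup>2" using u(3) by (simp add: cong_square_iff)
  then have ux: "u\<^sup>2 \<simeq> x" using y(2) by (simp add: cong_def)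
  have "\<psi> u \<simeq> (u\<^sup>2) ^ (2 * m)" using \<psi>_euler[of u] by (simp flip: power_mult)
  also have "(u\<^sup>2) ^ (2 * m) \<simeq> x ^ (2 * m)" by (intro cong_pow ux)
  also note assms
  finally have "\<psi> u = 1" by (rule cong_imp_eq) (use \<psi>_cases[of u] P_ge in auto)
  then show thesis using that[of u] u ux by (simp add: H_iff)
qed

text \<open>\<open>z = g ^ m\<close> is a primitive eighth root of unity, \<open>z ^ 7\<close> is
  its inverse, and the square of their sum is 2. So 2 is a quadratic residue and its quartic
  character is a sign.\<close>

lemma two_power_cases: "2 ^ (2 * m) \<simeq> 1 \<or> 2 ^ (2 * m) \<simeq> -1"
proof -
  obtain g where g: "int_primroot p g" using primroot_exists ..
  define z where "z = g ^ m"
  have z4: "z ^ 4 \<simeq> -1"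
    using primroot_power_4m[OF g] by (simp add: z_def mult.commute flip: power_mult)
  have "(z + z ^ 7)\<^sup>2 - 2 = (z ^ 4 + 1) * (z\<^sup>2 + 2 * (z ^ 4 - 1) + z ^ 6 * (z ^ 4 - 1)) "
    by (simp add: power2_eq_square eval_nat_numeral algebra_simps)
  then have "2 \<simeq> (z + z ^ 7)\<^sup>2"
    using z4 by (simp add: cong_iff_dvd_diff dvd_diff_commute[of _ 2])
  moreover have "\<not> P dvd 2" using P_ge by (intro not_dvd_small) auto
  ultimately have "\<psi> 2 = 1"
    using \<psi>_cong[of 2 "(z + z ^ 7)\<^sup>2"] \<psi>_mult_self[of "z + z ^ 7"] \<psi>_eq_0_iff[of 2]
    by (auto simp: power2_eq_square \<psi>_mult split: if_splits)
  then have "(2 ^ (2 * m))\<^sup>2 \<simeq> 1\<^sup>2"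
    using \<psi>_euler[of 2] by (simp add: cong_sym_eq mult.commute flip: power_mult)
  then show ?thesis by (simp only: cong_square_iff)
qed

text \<open>The count is the number of \<open>x\<close> such that \<open>x\<close> and
  \<open>x - 1\<close> are both biquadratic residues. As -1 is one too, \<open>x\<close> to
  \<open>1 - x\<close> is an involution of this set; its only possible fixed point is the inverse of
  2, which belongs to the set exactly when 2 is a biquadratic residue.\<close>

lemma odd_diff_count_1: "odd (diff_count 1) \<longleftrightarrow> 2 ^ (2 * m) \<simeq> 1"
proof -
  define S where "S = {x \<in> F. x ^ (2 * m) \<simeq> 1 \<and> (x - 1) ^ (2 * m) \<simeq> 1}"
  define f where "f = (\<lambda>x. (1 - x) mod P)"
  have finS: "finite S" unfolding S_def by (rule finite_subset[of _ F]) auto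
  have "bij_betw (\<lambda>(u, v). u\<^sup>2 mod P) {(u, v). u \<in> H \<and> v \<in> H \<and> u\<^sup>2 - v\<^sup>2 \<simeq> 1} S"
    unfolding bij_betw_def
  proof (intro conjI inj_onI equalityI subsetI)
    fix x y assume "x \<in> {(u, v). u \<in> H \<and> v \<in> H \<and> u\<^sup>2 - v\<^sup>2 \<simeq> 1}"
      "y \<in> {(u, v). u \<in> H \<and> v \<in> H \<and> u\<^sup>2 - v\<^sup>2 \<simeq> 1}"
      and eq: "(case x of (u, v) \<Rightarrow> u\<^sup>2 mod P) = (case y of (u, v) \<Rightarrow> u\<^sup>2 mod P)"
    then obtain u v u' v' where xy: "x = (u, v)" "y = (u', v')" "u \<in> H" "v \<in> H" "u' \<in> H" "v' \<in> H"
      "u\<^sup>2 - v\<^sup>2 \<simeq> 1" "u'\<^sup>2 - v'\<^sup>2 \<simeq> 1" by auto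
    then have 1: "u\<^sup>2 \<simeq> u'\<^sup>2" using eq by (simp add: cong_def)
    have "u\<^sup>2 - v\<^sup>2 \<simeq> u'\<^sup>2 - v'\<^sup>2" using xy by (simp add: cong_def)
    from cong_diff[OF 1 this] have 2: "v\<^sup>2 \<simeq> v'\<^sup>2" by simp
    show "x = y"
      using half_square_inj[OF _ _ _ _ 1] half_square_inj[OF _ _ _ _ 2] xy by (simp add: H_iff)
  next
    fix x assume "x \<in> (\<lambda>(u, v). u\<^sup>2 mod P) ` {(u, v). u \<in> H \<and> v \<in> H \<and> u\<^sup>2 - v\<^sup>2 \<simeq> 1}"
    then obtain u v where x: "x = u\<^sup>2 mod P" "u \<in> H" "v \<in> H" "u\<^sup>2 - v\<^sup>2 \<simeq> 1" by auto
    have xu: "x \<simeq> u\<^sup>2" using x by simp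
    have "x ^ (2 * m) \<simeq> 1" using cong_trans[OF cong_pow[OF xu] H_square_power[OF x(2)]] .
    moreover have "x - 1 \<simeq> v\<^sup>2" using cong_diff[OF xu cong_sym[OF x(4)]] by simp
    then have "(x - 1) ^ (2 * m) \<simeq> 1" using cong_trans[OF cong_pow H_square_power[OF x(3)]] by blast
    ultimately show "x \<in> S" using x(1) F_mod(1) by (simp add: S_def)
  next
    fix x assume "x \<in> S"
    then have x: "x \<in> F" "x ^ (2 * m) \<simeq> 1" "(x - 1) ^ (2 * m) \<simeq> 1" by (auto simp: S_def)
    obtain u where u: "u \<in> H" "u\<^sup>2 \<simeq> x" using x(2) by (rule fourth_power_root)
    obtain v where v: "v \<in> H" "v\<^sup>2 \<simeq> x - 1" using x(3) by (rule fourth_power_root)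
    have "u\<^sup>2 - v\<^sup>2 \<simeq> 1" using cong_diff[OF u(2) v(2)] by simp
    moreover have "x = u\<^sup>2 mod P" using u(2) x(1) by (simp add: cong_def)
    ultimately show "x \<in> (\<lambda>(u, v). u\<^sup>2 mod P) ` {(u, v). u \<in> H \<and> v \<in> H \<and> u\<^sup>2 - v\<^sup>2 \<simeq> 1}"
      using u v by (intro image_eqI[of _ _ "(u, v)"]) auto
  qed
  then have "diff_count 1 = card S"
    unfolding diff_count_def by (rule bij_betw_same_card)
  moreover have "even (card S) \<longleftrightarrow> even (card {x \<in> S. f x = x})"
  proof (rule card_involution[OF finS])
    fix x assume "x \<in> S"
    then have x: "x \<in> F" "x ^ (2 * m) \<simeq> 1" "(x - 1) ^ (2 * m) \<simeq> 1" by (auto simp: S_def)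
    have fx: "f x \<simeq> 1 - x" by (simp add: f_def)
    have "f x ^ (2 * m) \<simeq> (1 - x) ^ (2 * m)" by (intro cong_pow fx)
    also have "(1 - x) ^ (2 * m) = (x - 1) ^ (2 * m)"
      by (simp add: power_mult power2_commute)
    finally have 1: "f x ^ (2 * m) \<simeq> 1" using x(3) cong_trans by blast
    have "f x - 1 \<simeq> - x" using cong_diff[OF fx cong_refl[of 1]] by simp
    then have "(f x - 1) ^ (2 * m) \<simeq> (- x) ^ (2 * m)" by (rule cong_pow)
    then have "(f x - 1) ^ (2 * m) \<simeq> 1" using x(2) cong_trans by simp
    then show "f x \<in> S" using 1 F_mod(1) by (simp add: S_def f_def)
    have "1 - f x \<simeq> x" using cong_diff[OF cong_refl[of 1] fx] by simp
    then show "f (f x) = x" using x(1) by (simp add: f_def cong_def)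
  qed
  moreover have "card {x \<in> S. f x = x} = (if 2 ^ (2 * m) \<simeq> 1 then 1 else 0)"
  proof -
    \<comment> \<open>\<open>h = (P + 1) / 2\<close> is the inverse of 2.\<close>
    define h where "h = 4 * int m + 1"
    have "2 * h - 1 = P" unfolding h_def P_eq by simp
    then have h: "2 * h \<simeq> 1" by (simp add: cong_iff_dvd_diff)
    have hF: "h \<in> F" using m_pos by (simp add: h_def P_eq)
    have fix_iff: "f x = x \<longleftrightarrow> x = h" if "x \<in> F" for x
    proof -
      have "f x = x \<longleftrightarrow> 1 - x \<simeq> x" using that by (simp add: f_def cong_def)
      also have "\<dots> \<longleftrightarrow> 1 \<simeq> 2 * x" by (simp add: cong_iff_dvd_diff)
      also have "\<dots> \<longleftrightarrow> 2 * h \<simeq> 2 * x" using h by (simp add: cong_def)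
      also have "\<dots> \<longleftrightarrow> h \<simeq> x" using P_ge by (intro cong_mult_cancel not_dvd_small) auto
      also have "\<dots> \<longleftrightarrow> x = h" using F_cong_eq[OF hF that] by auto
      finally show ?thesis .
    qed
    have "h - 1 \<simeq> - h" using h by (simp add: cong_iff_dvd_diff algebra_simps)
    then have h1: "(h - 1) ^ (2 * m) \<simeq> h ^ (2 * m)" using cong_pow[of "h - 1" "- h" P "2 * m"] by simp
    have h2: "2 ^ (2 * m) * h ^ (2 * m) \<simeq> 1"
      using cong_pow[OF h, of "2 * m"] by (simp add: power_mult_distrib)
    have "h ^ (2 * m) \<simeq> 1 \<longleftrightarrow> 2 ^ (2 * m) \<simeq> 1"
    proof
      assume "h ^ (2 * m) \<simeq> 1"
      from cong_mult[OF cong_refl[of "2 ^ (2 * m)"] this] show "2 ^ (2 * m) \<simeq> 1"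
        using h2 by (simp add: cong_def)
    next
      assume "2 ^ (2 * m) \<simeq> 1"
      from cong_mult[OF this cong_refl[of "h ^ (2 * m)"]] show "h ^ (2 * m) \<simeq> 1"
        using h2 by (simp add: cong_def)
    qed
    then have "h \<in> S \<longleftrightarrow> 2 ^ (2 * m) \<simeq> 1"
      using h1 hF by (auto simp: S_def intro: cong_trans)
    moreover have "{x \<in> S. f x = x} = (if h \<in> S then {h} else {})"
      using fix_iff by (auto simp: S_def)
    ultimately show ?thesis by simp
  qed
  ultimately show ?thesis by simp
qed

end

text \<open>The parameters \<open>r\<close> and \<open>c\<close> encode the representation \<open>p = a\<^sup>2 + 4 * b\<^sup>2\<close> through
  \<open>a = 4 * r - 1\<close> and \<open>b = 2 * c\<close>; the integer \<open>b\<close> is even because \<open>p\<close> is 1 modulo 8.\<close>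

locale prime_two_squares = prime_1_mod_8 +
  fixes r c :: int
  assumes p_squares: "int p = (4 * r - 1)\<^sup>2 + 4 * (2 * c)\<^sup>2" and c_pos: "c > 0"
begin

lemma m_eq: "int m = 2 * r\<^sup>2 - r + 2 * c\<^sup>2"
  using p_squares unfolding P_eq by (simp add: power2_eq_square algebra_simps)

text \<open>Half of \<open>\<phi> 1\<close> and half of \<open>\<phi> g\<close> represent
  \<open>P\<close> as a sum of two squares. Uniqueness leaves \<open>a\<close> up to sign, and the
  residue modulo 4 removes that ambiguity.\<close>

lemma \<phi>_1: "\<phi> 1 = 2 * (4 * r - 1)"
proof -
  obtain g where g: "int_primroot p g" using primroot_exists ..
  have sq: "(\<phi> 1)\<^sup>2 + (\<phi> g)\<^sup>2 = 4 * P"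
    using \<psi>_primroot[OF g] by (rule \<phi>_squares_nonresidue)
  have "even ((\<phi> 1)\<^sup>2 + (\<phi> g)\<^sup>2)" unfolding sq by simp
  then have par: "even (\<phi> 1) \<longleftrightarrow> even (\<phi> g)" by simp
  have "even (\<phi> 1)"
  proof (rule ccontr)
    assume "odd (\<phi> 1)"
    then obtain i j where ij: "\<phi> 1 = 2 * i + 1" "\<phi> g = 2 * j + 1" using par by (blast elim: oddE)
    have "4 * (i\<^sup>2 + i + j\<^sup>2 + j) + 2 = 4 * P"
      using sq unfolding ij by (simp add: power2_eq_square algebra_simps)
    then show False by presburger
  qed
  then obtain x y where xy: "\<phi> 1 = 2 * x" "\<phi> g = 2 * y" using par by (blast elim: evenE)
  have sum: "x\<^sup>2 + y\<^sup>2 = P" using sq unfolding xy by (simp add: power_mult_distrib)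
  have "16 * int (diff_count 1) = P - 11 + 3 * \<phi> 1" by (rule diff_count_1) simp
  \<comment> \<open>The right side \<open>P - 11 + 6 * x\<close> is a multiple of 16, and
    \<open>P\<close> is 1 modulo 8; this forces \<open>x\<close> to be 3 modulo 4.\<close>
  then have x3: "x mod 4 = 3" using P_eq xy by presburger
  have "odd x" using x3 by presburger
  moreover have "odd (x\<^sup>2 + y\<^sup>2)" unfolding sum P_eq by simp
  ultimately have "even y" by simp
  define a where "a = 4 * r - 1"
  have "a\<^sup>2 + (4 * c)\<^sup>2 = P" using p_squares by (simp add: a_def power_mult_distrib)
  from two_squares_unique[OF prime_P this sum] have "a\<^sup>2 = x\<^sup>2 \<or> a\<^sup>2 = y\<^sup>2" .
  moreover have "a\<^sup>2 \<noteq> y\<^sup>2"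
  proof
    assume "a\<^sup>2 = y\<^sup>2"
    then have "even a" using \<open>even y\<close> even_power[of a 2] by simp
    then show False by (simp add: a_def)
  qed
  ultimately have "a = x \<or> a = - x" by (simp add: power2_eq_iff)
  then have "a = x" using x3 unfolding a_def by presburger
  then show ?thesis using xy by (simp add: a_def)
qed

text \<open>The sum of squares gives \<open>8 * c\<close> up to sign. Modulo \<open>p\<close>, the
  value is \<open>k ^ (2 * m) * \<phi> 1\<close>, hence \<open>2 * J * a\<close>, hence
  \<open>8 * c\<close>; the opposite sign would make \<open>p\<close> divide \<open>16 * c\<close>,
  but \<open>0 < c < P\<close>.\<close>

lemma \<phi>_J:
  assumes J: "J * (4 * r - 1) \<simeq> 4 * c" and k: "k ^ (2 * m) \<simeq> J" and kn: "\<psi> k = -1"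
  shows "\<phi> k = 8 * c"
proof -
  have "(\<phi> k)\<^sup>2 = (8 * c)\<^sup>2"
    using \<phi>_squares_nonresidue[OF kn] p_squares unfolding \<phi>_1 by (simp add: power2_eq_square algebra_simps)
  then have "\<phi> k = 8 * c \<or> \<phi> k = - (8 * c)" by (simp only: power2_eq_iff)
  moreover have "\<phi> k \<noteq> - (8 * c)"
  proof
    assume n: "\<phi> k = - (8 * c)"
    have "\<phi> k \<simeq> k ^ (2 * m) * (2 * (4 * r - 1))" using \<phi>_cong_power[of k] by (simp only: \<phi>_1)
    also have "k ^ (2 * m) * (2 * (4 * r - 1)) \<simeq> J * (2 * (4 * r - 1))" by (rule cong_mult[OF k cong_refl])
    also have "J * (2 * (4 * r - 1)) = 2 * (J * (4 * r - 1))" by simp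
    also have "2 * (J * (4 * r - 1)) \<simeq> 2 * (4 * c)" by (rule cong_mult[OF cong_refl J])
    finally have d: "P dvd 2 * (8 * c)" unfolding n by (simp add: cong_iff_dvd_diff dvd_diff_commute)
    have P28: "\<not> P dvd 2" "\<not> P dvd 8" using P_ge by (intro not_dvd_small; auto)+
    have "c * 1 \<le> c * c" using c_pos by (intro mult_left_mono) auto
    moreover have "4 * (2 * c)\<^sup>2 = 16 * (c * c)" by (simp add: power2_eq_square)
    ultimately have "c < P"
      using p_squares c_pos zero_le_power2[of "4 * r - 1"] by linarith
    then have "\<not> P dvd c" using c_pos by (intro not_dvd_small) auto
    then show False using d P28 by (auto simp only: dvd_mult_iff)
  qed
  ultimately show ?thesis by blast
qed

text \<open>The number of representations of 1 is \<open>r * (r + 1) + c\<^sup>2 - 1\<close>, odd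
  exactly for even \<open>c\<close>. This is Gauss's criterion: 2 is a biquadratic residue iff
  \<open>p\<close> has the form \<open>x\<^sup>2 + 64 * y\<^sup>2\<close>.\<close>

lemma two_power_eq: "2 ^ (2 * m) \<simeq> (if even c then 1 else -1)"
proof -
  have "16 * int (diff_count 1) = P - 11 + 3 * \<phi> 1" by (rule diff_count_1) simp
  then have "int (diff_count 1) = r * (r + 1) + c\<^sup>2 - 1"
    using P_eq m_eq \<phi>_1 by (simp add: power2_eq_square algebra_simps)
  moreover have "even (r * (r + 1))" by simp
  ultimately have "odd (int (diff_count 1)) \<longleftrightarrow> even c" by simp
  then have "2 ^ (2 * m) \<simeq> 1 \<longleftrightarrow> even c" using odd_diff_count_1 by simp
  then show ?thesis using two_power_cases by auto
qed

end

subsection \<open>A Vandermonde product of roots of unity\<close>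

lemma prod_pairs_nested:
  fixes f :: "nat \<Rightarrow> nat \<Rightarrow> 'a::comm_monoid_mult"
  shows "(\<Prod>(i, j) | 1 \<le> i \<and> i < j \<and> j \<le> n. f i j) = (\<Prod>j = 1..n. \<Prod>i = 1..<j. f i j)"
proof -
  have "(\<Prod>(i, j) | 1 \<le> i \<and> i < j \<and> j \<le> n. f i j) = (\<Prod>(j, i)\<in>Sigma {1..n} (\<lambda>j. {1..<j}). f i j)"
    by (rule prod.reindex_bij_witness[of _ "\<lambda>(j, i). (i, j)" "\<lambda>(i, j). (j, i)"]) auto
  then show ?thesis by (simp add: prod.Sigma)
qed

text \<open>Every index belongs to \<open>n - 1\<close> pairs, so the sum is
  \<open>(n - 1) * n * (n + 1) / 2\<close>; the additive form avoids subtraction of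
  naturals.\<close>

lemma sum_pairs_indices: "2 * (\<Sum>j = 1..n. \<Sum>i = 1..<j. i + j) + n = (n::nat) ^ 3"
proof (induction n)
  case (Suc n)
  have "2 * (\<Sum>i = 1..<Suc n. i + k) = n * (n + 1 + 2 * k)" for k :: nat
    by (induction n) (auto simp: algebra_simps)
  from this[of "Suc n"] Suc show ?case
    by (simp add: algebra_simps eval_nat_numeral)
qed simp

lemma prod_differences_nested:
  fixes S :: "nat \<Rightarrow> 'a::comm_monoid_mult"
  shows "(\<Prod>j = 1..n. \<Prod>i = 1..<j. S (j - i)) = (\<Prod>d = 1..<n. S d ^ (n - d))"
proof (induction n)
  case (Suc n)
  have "(\<Prod>i = 1..<Suc n. S (Suc n - i)) = (\<Prod>d = 1..<Suc n. S d)"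
    by (rule prod.reindex_bij_witness[of _ "\<lambda>d. Suc n - d" "\<lambda>d. Suc n - d"]) auto
  moreover have "(\<Prod>d = 1..<n. S d ^ (n - d)) = (\<Prod>d = 1..<Suc n. S d ^ (n - d))"
    by (cases n) auto
  moreover have "(\<Prod>d = 1..<Suc n. S d ^ (n - d)) * (\<Prod>d = 1..<Suc n. S d) =
      (\<Prod>d = 1..<Suc n. S d ^ (Suc n - d))"
    unfolding prod.distrib[symmetric] by (intro prod.cong refl) (auto simp: Suc_diff_le mult.commute)
  ultimately show ?case using Suc by simp
qed simp

text \<open>The exponents at \<open>d\<close> and \<open>2 * m - d\<close> add up to
  \<open>2 * m\<close>, so with equal bases each may be replaced by \<open>m\<close>; the middle
  index already has exponent \<open>m\<close>.\<close>

lemma prod_symmetric_powers: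
  fixes S :: "nat \<Rightarrow> 'a::comm_semiring_1"
  assumes "m > 0" "\<And>d. d < 2 * m \<Longrightarrow> d > 0 \<Longrightarrow> S (2 * m - d) = S d"
  shows "(\<Prod>d = 1..<2 * m. S d ^ (2 * m - d)) = (\<Prod>d = 1..<2 * m. S d) ^ m"
proof -
  have split: "(\<Prod>d = 1..<2 * m. f d) = (\<Prod>d = 1..<m. f d * f (2 * m - d)) * f m" for f :: "nat \<Rightarrow> 'a"
  proof -
    have "{1..<2 * m} = insert m ({1..<m} \<union> {Suc m..<2 * m})" using assms(1) by auto
    then have "(\<Prod>d = 1..<2 * m. f d) = f m * ((\<Prod>d = 1..<m. f d) * (\<Prod>d = Suc m..<2 * m. f d))"
      by (simp add: prod.union_disjoint)
    also have "(\<Prod>d = Suc m..<2 * m. f d) = (\<Prod>d = 1..<m. f (2 * m - d))"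
      by (rule prod.reindex_bij_witness[of _ "\<lambda>d. 2 * m - d" "\<lambda>d. 2 * m - d"]) auto
    finally show ?thesis by (simp add: prod.distrib mult_ac)
  qed
  have "(\<Prod>d = 1..<2 * m. S d ^ (2 * m - d)) = (\<Prod>d = 1..<m. (S d * S (2 * m - d)) ^ m) * S m ^ m"
    unfolding split[of "\<lambda>d. S d ^ (2 * m - d)"]
  proof (intro arg_cong2[where f = "(*)"] prod.cong refl)
    fix d assume d: "d \<in> {1..<m}"
    then have "2 * m - (2 * m - d) = d" "2 * m - d + d = m + m" by auto
    then show "S d ^ (2 * m - d) * S (2 * m - d) ^ (2 * m - (2 * m - d)) = (S d * S (2 * m - d)) ^ m"
      using assms(2)[of d] d by (simp add: power_mult_distrib mult_2 flip: power_add)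
  qed simp
  also have "\<dots> = (\<Prod>d = 1..<2 * m. S d) ^ m"
    unfolding split by (simp only: power_mult_distrib prod_power_distrib)
  finally show ?thesis .
qed

context prime_1_mod_8 begin

text \<open>Evaluate \<open>1 + X + ... + X ^ (2 * m - 1)\<close> at 1, after factoring it over its
  roots \<open>g ^ (4 * d)\<close>. The minus sign comes from reversing an odd number of
  factors.\<close>

lemma prod_1_minus_roots:
  assumes g: "int_primroot p g"
  shows "(\<Prod>d = 1..<2 * m. g ^ (4 * d) - 1) \<simeq> - (2 * int m)"
proof -
  define X where "X = (\<lambda>d. g ^ (4 * d)) ` {1..<2 * m}"
  \<comment> \<open>Both polynomials are monic of degree \<open>2 * m - 1\<close>, so their
    difference has degree below the number of its roots modulo \<open>p\<close> and vanishes modulo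
    \<open>p\<close> at 1 as well.\<close>
  define e where "e = (\<Sum>j<2 * m. monom 1 j) - (\<Prod>x\<in>X. [:- x, 1:] :: int poly)"
  have cong_inj: "d = d'" if "d < 2 * m" "d' < 2 * m" "g ^ (4 * d) \<simeq> g ^ (4 * d')" for d d'
  proof -
    have "[4 * d = 4 * d'] (mod 8 * m)" using primroot_power_cong_iff[OF g] that(3) by blast
    then have "4 * d = 4 * d'" by (rule cong_less_modulus_unique_nat) (use that in auto)
    then show ?thesis by simp
  qed
  have inj: "inj_on (\<lambda>d. g ^ (4 * d)) {1..<2 * m}"
    by (rule inj_onI) (auto intro: cong_inj)
  have card: "card X = 2 * m - 1" unfolding X_def using card_image[OF inj] by simp
  have fin: "finite X" unfolding X_def by simp
  have deg_sum: "degree (\<Sum>j<k. monom (1::int) j) \<le> k - 1" for k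
    by (rule degree_sum_le) (auto simp: degree_monom_eq)
  have deg_prod: "degree (\<Prod>x\<in>Y. [:- x, 1:] :: int poly) = card Y" if "finite Y" for Y
    using that by (subst degree_prod_eq_sum_degree) auto
  have lc_prod: "coeff (\<Prod>x\<in>Y. [:- x, 1:] :: int poly) (card Y) = 1" if "finite Y" for Y
    using deg_prod[OF that] lead_coeff_prod[of "\<lambda>x. [:- x, 1:] :: int poly" Y] by simp
  have lc_sum: "coeff (\<Sum>j<2 * m. monom (1::int) j) (2 * m - 1) = 1"
    using m_pos by (simp add: coeff_sum)
  show ?thesis
  proof (cases "m = 0")
    case False
    have "degree e < card X"
    proof (rule ccontr)
      assume "\<not> degree e < card X"
      moreover have "degree e \<le> card X"
        unfolding e_def using deg_sum[of "2 * m"] deg_prod[OF fin] card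
        by (intro degree_diff_le) auto
      ultimately have "degree e = card X" by simp
      moreover have "coeff e (card X) = 0"
        using lc_prod[OF fin] lc_sum card by (simp add: e_def)
      ultimately have "e = 0" using leading_coeff_0_iff[of e] by simp
      then show False using \<open>degree e = card X\<close> card m_pos by simp
    qed
    have "P dvd poly e 1"
    proof (rule poly_vanishes_mod_prime[OF prime_P fin])
      show "X \<noteq> {}" using card m_pos by (intro notI) simp
      show "degree e < card X" by fact
      show "x = y" if xy: "x \<in> X" "y \<in> X" "x \<simeq> y" for x y
      proof -
        obtain d d' where d: "d < 2 * m" "d' < 2 * m" "x = g ^ (4 * d)" "y = g ^ (4 * d')"
          using xy by (auto simp: X_def)
        then show ?thesis using cong_inj[OF d(1,2)] xy(3) by blast
      qed
      show "P dvd poly e x" if x: "x \<in> X" for x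
      proof -
        obtain d where d: "1 \<le> d" "d < 2 * m" "x = g ^ (4 * d)" using x by (auto simp: X_def)
        have "poly (\<Prod>x\<in>X. [:- x, 1:]) x = 0"
          using x fin by (auto simp: poly_prod)
        then have "poly e x = (\<Sum>j<2 * m. x ^ j)" by (simp add: e_def poly_sum poly_monom)
        moreover have "(x - 1) * (\<Sum>j<2 * m. x ^ j) = x ^ (2 * m) - 1"
          by (simp add: power_diff_1_eq)
        moreover have "x ^ (2 * m) \<simeq> 1"
          using primroot_power_cong_iff[OF g, of "4 * d * (2 * m)" 0] d
          by (simp add: cong_0_iff flip: power_mult)
        moreover have "\<not> P dvd x - 1"
          using cong_inj[of d 0] d by (auto simp: cong_iff_dvd_diff)
        ultimately show ?thesis by (metis cong_iff_dvd_diff dvd_mult_iff)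
      qed
    qed
    then have "2 * int m \<simeq> (\<Prod>x\<in>X. 1 - x)"
      by (simp add: e_def poly_sum poly_monom poly_prod cong_iff_dvd_diff)
    also have "(\<Prod>x\<in>X. 1 - x) = (\<Prod>d = 1..<2 * m. 1 - g ^ (4 * d))"
      unfolding X_def prod.reindex[OF inj] comp_def ..
    also have "\<dots> = (\<Prod>d = 1..<2 * m. - 1 * (g ^ (4 * d) - 1))" by simp
    also have "\<dots> = (- 1) ^ (2 * m - 1) * (\<Prod>d = 1..<2 * m. g ^ (4 * d) - 1)"
      by (subst prod.distrib) simp
    also have "(- 1 :: int) ^ (2 * m - 1) = -1" using m_pos by simp
    finally show ?thesis by (simp add: cong_iff_dvd_diff add.commute)
  qed (use m_pos in simp)
qed

text \<open>With \<open>h = g\<^sup>2\<close> and \<open>h ^ (2 * m) \<simeq> -1\<close>, each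
  difference becomes \<open>h ^ (i + j) * S (j - i)\<close>, where \<open>S\<close> is symmetric
  under \<open>d\<close> to \<open>2 * m - d\<close>. The symmetry turns the uneven multiplicities
  of the distances into one \<open>m\<close>-th power of \<open>Q\<close>, and \<open>Q\<close>
  follows from the product over roots of unity because
  \<open>h ^ d * S d \<simeq> g ^ (4 * d) - 1\<close>.\<close>

lemma vandermonde_primroot:
  assumes g: "int_primroot p g"
  shows "(\<Prod>(i, j) | 1 \<le> i \<and> i < j \<and> j \<le> 2 * m. g ^ (4 * j) - g ^ (4 * i)) \<simeq>
    2 ^ (2 * m) * (g ^ (2 * m)) ^ (3 * (m + 1))" (is "?V \<simeq> _")
proof -
  define h where "h = g\<^sup>2"
  define I where "I = g ^ (2 * m)"
  define S where "S = (\<lambda>d. h ^ d + h ^ (2 * m - d))"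
  define Q where "Q = (\<Prod>d = 1..<2 * m. S d)"
  define s where "s = (\<Sum>j = 1..2 * m. \<Sum>i = 1..<j. i + j)"
  have hm: "h ^ m = I" by (simp add: h_def I_def flip: power_mult)
  have hn: "h ^ (2 * m) \<simeq> -1"
    using primroot_power_4m[OF g] by (simp add: h_def flip: power_mult)
  have hk: "h ^ (2 * k) = g ^ (4 * k)" for k by (simp add: h_def flip: power_mult)
  have "g ^ (4 * j) - g ^ (4 * i) \<simeq> h ^ (i + j) * S (j - i)" if "i < j" "j \<le> 2 * m" for i j
  proof -
    have e: "i + j + (j - i) = 2 * j" "i + j + (2 * m - (j - i)) = 2 * m + 2 * i"
      using that by auto
    have "h ^ (i + j) * S (j - i) = h ^ (2 * j) + h ^ (2 * m) * h ^ (2 * i)"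
      unfolding S_def distrib_left power_add[symmetric] e ..
    moreover have "h ^ (2 * j) + h ^ (2 * m) * h ^ (2 * i) \<simeq> h ^ (2 * j) + (-1) * h ^ (2 * i)"
      by (intro cong_add cong_mult hn) auto
    ultimately show ?thesis unfolding hk by (simp add: cong_sym_eq)
  qed
  then have "?V \<simeq> (\<Prod>(i, j) | 1 \<le> i \<and> i < j \<and> j \<le> 2 * m. h ^ (i + j) * S (j - i))"
    by (intro cong_prod) auto
  also have "(\<Prod>(i, j) | 1 \<le> i \<and> i < j \<and> j \<le> 2 * m. h ^ (i + j) * S (j - i)) =
      (\<Prod>j = 1..2 * m. \<Prod>i = 1..<j. h ^ (i + j)) * (\<Prod>j = 1..2 * m. \<Prod>i = 1..<j. S (j - i))"
    unfolding prod_pairs_nested by (simp only: prod.distrib)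
  also have "(\<Prod>j = 1..2 * m. \<Prod>i = 1..<j. S (j - i)) = Q ^ m"
    unfolding Q_def prod_differences_nested
    by (rule prod_symmetric_powers[OF m_pos]) (auto simp: S_def)
  also have "(\<Prod>j = 1..2 * m. \<Prod>i = 1..<j. h ^ (i + j)) = h ^ s"
    by (simp add: s_def power_sum)
  also have "s = m * (4 * m\<^sup>2 - 1)"
  proof -
    have "2 * s + 2 * m = 2 * m * (4 * m\<^sup>2)"
      using sum_pairs_indices[of "2 * m"]
      unfolding s_def[symmetric] by (simp add: power3_eq_cube power2_eq_square)
    then show ?thesis by (simp add: diff_mult_distrib2)
  qed
  finally have V: "?V \<simeq> I ^ (4 * m\<^sup>2 - 1) * Q ^ m"
    by (simp add: power_mult hm)
  have Q: "4 * (I ^ (2 * m - 1) * Q) \<simeq> 1"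
  proof -
    have "(\<Prod>d = 1..<2 * m. h ^ d) = h ^ (m * (2 * m - 1))"
    proof -
      have "2 * (\<Sum>d = 1..<k. d) = k * (k - 1)" for k :: nat
        by (induction k) (auto simp: algebra_simps split: nat_diff_split)
      from this[of "2 * m"] have "(\<Sum>d = 1..<2 * m. d) = m * (2 * m - 1)" by simp
      then show ?thesis by (simp flip: power_sum)
    qed
    then have "I ^ (2 * m - 1) * Q = (\<Prod>d = 1..<2 * m. h ^ d * S d)"
      by (simp add: prod.distrib Q_def power_mult hm)
    also have "\<dots> \<simeq> (\<Prod>d = 1..<2 * m. g ^ (4 * d) - 1)"
    proof (rule cong_prod)
      fix d assume "d \<in> {1..<2 * m}"
      then have "d + (2 * m - d) = 2 * m" by auto
      then have "h ^ d * S d = h ^ (2 * d) + h ^ (2 * m)"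
        unfolding S_def distrib_left power_add[symmetric] by (simp add: mult_2)
      moreover have "h ^ (2 * d) + h ^ (2 * m) \<simeq> h ^ (2 * d) + (-1)" by (intro cong_add hn) simp
      ultimately show "h ^ d * S d \<simeq> g ^ (4 * d) - 1" unfolding hk by simp
    qed
    also have "(\<Prod>d = 1..<2 * m. g ^ (4 * d) - 1) \<simeq> - (2 * int m)" by (rule prod_1_minus_roots[OF g])
    finally have "4 * (I ^ (2 * m - 1) * Q) \<simeq> 4 * - (2 * int m)" by (intro cong_mult) auto
    \<comment> \<open>The factor 4 was introduced because \<open>8 * m = P - 1\<close>; thus 4 is
      inverse to \<open>- (2 * int m)\<close>.\<close>
    also have "4 * - (2 * int m) = 1 + P * (-1)" by (simp add: P_eq)
    also have "1 + P * (-1) \<simeq> 1" by (simp add: cong_iff_dvd_diff)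
    finally show ?thesis .
  qed
  define t where "t = (2 :: int) ^ (2 * m)"
  have t2: "t * t \<simeq> 1"
    using two_power_cases cong_mult[of t 1 P t 1] cong_mult[of t "-1" P t "-1"] by (auto simp: t_def)
  have I4: "I ^ (4 * k) \<simeq> 1" for k
    using primroot_power_cong_iff[OF g, of "2 * m * (4 * k)" 0]
    by (simp add: I_def cong_0_iff flip: power_mult)
  have Qm: "t * I ^ ((2 * m - 1) * m) * Q ^ m \<simeq> 1"
    using cong_pow[OF Q, of m] by (simp add: t_def power_mult_distrib power_mult mult.assoc)
  \<comment> \<open>Both sides are multiplied by factors congruent to 1, chosen so that the known
    product \<open>t * I ^ ((2 * m - 1) * m) * Q ^ m\<close> can be split off without
    inverses.\<close>
  have "?V * (t * t) * I ^ (4 * ((2 * m - 1) * m)) \<simeq> I ^ (4 * m\<^sup>2 - 1) * Q ^ m * (t * t) * I ^ (4 * ((2 * m - 1) * m))"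
    by (rule cong_mult[OF cong_mult[OF V cong_refl] cong_refl])
  also have "I ^ (4 * m\<^sup>2 - 1) * Q ^ m * (t * t) * I ^ (4 * ((2 * m - 1) * m)) =
      (t * I ^ ((2 * m - 1) * m) * Q ^ m) * (t * I ^ (4 * m\<^sup>2 - 1 + 3 * ((2 * m - 1) * m)))"
  proof -
    have e: "I ^ (4 * x) = I ^ x * I ^ (3 * x)" for x
      by (simp flip: power_add)
    show ?thesis unfolding e power_add by (simp only: mult_ac)
  qed
  also have "(t * I ^ ((2 * m - 1) * m) * Q ^ m) * (t * I ^ (4 * m\<^sup>2 - 1 + 3 * ((2 * m - 1) * m))) \<simeq> 1 * (t * I ^ (4 * m\<^sup>2 - 1 + 3 * ((2 * m - 1) * m)))"
    by (rule cong_mult[OF Qm cong_refl])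
  also have "1 * (t * I ^ (4 * m\<^sup>2 - 1 + 3 * ((2 * m - 1) * m))) \<simeq> t * I ^ (3 * (m + 1))"
  proof -
    obtain q where q: "m = Suc q" using m_pos by (cases m) auto
    have "even ((5 * q + 7) * q)" by simp
    then obtain k where k: "(5 * q + 7) * q = 2 * k" by (rule evenE)
    \<comment> \<open>The excess over \<open>3 * (m + 1)\<close> is twice an even number, hence a
      multiple of 4, the order of \<open>I\<close>.\<close>
    have "4 * m\<^sup>2 - 1 + 3 * ((2 * m - 1) * m) = 3 * (m + 1) + 2 * ((5 * q + 7) * q)"
      unfolding q by (simp add: power2_eq_square algebra_simps)
    then have "I ^ (4 * m\<^sup>2 - 1 + 3 * ((2 * m - 1) * m)) = I ^ (3 * (m + 1)) * I ^ (4 * k)"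
      unfolding k by (simp add: power_add)
    also have "\<dots> \<simeq> I ^ (3 * (m + 1)) * 1" by (rule cong_mult[OF cong_refl I4])
    finally show ?thesis using cong_mult[OF cong_refl[of t]] by simp
  qed
  finally have "?V * (t * t) * I ^ (4 * ((2 * m - 1) * m)) \<simeq> t * I ^ (3 * (m + 1))" .
  moreover have "?V * (t * t) * I ^ (4 * ((2 * m - 1) * m)) \<simeq> ?V * 1 * 1"
    by (rule cong_mult[OF cong_mult[OF cong_refl t2] I4])
  ultimately show ?thesis by (simp add: t_def I_def cong_def)
qed

end

subsection \<open>Residue classes in the half interval\<close>

context prime_1_mod_8 begin

definition abs_residue :: "int \<Rightarrow> int" where
  "abs_residue x = (if 2 * (x mod P) < P then x mod P else P - x mod P)"

text \<open>For \<open>x\<close> prime to \<open>p\<close> this is the sign of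
  \<open>sin (2 * pi * x / p)\<close>, which is how \<open>lam\<close> enters.\<close>

definition residue_sign :: "int \<Rightarrow> int" where
  "residue_sign x = (if 2 * (x mod P) < P then 1 else -1)"

lemma two_mult_neq_P: "2 * x \<noteq> P"
proof
  assume "2 * x = P"
  then have "even P" by (metis dvd_triv_left)
  then show False using odd_P by contradiction
qed

lemma residue_sign_cases: "residue_sign x = 1 \<or> residue_sign x = -1"
  by (simp add: residue_sign_def)

lemma abs_residue_cong: "x \<simeq> residue_sign x * abs_residue x"
  by (simp add: residue_sign_def abs_residue_def cong_def)

lemma abs_residue_square: "(abs_residue x)\<^sup>2 \<simeq> x\<^sup>2"
proof -
  have "x\<^sup>2 \<simeq> (residue_sign x * abs_residue x)\<^sup>2"
    by (intro cong_pow abs_residue_cong)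
  also have "(residue_sign x * abs_residue x)\<^sup>2 = (abs_residue x)\<^sup>2"
    using residue_sign_cases[of x] by auto
  finally show ?thesis by (rule cong_sym)
qed

lemma abs_residue_bounds:
  assumes "\<not> P dvd x"
  shows "0 < abs_residue x" "2 * abs_residue x < P"
proof -
  have "x mod P \<noteq> 0" using assms by (simp add: dvd_eq_mod_eq_0)
  moreover have "0 \<le> x mod P" "x mod P < P" using P_ge by auto
  ultimately show "0 < abs_residue x" "2 * abs_residue x < P"
    using two_mult_neq_P[of "x mod P"] by (auto simp: abs_residue_def)
qed

lemma abs_residue_eqI:
  assumes "0 < k" "2 * k < P" "k\<^sup>2 \<simeq> x\<^sup>2"
  shows "abs_residue x = k"
proof -
  have "P dvd x \<longleftrightarrow> P dvd k" using cong_dvd[OF assms(3)] by (simp add: dvd_power_iff)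
  then have "\<not> P dvd x" using assms not_dvd_small[of k] by auto
  then show ?thesis
    using abs_residue_bounds[of x] assms cong_trans[OF abs_residue_square cong_sym[OF assms(3)]]
    by (intro half_square_inj) auto
qed

lemma Omega_iff: "x \<in> Omega p \<epsilon> \<longleftrightarrow> 0 < x \<and> 2 * x < P \<and> x ^ (2 * m) \<simeq> \<epsilon>"
  using p_eq by (simp add: Omega_def)

text \<open>The class consists of the absolute residues of \<open>g ^ (e0 + 4 * i)\<close> for
  \<open>i < m\<close>. Passing to absolute residues loses signs, so only the square is determined;
  it is a power of \<open>g\<close> with exponent
  \<open>2 * m * e0 + 4 * m * (m - 1)\<close>.\<close>

lemma prod_Omega_square:
  assumes g: "int_primroot p g" and e0: "e0 < 4"
  shows "(\<Prod>(Omega p (g ^ (2 * m * e0))))\<^sup>2 \<simeq> (-1) ^ (m + 1) * g ^ (2 * m * e0)"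
proof -
  let ?y = "\<lambda>i. g ^ (e0 + 4 * i)"
  have nd: "\<not> P dvd g ^ k" for k
    using primroot_not_dvd[OF g] by (cases "k = 0") (auto simp: dvd_power_iff not_dvd_small P_ge)
  have sq: "(g ^ k)\<^sup>2 = g ^ (2 * k)" for k by (simp add: mult.commute flip: power_mult)
  have bij: "bij_betw (\<lambda>i. abs_residue (?y i)) {..<m} (Omega p (g ^ (2 * m * e0)))"
    unfolding bij_betw_def
  proof (intro conjI inj_onI equalityI subsetI)
    fix i j assume ij: "i \<in> {..<m}" "j \<in> {..<m}" "abs_residue (?y i) = abs_residue (?y j)"
    then have "(?y i)\<^sup>2 \<simeq> (?y j)\<^sup>2"
      using abs_residue_square[of "?y i"] abs_residue_square[of "?y j"] by (simp add: cong_def)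
    then have "[2 * (e0 + 4 * i) = 2 * (e0 + 4 * j)] (mod 8 * m)"
      unfolding sq primroot_power_cong_iff[OF g] .
    then have "[8 * i = 8 * j] (mod 8 * m)"
      by (simp add: distrib_left cong_add_lcancel_nat)
    then have "8 * i = 8 * j" by (rule cong_less_modulus_unique_nat) (use ij in auto)
    then show "i = j" by simp
  next
    fix x assume "x \<in> (\<lambda>i. abs_residue (?y i)) ` {..<m}"
    then obtain i where i: "x = abs_residue (?y i)" by auto
    have "x ^ (2 * m) = (x\<^sup>2) ^ m" by (simp flip: power_mult)
    also have "(x\<^sup>2) ^ m \<simeq> ((?y i)\<^sup>2) ^ m" unfolding i by (intro cong_pow abs_residue_square)
    also have "((?y i)\<^sup>2) ^ m = g ^ (2 * m * e0 + 8 * m * i)"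
      by (simp add: algebra_simps flip: power_mult)
    also have "g ^ (2 * m * e0 + 8 * m * i) \<simeq> g ^ (2 * m * e0)"
      unfolding primroot_power_cong_iff[OF g] by (simp add: cong_def)
    finally show "x \<in> Omega p (g ^ (2 * m * e0))"
      using abs_residue_bounds[OF nd] unfolding i Omega_iff by blast
  next
    fix x assume "x \<in> Omega p (g ^ (2 * m * e0))"
    then have x: "0 < x" "2 * x < P" "x ^ (2 * m) \<simeq> g ^ (2 * m * e0)" by (auto simp: Omega_iff)
    then have "\<not> P dvd x" by (intro not_dvd_small) auto
    then obtain e where e: "e < 8 * m" "x \<simeq> g ^ e" using primroot_generates[OF g] by blast
    have "g ^ (2 * m * e) \<simeq> g ^ (2 * m * e0)"
      using cong_pow[OF e(2), of "2 * m"] x(3) by (simp add: cong_def mult.commute flip: power_mult)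
    then have "[2 * m * e = 2 * m * e0] (mod 2 * m * 4)"
      unfolding primroot_power_cong_iff[OF g] by (simp add: mult.commute mult.left_commute)
    then have "2 * m * (e mod 4) = 2 * m * (e0 mod 4)"
      by (simp only: cong_def mult_mod_right)
    then have "e mod 4 = e0" using e0 m_pos by simp
    then obtain q where q: "e = e0 + 4 * q" by (metis mod_mult_div_eq)
    \<comment> \<open>As \<open>g ^ (4 * m)\<close> is -1, shifting \<open>q\<close> by
      \<open>m\<close> only negates the power and keeps its absolute residue.\<close>
    define i where "i = (if q < m then q else q - m)"
    have "q < 2 * m" using e(1) q by simp
    then have i: "i < m" by (auto simp: i_def)
    have "2 * e = 2 * (e0 + 4 * i) \<or> 2 * e = 2 * (e0 + 4 * i) + 8 * m"
      using q by (auto simp: i_def)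
    then have "[2 * e = 2 * (e0 + 4 * i)] (mod 8 * m)"
      by (auto simp: cong_def)
    then have "(g ^ e)\<^sup>2 \<simeq> (?y i)\<^sup>2" unfolding sq primroot_power_cong_iff[OF g] .
    with cong_pow[OF e(2), of 2] have "x\<^sup>2 \<simeq> (?y i)\<^sup>2" by (rule cong_trans)
    then have "abs_residue (?y i) = x" using x by (intro abs_residue_eqI) auto
    then show "x \<in> (\<lambda>i. abs_residue (?y i)) ` {..<m}" using i by blast
  qed
  have "(\<Prod>(Omega p (g ^ (2 * m * e0))))\<^sup>2 = (\<Prod>i<m. (abs_residue (?y i))\<^sup>2)"
    using prod.reindex_bij_betw[OF bij, of "\<lambda>x. x"] by (simp flip: prod_power_distrib)
  also have "(\<Prod>i<m. (abs_residue (?y i))\<^sup>2) \<simeq> (\<Prod>i<m. (?y i)\<^sup>2)"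
    by (intro cong_prod abs_residue_square)
  also have "(\<Prod>i<m. (?y i)\<^sup>2) = g ^ (2 * m * e0) * (g ^ (4 * m)) ^ (m - 1)"
  proof -
    have "(\<Sum>i<k. 2 * (e0 + 4 * i)) + 4 * k = 2 * k * e0 + 4 * k * k" for k
      by (induction k) (auto simp: algebra_simps)
    moreover obtain q where "m = Suc q" using m_pos by (cases m) auto
    ultimately have "(\<Sum>i<m. 2 * (e0 + 4 * i)) = 2 * m * e0 + 4 * m * (m - 1)"
      by (simp add: algebra_simps)
    then have "(\<Prod>i<m. g ^ (2 * (e0 + 4 * i))) = g ^ (2 * m * e0 + 4 * m * (m - 1))"
      by (simp only: power_sum[symmetric])
    then show ?thesis unfolding sq by (simp only: power_add power_mult)
  qed
  also have "g ^ (2 * m * e0) * (g ^ (4 * m)) ^ (m - 1) \<simeq> g ^ (2 * m * e0) * (-1) ^ (m - 1)"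
    by (intro cong_mult cong_refl cong_pow primroot_power_4m[OF g])
  also have "(-1 :: int) ^ (m - 1) = (-1) ^ (m + 1)"
    using m_pos by (cases m) auto
  finally show ?thesis by (simp add: mult.commute)
qed

lemma square_minus_1_cases:
  assumes J: "J\<^sup>2 \<simeq> -1" and g: "int_primroot p g"
  shows "J \<simeq> g ^ (2 * m * 1) \<or> J \<simeq> g ^ (2 * m * 3)"
proof -
  have "(g ^ (2 * m))\<^sup>2 \<simeq> -1"
    using primroot_power_4m[OF g] by (simp add: mult.commute flip: power_mult)
  then have "J\<^sup>2 \<simeq> (g ^ (2 * m))\<^sup>2" using J by (simp add: cong_def)
  then have "J \<simeq> g ^ (2 * m) \<or> J \<simeq> - (g ^ (2 * m))" by (simp add: cong_square_iff)
  moreover have "- (g ^ (2 * m)) \<simeq> g ^ (2 * m * 3)"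
  proof -
    have "g ^ (4 * m) * g ^ (2 * m) \<simeq> (-1) * g ^ (2 * m)"
      by (rule cong_mult[OF primroot_power_4m[OF g] cong_refl])
    then show ?thesis by (simp add: cong_sym_eq flip: power_add)
  qed
  ultimately show ?thesis using cong_trans by auto
qed

lemma Omega_cong: "\<epsilon> \<simeq> \<delta> \<Longrightarrow> Omega p \<epsilon> = Omega p \<delta>"
  unfolding Omega_def by (auto simp: cong_def)

text \<open>The fourth roots of unity are the powers \<open>g ^ (2 * m * e)\<close> with
  \<open>e < 4\<close>, so the preceding computation covers every class without mention of
  \<open>g\<close>.\<close>

lemma prod_Omega_cases:
  assumes "\<epsilon> \<simeq> 1 \<or> \<epsilon> \<simeq> -1 \<or> \<epsilon>\<^sup>2 \<simeq> -1"
  shows "(\<Prod>(Omega p \<epsilon>))\<^sup>2 \<simeq> (-1) ^ (m + 1) * \<epsilon>"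
proof -
  obtain g where g: "int_primroot p g" using primroot_exists ..
  have "\<exists>e<4. \<epsilon> \<simeq> g ^ (2 * m * e)"
  proof -
    have "\<epsilon> \<simeq> g ^ (2 * m * 0)" if "\<epsilon> \<simeq> 1" using that by simp
    moreover have "\<epsilon> \<simeq> g ^ (2 * m * 2)" if "\<epsilon> \<simeq> -1"
      using that primroot_power_4m[OF g] by (simp add: cong_def mult.commute)
    moreover have "\<epsilon> \<simeq> g ^ (2 * m * 1) \<or> \<epsilon> \<simeq> g ^ (2 * m * 3)" if "\<epsilon>\<^sup>2 \<simeq> -1"
      using that g by (rule square_minus_1_cases)
    ultimately have "\<exists>e\<in>{0, 1, 2, 3}. \<epsilon> \<simeq> g ^ (2 * m * e)" using assms by blast
    moreover have "{0, 1, 2, 3} \<subseteq> {e. e < (4 :: nat)}" by auto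
    ultimately show ?thesis by blast
  qed
  then obtain e where e: "e < 4" "\<epsilon> \<simeq> g ^ (2 * m * e)" by blast
  have "(-1) ^ (m + 1) * g ^ (2 * m * e) \<simeq> (-1) ^ (m + 1) * \<epsilon>"
    by (rule cong_mult[OF cong_refl cong_sym[OF e(2)]])
  then show ?thesis
    using prod_Omega_square[OF g e(1)] unfolding Omega_cong[OF e(2)] by (rule cong_trans[rotated])
qed

lemma half_partition:
  fixes f :: "int \<Rightarrow> int"
  assumes J: "J\<^sup>2 \<simeq> -1"
  shows "(\<Prod>x | 0 < x \<and> 2 * x < P. f x) =
    (\<Prod>x\<in>Omega p 1. f x) * (\<Prod>x\<in>Omega p (-1). f x) *
    ((\<Prod>x\<in>Omega p J. f x) * (\<Prod>x\<in>Omega p (- J). f x))"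
proof -
  have fin: "finite (Omega p \<epsilon>)" for \<epsilon>
    by (rule finite_subset[of _ F]) (auto simp: Omega_def)
  have d2: "\<not> P dvd 2" using P_ge by (intro not_dvd_small) auto
  have ndJ: "\<not> P dvd J" using \<psi>_sqrt_minus_1[OF J] \<psi>_eq_0_iff[of J] by auto
  have n1: "\<not> 1 \<simeq> -1" "\<not> J \<simeq> - J"
    using d2 ndJ dvd_mult_iff[of 2 J] by (auto simp: cong_iff_dvd_diff)
  have n2: "\<not> s \<simeq> t" if "s\<^sup>2 = 1" "t\<^sup>2 = J\<^sup>2" for s t
  proof
    assume "s \<simeq> t"
    then have "s\<^sup>2 \<simeq> t\<^sup>2" by (rule cong_pow)
    then show False using that J n1(1) by (simp add: cong_def)
  qed
  have disj: "Omega p s \<inter> Omega p t = {}" if "\<not> s \<simeq> t" for s t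
    using that by (auto simp: Omega_iff cong_def)
  have "{x. 0 < x \<and> 2 * x < P} = (Omega p 1 \<union> Omega p (-1)) \<union> (Omega p J \<union> Omega p (- J))"
  proof -
    have "x ^ (2 * m) \<simeq> 1 \<or> x ^ (2 * m) \<simeq> -1 \<or> x ^ (2 * m) \<simeq> J \<or> x ^ (2 * m) \<simeq> - J"
      if "0 < x" "2 * x < P" for x
    proof -
      have "\<not> P dvd x" using that by (intro not_dvd_small) auto
      then have "\<psi> x = 1 \<or> \<psi> x = -1" using \<psi>_cases[of x] \<psi>_eq_0_iff[of x] by auto
      moreover have "(x ^ (2 * m))\<^sup>2 \<simeq> \<psi> x"
        using \<psi>_euler[of x] by (simp add: cong_sym_eq mult.commute flip: power_mult)
      ultimately have "(x ^ (2 * m))\<^sup>2 \<simeq> 1\<^sup>2 \<or> (x ^ (2 * m))\<^sup>2 \<simeq> J\<^sup>2"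
        using J by (auto simp: cong_def)
      then show ?thesis unfolding cong_square_iff by blast
    qed
    then show ?thesis
      by (intro Set.set_eqI) (unfold Un_iff mem_Collect_eq Omega_iff, blast)
  qed
  moreover have "(Omega p 1 \<union> Omega p (-1)) \<inter> (Omega p J \<union> Omega p (- J)) = {}"
    using disj[OF n2] by (simp add: Int_Un_distrib Int_Un_distrib2)
  ultimately show ?thesis
    using disj[OF n1(1)] disj[OF n1(2)] fin by (simp add: prod.union_disjoint)
qed

lemma card_H: "card H = 2 * m"
proof -
  have "4 * (\<Sum>x\<in>H. 1) = (\<Sum>x\<in>F - {0}. 1 + \<psi> x)"
    using sum_H[of "\<lambda>_. 1"] by simp
  also have "\<dots> = P - 1 + (\<Sum>x\<in>F. \<psi> x)"
    using card_F_0 by (simp add: sum.distrib sum_F_split[of \<psi>])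
  finally have "4 * int (card H) = P - 1" by (simp add: sum_\<psi>)
  then show ?thesis using P_eq by linarith
qed

lemma half_qr_bij: "bij_betw (half_qr p) {1..2 * m} H"
  and half_qr_mono: "\<lbrakk>1 \<le> i; i < j; j \<le> 2 * m\<rbrakk> \<Longrightarrow> half_qr p i < half_qr p j"
proof -
  let ?l = "sorted_list_of_set H"
  have hq: "half_qr p i = ?l ! (i - 1)" for i
    unfolding half_qr_def H_def ..
  have len: "length ?l = 2 * m" using card_H by simp
  show mono: "half_qr p i < half_qr p j" if "1 \<le> i" "i < j" "j \<le> 2 * m" for i j
    unfolding hq using that len
    by (intro sorted_wrt_nth_less[OF strict_sorted_list_of_set]) auto
  have "inj_on (half_qr p) {1..2 * m}"
  proof (rule inj_onI)
    fix i j assume "i \<in> {1..2 * m}" "j \<in> {1..2 * m}" "half_qr p i = half_qr p j"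
    then show "i = j" using mono[of i j] mono[of j i] by (cases i j rule: linorder_cases) auto
  qed
  moreover have "half_qr p i \<in> H" if "i \<in> {1..2 * m}" for i
  proof -
    have "?l ! (i - 1) \<in> set ?l" using that len by (intro nth_mem) auto
    then show ?thesis using H_subset(2) by (simp add: hq)
  qed
  then have "half_qr p ` {1..2 * m} \<subseteq> H" by blast
  ultimately show "bij_betw (half_qr p) {1..2 * m} H"
    using H_subset(2) card_H by (intro bij_betw_imageI card_subset_eq) (auto simp: card_image)
qed

lemma prod_pairs_half_qr:
  fixes f :: "int \<Rightarrow> int \<Rightarrow> 'a::comm_monoid_mult"
  shows "(\<Prod>(i, j) | 1 \<le> i \<and> i < j \<and> j \<le> 2 * m. f (half_qr p i) (half_qr p j)) =
    (\<Prod>(u, v) | u \<in> H \<and> v \<in> H \<and> u < v. f u v)"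
proof -
  let ?h = "\<lambda>(i, j). (half_qr p i, half_qr p j)"
  have inj: "inj_on (half_qr p) {1..2 * m}" and img: "half_qr p ` {1..2 * m} = H"
    using half_qr_bij by (auto simp: bij_betw_def)
  have "bij_betw ?h {(i, j). 1 \<le> i \<and> i < j \<and> j \<le> 2 * m} {(u, v). u \<in> H \<and> v \<in> H \<and> u < v}"
    unfolding bij_betw_def
  proof (intro conjI inj_onI equalityI subsetI)
    fix x y assume "x \<in> {(i, j). 1 \<le> i \<and> i < j \<and> j \<le> 2 * m}"
      "y \<in> {(i, j). 1 \<le> i \<and> i < j \<and> j \<le> 2 * m}" and eq: "?h x = ?h y"
    then obtain i j k l where xy: "x = (i, j)" "y = (k, l)"
      "i \<in> {1..2 * m}" "j \<in> {1..2 * m}" "k \<in> {1..2 * m}" "l \<in> {1..2 * m}" by fastforce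
    then show "x = y"
      using eq inj_onD[OF inj, of i k] inj_onD[OF inj, of j l] by simp
  next
    fix x assume "x \<in> ?h ` {(i, j). 1 \<le> i \<and> i < j \<and> j \<le> 2 * m}"
    then obtain i j where x: "x = (half_qr p i, half_qr p j)" "1 \<le> i" "i < j" "j \<le> 2 * m"
      by auto
    then have "i \<in> {1..2 * m}" "j \<in> {1..2 * m}" by auto
    then have "half_qr p i \<in> H" "half_qr p j \<in> H" using img by blast+
    then show "x \<in> {(u, v). u \<in> H \<and> v \<in> H \<and> u < v}"
      using half_qr_mono[OF x(2-4)] x(1) by simp
  next
    fix x assume "x \<in> {(u, v). u \<in> H \<and> v \<in> H \<and> u < v}"
    then obtain u v where x: "x = (u, v)" "u \<in> H" "v \<in> H" "u < v" by auto
    then obtain i j where ij: "i \<in> {1..2 * m}" "j \<in> {1..2 * m}" "u = half_qr p i" "v = half_qr p j"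
      using img by blast
    have "i < j"
      using ij x(4) half_qr_mono[of j i] by (cases i j rule: linorder_cases) auto
    then show "x \<in> ?h ` {(i, j). 1 \<le> i \<and> i < j \<and> j \<le> 2 * m}"
      using ij x(1) by (intro image_eqI[of _ _ "(i, j)"]) auto
  qed
  from prod.reindex_bij_betw[OF this, of "\<lambda>(u, v). f u v"] show ?thesis
    by (simp add: case_prod_beta)
qed

end

subsection \<open>The permutation and its difference product\<close>

context prime_1_mod_8 begin

definition quartic :: "nat \<Rightarrow> int" where
  "quartic i = (half_qr p i)\<^sup>2 mod P"

abbreviation Quartics :: "int set" where
  "Quartics \<equiv> quartic ` {1..2 * m}"

lemma half_qr_in_H: "i \<in> {1..2 * m} \<Longrightarrow> half_qr p i \<in> H"
  using half_qr_bij by (auto simp: bij_betw_def)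

lemma inj_quartic: "inj_on quartic {1..2 * m}"
proof (rule inj_onI)
  fix i j assume ij: "i \<in> {1..2 * m}" "j \<in> {1..2 * m}" "quartic i = quartic j"
  have "half_qr p i = half_qr p j"
    using half_qr_in_H[OF ij(1)] half_qr_in_H[OF ij(2)] ij(3)
    by (intro half_square_inj) (auto simp: H_iff quartic_def cong_def)
  then show "i = j" using inj_onD[OF bij_betw_imp_inj_on[OF half_qr_bij]] ij(1,2) by blast
qed

lemma bij_power_quartics:
  assumes g: "int_primroot p g"
  shows "bij_betw (\<lambda>i. g ^ (4 * i) mod P) {1..2 * m} Quartics"
proof -
  have inj: "inj_on (\<lambda>i. g ^ (4 * i) mod P) {1..2 * m}"
  proof (rule inj_onI)
    fix i j assume ij: "i \<in> {1..2 * m}" "j \<in> {1..2 * m}" "g ^ (4 * i) mod P = g ^ (4 * j) mod P"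
    then have "g ^ (4 * i) \<simeq> g ^ (4 * j)" by (simp add: cong_def)
    then have "[4 * i = 4 * j] (mod 8 * m)" unfolding primroot_power_cong_iff[OF g] .
    \<comment> \<open>The last exponent equals the modulus \<open>8 * m\<close>; after the shift by
      4 all exponents lie below it, where congruence means equality.\<close>
    moreover have "4 * i = 4 + 4 * (i - 1)" "4 * j = 4 + 4 * (j - 1)" using ij(1,2) by auto
    ultimately have "[4 * (i - 1) = 4 * (j - 1)] (mod 8 * m)"
      by (metis cong_add_lcancel_nat)
    then have "4 * (i - 1) = 4 * (j - 1)"
      by (rule cong_less_modulus_unique_nat) (use ij(1,2) in auto)
    then show "i = j" using ij(1,2) by auto
  qed
  have "g ^ (4 * i) mod P \<in> Quartics" for i
  proof -
    have "(g ^ (4 * i)) ^ (2 * m) \<simeq> 1"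
      using primroot_power_cong_iff[OF g, of "4 * i * (2 * m)" 0]
      by (simp add: cong_0_iff flip: power_mult)
    then obtain u where u: "u \<in> H" "u\<^sup>2 \<simeq> g ^ (4 * i)" by (rule fourth_power_root)
    then obtain j where j: "j \<in> {1..2 * m}" "u = half_qr p j"
      using bij_betw_imp_surj_on[OF half_qr_bij] by blast
    then have "g ^ (4 * i) mod P = quartic j" using u(2) by (simp add: quartic_def cong_def)
    then show ?thesis using j(1) by blast
  qed
  then have "(\<lambda>i. g ^ (4 * i) mod P) ` {1..2 * m} \<subseteq> Quartics" by blast
  then show ?thesis
    using inj inj_quartic by (intro bij_betw_imageI card_subset_eq) (auto simp: card_image)
qed

text \<open>The description in \<open>tau\<close> has exactly one solution: the values on the
  biquadratic residues are prescribed and bijective, and a permutation of that set fixes everything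
  else.\<close>

lemma tau_props:
  assumes g: "int_primroot p g"
  shows "tau p g permutes Quartics"
    and "i \<in> {1..2 * m} \<Longrightarrow> tau p g (quartic i) = g ^ (4 * i) mod P"
proof -
  let ?r = "\<lambda>i. g ^ (4 * i) mod P" and ?k = "inv_into {1..2 * m} quartic"
  define \<sigma> where "\<sigma> = (\<lambda>x. if x \<in> Quartics then ?r (?k x) else x)"
  have "bij_betw ?k Quartics {1..2 * m}"
    using inj_quartic by (intro bij_betw_inv_into) (simp add: bij_betw_def)
  then have "bij_betw (?r \<circ> ?k) Quartics Quartics"
    using bij_power_quartics[OF g] by (rule bij_betw_trans)
  then have "bij_betw \<sigma> Quartics Quartics"
    by (rule bij_betw_cong[THEN iffD1, rotated]) (simp add: \<sigma>_def)
  then have perm: "\<sigma> permutes Quartics"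
    by (rule bij_imp_permutes) (simp add: \<sigma>_def)
  have val: "\<sigma> (quartic i) = ?r i" if "i \<in> {1..2 * m}" for i
    using that inv_into_f_f[OF inj_quartic that] by (simp add: \<sigma>_def)
  let ?Q = "\<lambda>\<sigma>. \<sigma> permutes Quartics \<and> (\<forall>i\<in>{1..2 * m}. \<sigma> (quartic i) = ?r i)"
  have "(p - 1) div 4 = 2 * m" using p_eq by simp
  then have tau: "tau p g = (THE \<sigma>. ?Q \<sigma>)"
    by (simp add: tau_def quartic_def)
  have "?Q (tau p g)"
    unfolding tau
  proof (rule theI[of ?Q \<sigma>])
    show "?Q \<sigma>" using perm val by blast
    fix \<rho> assume \<rho>: "?Q \<rho>"
    show "\<rho> = \<sigma>"
    proof
      fix x
      show "\<rho> x = \<sigma> x"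
      proof (cases "x \<in> Quartics")
        case True
        then show ?thesis using \<rho> val by auto
      next
        case False
        then show ?thesis using \<rho> perm permutes_not_in by metis
      qed
    qed
  qed
  then show "tau p g permutes Quartics"
    and "i \<in> {1..2 * m} \<Longrightarrow> tau p g (quartic i) = g ^ (4 * i) mod P" by blast+
qed

definition square_differences :: int where
  "square_differences = (\<Prod>(u, v) | u \<in> H \<and> v \<in> H \<and> u < v. v\<^sup>2 - u\<^sup>2)"

text \<open>Ordered by index, the difference product before applying \<open>tau p g\<close> is
  \<open>square_differences\<close> modulo \<open>p\<close>, and the one after it is the Vandermonde
  product of the powers of \<open>g ^ 4\<close>.\<close>

lemma sign_tau_cong:
  assumes g: "int_primroot p g"
  shows "sign (tau p g) * square_differences \<simeq> 2 ^ (2 * m) * (g ^ (2 * m)) ^ (3 * (m + 1))"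
proof -
  define key where "key = inv_into {1..2 * m} quartic"
  let ?I = "{(i, j). 1 \<le> i \<and> i < j \<and> j \<le> 2 * m}"
  have k: "key (quartic i) = i" if "i \<in> {1..2 * m}" for i
    unfolding key_def using inj_quartic that by (rule inv_into_f_f)
  have reindex: "(\<Prod>(x, y) | x \<in> Quartics \<and> y \<in> Quartics \<and> key x < key y. f y - f x) =
      (\<Prod>(i, j)\<in>?I. f (quartic j) - f (quartic i))" for f :: "int \<Rightarrow> int"
    by (rule prod.reindex_bij_witness[of _ "\<lambda>(i, j). (quartic i, quartic j)" "\<lambda>(x, y). (key x, key y)"])
       (auto simp: k)
  have "inj_on key Quartics" unfolding key_def by (rule inj_on_inv_into) simp
  from sign_eq_prod_differences[OF _ this tau_props(1)[OF g], of "\<lambda>x. x"]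
  have "sign (tau p g) * (\<Prod>(i, j)\<in>?I. quartic j - quartic i) =
      (\<Prod>(i, j)\<in>?I. tau p g (quartic j) - tau p g (quartic i))"
    using reindex[of "\<lambda>x. x"] reindex[of "tau p g"] by simp
  also have "\<dots> = (\<Prod>(i, j)\<in>?I. g ^ (4 * j) mod P - g ^ (4 * i) mod P)"
    by (intro prod.cong) (auto simp: tau_props(2)[OF g])
  finally have tau: "sign (tau p g) * (\<Prod>(i, j)\<in>?I. quartic j - quartic i) =
      (\<Prod>(i, j)\<in>?I. g ^ (4 * j) mod P - g ^ (4 * i) mod P)" .
  have "(\<Prod>(i, j)\<in>?I. (half_qr p j)\<^sup>2 - (half_qr p i)\<^sup>2) \<simeq>
      (\<Prod>(i, j)\<in>?I. quartic j - quartic i)"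
    by (intro cong_prod) (auto simp: quartic_def intro!: cong_diff)
  moreover have "(\<Prod>(i, j)\<in>?I. (half_qr p j)\<^sup>2 - (half_qr p i)\<^sup>2) = square_differences"
    unfolding square_differences_def by (rule prod_pairs_half_qr)
  ultimately have "square_differences \<simeq> (\<Prod>(i, j)\<in>?I. quartic j - quartic i)"
    by (simp only:)
  then have "sign (tau p g) * square_differences \<simeq>
      sign (tau p g) * (\<Prod>(i, j)\<in>?I. quartic j - quartic i)"
    by (rule cong_mult[OF cong_refl])
  also note tau
  also have "(\<Prod>(i, j)\<in>?I. g ^ (4 * j) mod P - g ^ (4 * i) mod P) \<simeq>
      (\<Prod>(i, j)\<in>?I. g ^ (4 * j) - g ^ (4 * i))"
    by (intro cong_prod) (auto intro!: cong_diff)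
  also note vandermonde_primroot[OF g]
  finally show ?thesis .
qed

section \<open>Signs of the sines and counting absolute residues\<close>

lemma sgn_sin_residue:
  assumes "\<not> P dvd x"
  shows "sgn (sin (2 * pi * real_of_int x / real p)) = real_of_int (residue_sign x)"
proof -
  define t where "t = x mod P"
  have t: "0 < t" "t < P"
    using assms P_ge pos_mod_bound[of P x] pos_mod_sign[of P x]
    by (auto simp: t_def dvd_eq_mod_eq_0 less_le)
  have p0: "real p > 0" using P_ge by simp
  have "x = t + P * (x div P)" by (simp add: t_def)
  then have "real_of_int x = real_of_int t + real p * real_of_int (x div P)"
    by (metis of_int_add of_int_mult of_int_of_nat_eq)
  then have "2 * pi * real_of_int x / real p = 2 * pi * real_of_int t / real p + 2 * pi * real_of_int (x div P)"
    using p0 by (simp add: field_simps)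
  then have "sin (2 * pi * real_of_int x / real p) = sin (2 * pi * real_of_int t / real p)"
    by (simp add: sin_add sin_int_2pin cos_int_2pin)
  moreover have "sgn (sin (2 * pi * real_of_int t / real p)) = real_of_int (residue_sign x)"
  proof (cases "2 * t < P")
    case True
    then have "real_of_int (2 * t) < real_of_int P" by (simp only: of_int_less_iff)
    then have "0 < 2 * pi * real_of_int t / real p" "2 * pi * real_of_int t / real p < pi"
      using p0 t by (auto simp: field_simps)
    then show ?thesis using True sin_gt_zero by (simp add: residue_sign_def t_def)
  next
    case False
    then have "P < 2 * t" using two_mult_neq_P[of t] by simp
    then have "real_of_int P < real_of_int (2 * t)" by (simp only: of_int_less_iff)
    moreover have "real_of_int t < real_of_int P" using t(2) by (simp only: of_int_less_iff)
    ultimately have "pi < 2 * pi * real_of_int t / real p" "2 * pi * real_of_int t / real p < 2 * pi"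
      using p0 by (auto simp: field_simps)
    then show ?thesis using False sin_lt_zero by (simp add: residue_sign_def t_def)
  qed
  ultimately show ?thesis by simp
qed

lemma H_difference_not_dvd: "u \<in> H \<Longrightarrow> v \<in> H \<Longrightarrow> u \<noteq> v \<Longrightarrow> \<not> P dvd v\<^sup>2 - u\<^sup>2"
  using half_square_inj[of v u] by (auto simp: H_iff cong_iff_dvd_diff)

lemma lam_eq: "(-1) ^ lam p = (\<Prod>(u, v) | u \<in> H \<and> v \<in> H \<and> u < v. residue_sign (v\<^sup>2 - u\<^sup>2))"
proof -
  define R where "R = (\<Prod>(u, v) | u \<in> H \<and> v \<in> H \<and> u < v. residue_sign (v\<^sup>2 - u\<^sup>2))"
  have sgn_prod: "sgn (prod f A) = (\<Prod>x\<in>A. sgn (f x))" for f :: "int \<times> int \<Rightarrow> real" and A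
    by (induction A rule: infinite_finite_induct) (auto simp: sgn_mult)
  have "(p - 1) div 4 = 2 * m" using p_eq by simp
  then have "U_prod p = (\<Prod>(u, v) | u \<in> H \<and> v \<in> H \<and> u < v. sin (2 * pi * real_of_int (v\<^sup>2 - u\<^sup>2) / real p))"
    unfolding U_prod_def by (simp only: prod_pairs_half_qr[of "\<lambda>u v. sin (2 * pi * real_of_int (v\<^sup>2 - u\<^sup>2) / real p)"])
  then have "sgn (U_prod p) = (\<Prod>(u, v) | u \<in> H \<and> v \<in> H \<and> u < v. sgn (sin (2 * pi * real_of_int (v\<^sup>2 - u\<^sup>2) / real p)))"
    using sgn_prod by (simp add: case_prod_beta)
  also have "\<dots> = (\<Prod>(u, v) | u \<in> H \<and> v \<in> H \<and> u < v. real_of_int (residue_sign (v\<^sup>2 - u\<^sup>2)))"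
  proof (rule prod.cong, rule refl, clarify)
    fix u v assume "u \<in> H" "v \<in> H" "u < v"
    then have "\<not> P dvd v\<^sup>2 - u\<^sup>2" by (intro H_difference_not_dvd) auto
    then show "sgn (sin (2 * pi * real_of_int (v\<^sup>2 - u\<^sup>2) / real p)) = real_of_int (residue_sign (v\<^sup>2 - u\<^sup>2))"
      by (rule sgn_sin_residue)
  qed
  also have "\<dots> = real_of_int (\<Prod>(u, v) | u \<in> H \<and> v \<in> H \<and> u < v. residue_sign (v\<^sup>2 - u\<^sup>2))"
    by (simp add: case_prod_beta)
  finally have sgn: "sgn (U_prod p) = real_of_int R" unfolding R_def .
  have "finite {(u, v). u \<in> H \<and> v \<in> H \<and> u < v}"
    by (rule finite_subset[of _ "H \<times> H"]) (use H_subset in auto)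
  \<comment> \<open>Nonvanishing matters here: \<open>lam\<close> gives 1 to every value that is not
    positive, so it records the sign only when \<open>U_prod p\<close> is not 0.\<close>
  then have "R \<noteq> 0"
    unfolding R_def by (auto simp: residue_sign_def)
  then have "U_prod p \<noteq> 0" using sgn by auto
  then have "sgn (U_prod p) = (-1) ^ lam p"
    by (simp add: lam_def)
  then have "real_of_int ((-1) ^ lam p) = real_of_int R"
    using sgn by simp
  then show ?thesis by (simp only: of_int_eq_iff R_def)
qed

text \<open>A pair \<open>u < v\<close> whose difference of squares is \<open>k\<close> up to sign
  gives a representation of \<open>k\<close> in exactly one orientation, since \<open>k\<close> and
  \<open>- k\<close> are incongruent.\<close>

lemma card_abs_residue_fiber:
  assumes k: "0 < k" "2 * k < P"
  shows "card {(u, v). u \<in> H \<and> v \<in> H \<and> u < v \<and> abs_residue (v\<^sup>2 - u\<^sup>2) = k} = diff_count k"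
proof -
  let ?A = "{(u, v). u \<in> H \<and> v \<in> H \<and> u < v \<and> abs_residue (v\<^sup>2 - u\<^sup>2) = k}"
  let ?B = "{(u, v). u \<in> H \<and> v \<in> H \<and> u\<^sup>2 - v\<^sup>2 \<simeq> k}"
  have kn: "\<not> k \<simeq> - k"
  proof
    assume "k \<simeq> - k"
    then have "k = - k" by (rule cong_imp_eq) (use k in auto)
    then show False using k by simp
  qed
  have abs_iff: "abs_residue x = k \<longleftrightarrow> x \<simeq> k \<or> - x \<simeq> k" if "\<not> P dvd x" for x
  proof
    assume "abs_residue x = k"
    then show "x \<simeq> k \<or> - x \<simeq> k"
      using abs_residue_cong[of x] residue_sign_cases[of x] cong_minus_minus_iff[of x "- k" P] by auto
  next
    assume "x \<simeq> k \<or> - x \<simeq> k"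
    then have "k\<^sup>2 \<simeq> x\<^sup>2"
      unfolding cong_square_iff using cong_minus_minus_iff[of k "- x" P] by (auto simp: cong_sym_eq)
    then show "abs_residue x = k" using k by (intro abs_residue_eqI)
  qed
  have "bij_betw (\<lambda>(u, v). if v\<^sup>2 - u\<^sup>2 \<simeq> k then (v, u) else (u, v)) ?A ?B"
  proof (rule bij_betw_byWitness[where f' = "\<lambda>(u, v). (min u v, max u v)"])
    show "\<forall>a\<in>?A. (case case a of (u, v) \<Rightarrow> if v\<^sup>2 - u\<^sup>2 \<simeq> k then (v, u) else (u, v) of
        (u, v) \<Rightarrow> (min u v, max u v)) = a" by auto
    show "\<forall>a\<in>?B. (case case a of (u, v) \<Rightarrow> (min u v, max u v) of
        (u, v) \<Rightarrow> if v\<^sup>2 - u\<^sup>2 \<simeq> k then (v, u) else (u, v)) = a"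
    proof
      fix x assume "x \<in> ?B"
      then obtain u v where x: "x = (u, v)" and uv: "u \<in> H" "v \<in> H" "u\<^sup>2 - v\<^sup>2 \<simeq> k" by auto
      have "\<not> v\<^sup>2 - u\<^sup>2 \<simeq> k"
      proof
        assume "v\<^sup>2 - u\<^sup>2 \<simeq> k"
        moreover have "- (u\<^sup>2 - v\<^sup>2) \<simeq> - k" using uv(3) by (simp only: cong_minus_minus_iff)
        ultimately show False using kn by (simp add: cong_def)
      qed
      then show "(case case x of (u, v) \<Rightarrow> (min u v, max u v) of
          (u, v) \<Rightarrow> if v\<^sup>2 - u\<^sup>2 \<simeq> k then (v, u) else (u, v)) = x"
        using uv(3) x by (auto simp: min_def max_def)
    qed
    show "(\<lambda>(u, v). if v\<^sup>2 - u\<^sup>2 \<simeq> k then (v, u) else (u, v)) ` ?A \<subseteq> ?B"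
    proof (rule image_subsetI)
      fix x assume "x \<in> ?A"
      then obtain u v where x: "x = (u, v)" "u \<in> H" "v \<in> H" "u < v" "abs_residue (v\<^sup>2 - u\<^sup>2) = k"
        by auto
      then have "v\<^sup>2 - u\<^sup>2 \<simeq> k \<or> u\<^sup>2 - v\<^sup>2 \<simeq> k"
        using abs_iff[of "v\<^sup>2 - u\<^sup>2"] H_difference_not_dvd[of u v] by simp
      then show "(case x of (u, v) \<Rightarrow> if v\<^sup>2 - u\<^sup>2 \<simeq> k then (v, u) else (u, v)) \<in> ?B"
        using x by auto
    qed
    show "(\<lambda>(u, v). (min u v, max u v)) ` ?B \<subseteq> ?A"
    proof (rule image_subsetI)
      fix x assume "x \<in> ?B"
      then obtain u v where x: "x = (u, v)" "u \<in> H" "v \<in> H" "u\<^sup>2 - v\<^sup>2 \<simeq> k" by auto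
      have "u \<noteq> v"
      proof
        assume "u = v"
        then have "P dvd k" using x(4) by (simp add: cong_iff_dvd_diff)
        then show False using not_dvd_small[of k] k by simp
      qed
      then have "abs_residue (u\<^sup>2 - v\<^sup>2) = k" "abs_residue (v\<^sup>2 - u\<^sup>2) = k"
        using abs_iff[of "u\<^sup>2 - v\<^sup>2"] abs_iff[of "v\<^sup>2 - u\<^sup>2"] x H_difference_not_dvd by auto
      then show "(case x of (u, v) \<Rightarrow> (min u v, max u v)) \<in> ?A"
        using x \<open>u \<noteq> v\<close> by (auto simp: min_def max_def)
    qed
  qed
  then show ?thesis unfolding diff_count_def by (rule bij_betw_same_card)
qed

lemma square_differences_cong:
  "square_differences \<simeq> (-1) ^ lam p * (\<Prod>k | 0 < k \<and> 2 * k < P. k ^ diff_count k)"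
proof -
  let ?S = "{(u, v). u \<in> H \<and> v \<in> H \<and> u < v}"
  let ?K = "{k. 0 < k \<and> 2 * k < P}"
  let ?d = "\<lambda>(u, v). abs_residue (v\<^sup>2 - u\<^sup>2)"
  have finS: "finite ?S"
    by (rule finite_subset[of _ "H \<times> H"]) (use H_subset in auto)
  have finK: "finite ?K" by (rule finite_subset[of _ F]) auto
  have img: "?d ` ?S \<subseteq> ?K"
    using abs_residue_bounds[OF H_difference_not_dvd] by fastforce
  have "square_differences \<simeq> (\<Prod>(u, v)\<in>?S. residue_sign (v\<^sup>2 - u\<^sup>2) * abs_residue (v\<^sup>2 - u\<^sup>2))"
    unfolding square_differences_def by (intro cong_prod) (auto intro: abs_residue_cong)
  also have "(\<Prod>(u, v)\<in>?S. residue_sign (v\<^sup>2 - u\<^sup>2) * abs_residue (v\<^sup>2 - u\<^sup>2)) =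
      (-1) ^ lam p * prod ?d ?S"
    unfolding lam_eq by (simp add: case_prod_beta prod.distrib)
  also have "prod ?d ?S = (\<Prod>k\<in>?K. prod ?d {x \<in> ?S. ?d x = k})"
    by (rule prod.group[OF finS finK img, symmetric])
  also have "\<dots> = (\<Prod>k\<in>?K. k ^ diff_count k)"
  proof (rule prod.cong)
    fix k assume k: "k \<in> ?K"
    have "{x \<in> ?S. ?d x = k} = {(u, v). u \<in> H \<and> v \<in> H \<and> u < v \<and> abs_residue (v\<^sup>2 - u\<^sup>2) = k}"
      by auto
    then have card: "card {x \<in> ?S. ?d x = k} = diff_count k"
      using card_abs_residue_fiber[of k] k by simp
    have "prod ?d {x \<in> ?S. ?d x = k} = (\<Prod>x\<in>{x \<in> ?S. ?d x = k}. k)"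
      by (rule prod.cong) auto
    then show "prod ?d {x \<in> ?S. ?d x = k} = k ^ diff_count k"
      by (simp only: prod_constant card)
  qed simp
  finally show ?thesis .
qed

end

subsection \<open>The half-interval product\<close>

context prime_two_squares begin

lemma diff_count_Omega_1:
  assumes "k \<in> Omega p 1"
  shows "int (diff_count k) = r\<^sup>2 + r + c\<^sup>2 - 1"
proof -
  have "16 * int (diff_count k) = P - 11 + 3 * \<phi> 1"
    using assms by (intro diff_count_1) (simp add: Omega_iff)
  then show ?thesis unfolding \<phi>_1 P_eq m_eq by simp
qed

lemma diff_count_Omega_minus_1:
  assumes "k \<in> Omega p (-1)"
  shows "int (diff_count k) = r\<^sup>2 - r + c\<^sup>2"
proof -
  have "16 * int (diff_count k) = P - 3 - \<phi> 1"
    using assms by (intro diff_count_minus_1) (simp add: Omega_iff)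
  then show ?thesis unfolding \<phi>_1 P_eq m_eq by simp
qed

lemma \<psi>_nonresidueI:
  assumes "k ^ (2 * m) \<simeq> J" "J\<^sup>2 \<simeq> -1"
  shows "\<psi> k = -1"
proof (rule cong_imp_eq)
  have "\<psi> k \<simeq> (k ^ (2 * m))\<^sup>2" using \<psi>_euler[of k] by (simp add: mult.commute flip: power_mult)
  also have "(k ^ (2 * m))\<^sup>2 \<simeq> J\<^sup>2" by (intro cong_pow assms)
  also note assms(2)
  finally show "\<psi> k \<simeq> -1" .
  show "\<bar>\<psi> k - - 1\<bar> < P" using \<psi>_cases[of k] P_ge by auto
qed

lemma diff_count_Omega_J:
  assumes J: "J\<^sup>2 \<simeq> -1" "J * (4 * r - 1) \<simeq> 4 * c" and k: "k \<in> Omega p J"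
  shows "int (diff_count k) = r\<^sup>2 - r + c\<^sup>2 + c"
proof -
  have kJ: "k ^ (2 * m) \<simeq> J" using k by (simp add: Omega_iff)
  have n: "\<psi> k = -1" using kJ J(1) by (rule \<psi>_nonresidueI)
  then show ?thesis
    using diff_count_nonresidue[OF n] unfolding \<phi>_J[OF J(2) kJ n] \<phi>_1 P_eq m_eq by simp
qed

text \<open>Multiplication by \<open>g\<^sup>2\<close> carries the class of \<open>- J\<close> to
  that of \<open>J\<close>, and it negates \<open>\<phi>\<close> because
  \<open>\<psi> g = -1\<close>.\<close>

lemma diff_count_Omega_minus_J:
  assumes J: "J\<^sup>2 \<simeq> -1" "J * (4 * r - 1) \<simeq> 4 * c" and k: "k \<in> Omega p (- J)"
  shows "int (diff_count k) = r\<^sup>2 - r + c\<^sup>2 - c"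
proof -
  obtain g where g: "int_primroot p g" using primroot_exists ..
  have kJ: "k ^ (2 * m) \<simeq> - J" using k by (simp add: Omega_iff)
  have n: "\<psi> k = -1" by (rule \<psi>_nonresidueI[OF kJ]) (simp add: J)
  have "(k * g\<^sup>2) ^ (2 * m) = k ^ (2 * m) * g ^ (4 * m)"
    by (simp add: power_mult_distrib flip: power_mult)
  also have "k ^ (2 * m) * g ^ (4 * m) \<simeq> (- J) * (-1)"
    by (intro cong_mult kJ primroot_power_4m[OF g])
  finally have kgJ: "(k * g\<^sup>2) ^ (2 * m) \<simeq> J" by simp
  have "\<phi> (k * g\<^sup>2) = 8 * c"
    using J(2) kgJ by (rule \<phi>_J) (rule \<psi>_nonresidueI[OF kgJ J(1)])
  then have \<phi>_k: "\<phi> k = - (8 * c)"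
    using \<phi>_scale[OF primroot_not_dvd[OF g], of k] \<psi>_primroot[OF g] by simp
  show ?thesis
    using diff_count_nonresidue[OF n] unfolding \<phi>_k \<phi>_1 P_eq m_eq by simp
qed

text \<open>The counts are \<open>n\<close>, \<open>2 * w + t\<close>, \<open>2 * (w + t)\<close>
  and \<open>2 * w\<close> on the classes of 1, -1, \<open>J\<close> and \<open>- J\<close>. The
  last two are even, so the known squares of the class products suffice.\<close>

lemma prod_half_powers:
  assumes J: "J\<^sup>2 \<simeq> -1" "J * (4 * r - 1) \<simeq> 4 * c"
    and n: "int n = r\<^sup>2 + r + c\<^sup>2 - 1" and t: "int t = c" and w: "2 * int w = r\<^sup>2 - r + c\<^sup>2 - c"
  shows "(\<Prod>k | 0 < k \<and> 2 * k < P. k ^ diff_count k) \<simeq>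
    A_prod p ^ n * B_prod p ^ (2 * w + t) * ((-1) ^ (m + 1) * J) ^ t"
proof -
  have const: "(\<Prod>k\<in>Omega p \<epsilon>. k ^ diff_count k) = (\<Prod>(Omega p \<epsilon>)) ^ l"
    if "\<And>k. k \<in> Omega p \<epsilon> \<Longrightarrow> int (diff_count k) = int l" for \<epsilon> l
    unfolding prod_power_distrib using that by (intro prod.cong) auto
  have "(\<Prod>k\<in>Omega p 1. k ^ diff_count k) = A_prod p ^ n"
    unfolding A_prod_def using n by (intro const) (simp add: diff_count_Omega_1)
  moreover have "(\<Prod>k\<in>Omega p (-1). k ^ diff_count k) = B_prod p ^ (2 * w + t)"
    unfolding B_prod_def using t w by (intro const) (simp add: diff_count_Omega_minus_1)
  moreover have "(\<Prod>k\<in>Omega p J. k ^ diff_count k) = ((\<Prod>(Omega p J))\<^sup>2) ^ (w + t)"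
    unfolding power_mult[symmetric]
    using t w by (intro const) (simp add: diff_count_Omega_J[OF J])
  moreover have "(\<Prod>k\<in>Omega p (- J). k ^ diff_count k) = ((\<Prod>(Omega p (- J)))\<^sup>2) ^ w"
    unfolding power_mult[symmetric]
    using t w by (intro const) (simp add: diff_count_Omega_minus_J[OF J])
  moreover have "((\<Prod>(Omega p J))\<^sup>2) ^ (w + t) * ((\<Prod>(Omega p (- J)))\<^sup>2) ^ w \<simeq> ((-1) ^ (m + 1) * J) ^ t"
  proof -
    have "((\<Prod>(Omega p J))\<^sup>2) ^ (w + t) * ((\<Prod>(Omega p (- J)))\<^sup>2) ^ w \<simeq>
        ((-1) ^ (m + 1) * J) ^ (w + t) * ((-1) ^ (m + 1) * - J) ^ w"
      using J(1) by (intro cong_mult cong_pow prod_Omega_cases) auto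
    also have "((-1) ^ (m + 1) * J) ^ (w + t) * ((-1) ^ (m + 1) * - J) ^ w =
        ((-1) ^ (m + 1) * J) ^ t * ((((-1) ^ (m + 1) * J) * ((-1) ^ (m + 1) * - J)) ^ w)"
      by (simp only: power_add power_mult_distrib mult_ac)
    \<comment> \<open>The common \<open>w\<close>-th powers of the classes of \<open>J\<close> and
      \<open>- J\<close> cancel, because this product is congruent to 1; only \<open>t\<close>
      copies of the class of \<open>J\<close> remain.\<close>
    also have "((-1) ^ (m + 1) * J) * ((-1) ^ (m + 1) * - J) = - (J\<^sup>2)"
      by (cases "even m") (simp_all add: power2_eq_square)
    also have "((-1) ^ (m + 1) * J) ^ t * (- (J\<^sup>2)) ^ w \<simeq> ((-1) ^ (m + 1) * J) ^ t * (- (- 1)) ^ w"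
      using J(1) by (intro cong_mult[OF cong_refl] cong_pow) (simp only: cong_minus_minus_iff)
    finally show ?thesis by simp
  qed
  ultimately show ?thesis
    unfolding half_partition[OF J(1)] using cong_mult[OF cong_refl] by (simp only: )
qed

lemma sign_tau_relation:
  assumes J: "J\<^sup>2 \<simeq> -1" "J * (4 * r - 1) \<simeq> 4 * c"
    and n: "int n = r\<^sup>2 + r + c\<^sup>2 - 1" and t: "int t = c" and w: "2 * int w = r\<^sup>2 - r + c\<^sup>2 - c"
    and g: "int_primroot p g"
  shows "sign (tau p g) * ((-1) ^ lam p *
      (A_prod p ^ n * B_prod p ^ (2 * w + t) * ((-1) ^ (m + 1) * J) ^ t)) \<simeq>
    (-1) ^ t * (g ^ (2 * m)) ^ (3 * (m + 1))"
proof -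
  have "sign (tau p g) * ((-1) ^ lam p * (A_prod p ^ n * B_prod p ^ (2 * w + t) * ((-1) ^ (m + 1) * J) ^ t)) \<simeq>
      sign (tau p g) * ((-1) ^ lam p * (\<Prod>k | 0 < k \<and> 2 * k < P. k ^ diff_count k))"
    by (intro cong_mult[OF cong_refl] cong_sym[OF prod_half_powers] assms)
  also have "sign (tau p g) * ((-1) ^ lam p * (\<Prod>k | 0 < k \<and> 2 * k < P. k ^ diff_count k)) \<simeq>
      sign (tau p g) * square_differences"
    by (intro cong_mult[OF cong_refl] cong_sym[OF square_differences_cong])
  also note sign_tau_cong[OF g]
  also have "2 ^ (2 * m) * (g ^ (2 * m)) ^ (3 * (m + 1)) \<simeq> (-1) ^ t * (g ^ (2 * m)) ^ (3 * (m + 1))"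
  proof (rule cong_mult[OF _ cong_refl])
    have "even c \<longleftrightarrow> even t" using t by presburger
    then show "2 ^ (2 * m) \<simeq> (-1) ^ t" using two_power_eq by (cases "even t") simp_all
  qed
  finally show ?thesis .
qed

end

subsection \<open>Dependence on the primitive root\<close>

context prime_1_mod_8 begin

lemma sign_exponent_cong:
  assumes "x \<simeq> 1 \<or> x \<simeq> -1"
  shows "(-1) ^ sign_exponent p x \<simeq> x"
proof -
  have n: "\<not> 1 \<simeq> -1" using not_dvd_small[of 2] P_ge by (simp add: cong_iff_dvd_diff)
  have "\<exists>!e. e \<in> {0, 1 :: nat} \<and> (-1) ^ e \<simeq> x"
    using assms
  proof
    assume x: "x \<simeq> 1"
    then have "\<not> -1 \<simeq> x" using n by (simp add: cong_def)
    then show ?thesis using x by (intro ex1I[of _ 0]) (auto simp: cong_sym_eq)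
  next
    assume x: "x \<simeq> -1"
    then have "\<not> 1 \<simeq> x" using n by (simp add: cong_def)
    then show ?thesis using x by (intro ex1I[of _ 1]) (auto simp: cong_sym_eq)
  qed
  from theI'[OF this] show ?thesis
    unfolding sign_exponent_def by blast
qed

lemma sign_power_transfer:
  assumes "s * (-1) ^ x \<simeq> (-1) ^ y"
  shows "s \<simeq> (-1) ^ (x + y)"
proof -
  have "s * (-1) ^ x * (-1) ^ x = s"
    by (cases "even x") simp_all
  then have "s \<simeq> (-1) ^ y * (-1) ^ x"
    using cong_mult[OF assms cong_refl[of "(-1) ^ x"]] by (simp only:)
  then show ?thesis by (simp add: power_add mult.commute)
qed

text \<open>The congruence determines the sign exactly, and the exponents have to agree only modulo
  2; \<open>K\<close> is an integer and may be negative, hence \<open>powi\<close> in the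
  target.\<close>

lemma is_sign_powerI:
  assumes s: "s \<simeq> (-1) ^ e'" "s = 1 \<or> s = -1" and N: "N = 32 * K" and par: "even (int e' - int e - K)"
  shows "is_sign_power s e N"
proof -
  have "s = (-1) ^ e'"
    by (rule cong_imp_eq[OF s(1)]) (use s(2) P_ge in \<open>cases "even e'"; auto\<close>)
  moreover have "even (int e' - int e - K) \<longleftrightarrow> (even e' \<longleftrightarrow> even (int e + K))" by auto
  ultimately have "real_of_int s = (-1) powi (int e + K)"
    using par by (cases "even e'") (auto simp: power_int_minus_left)
  then show ?thesis using N by (simp add: is_sign_power_def)
qed

lemma sign_tau_cases: "sign (tau p g) = 1 \<or> sign (tau p g) = -1"
  by (cases "tau p g" rule: sign_cases) auto

text \<open>A description by integer powers alone, from which invariance under inversion modulo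
  \<open>p\<close> can be read off.\<close>

lemma int_primroot_iff:
  "int_primroot p g \<longleftrightarrow> \<not> P dvd g \<and> (\<forall>d. g ^ d \<simeq> 1 \<longrightarrow> 8 * m dvd d)"
proof
  assume g: "int_primroot p g"
  then show "\<not> P dvd g \<and> (\<forall>d. g ^ d \<simeq> 1 \<longrightarrow> 8 * m dvd d)"
    using primroot_not_dvd[OF g] primroot_power_cong_iff[OF g, of _ 0] by (simp add: cong_0_iff)
next
  assume g: "\<not> P dvd g \<and> (\<forall>d. g ^ d \<simeq> 1 \<longrightarrow> 8 * m dvd d)"
  define g' where "g' = nat (g mod P)"
  have g': "int g' \<simeq> g" using P_ge by (simp add: g'_def)
  have tot: "totient p = 8 * m" using prime_p p_eq by (simp add: totient_prime)
  have "\<not> P dvd int g'" using g cong_dvd[OF g'] by simp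
  then have cop: "coprime p g'" using prime_p by (simp add: prime_imp_coprime)
  have "[g' ^ ord p g' = 1] (mod p)" by (rule ord)
  then have "[int (g' ^ ord p g') = int 1] (mod P)" by (simp only: cong_int_iff)
  then have "g ^ ord p g' \<simeq> 1"
    using cong_pow[OF g', of "ord p g'"] by (simp add: cong_def)
  then have "8 * m dvd ord p g'" using g by blast
  moreover have "ord p g' dvd 8 * m" using order_divides_totient[OF cop] tot by simp
  ultimately have "ord p g' = totient p" using tot dvd_antisym by metis
  then show "int_primroot p g"
    using cop prime_p prime_gt_0_nat by (simp add: int_primroot_def residue_primroot_def g'_def)
qed

text \<open>The inverse of \<open>g\<close> by Fermat, with exponent \<open>p - 2\<close>, as a
  least nonnegative residue.\<close>

definition inverse_residue :: "int \<Rightarrow> int" where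
  "inverse_residue g = g ^ (8 * m - 1) mod P"

lemma inverse_residue_mult:
  assumes g: "int_primroot p g"
  shows "g * inverse_residue g \<simeq> 1"
proof -
  have "g * inverse_residue g \<simeq> g * g ^ (8 * m - 1)"
    unfolding inverse_residue_def by (intro cong_mult) auto
  also have "g * g ^ (8 * m - 1) = g ^ (8 * m)"
    using m_pos by (simp flip: power_Suc)
  also have "g ^ (8 * m) \<simeq> g ^ 0" unfolding primroot_power_cong_iff[OF g] by (simp add: cong_0_iff)
  finally show ?thesis by simp
qed

lemma inverse_residue_primroot:
  assumes g: "int_primroot p g"
  shows "int_primroot p (inverse_residue g)"
  unfolding int_primroot_iff
proof (intro conjI allI impI)
  have "\<not> P dvd 1" using not_dvd_small[of 1] P_ge by simp
  then show "\<not> P dvd inverse_residue g"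
    using cong_dvd[OF inverse_residue_mult[OF g]] by auto
  fix d assume d: "inverse_residue g ^ d \<simeq> 1"
  have "g ^ d * inverse_residue g ^ d \<simeq> 1 ^ d"
    unfolding power_mult_distrib[symmetric] by (intro cong_pow inverse_residue_mult g)
  moreover have "g ^ d * inverse_residue g ^ d \<simeq> g ^ d * 1"
    by (rule cong_mult[OF cong_refl d])
  ultimately have "g ^ d \<simeq> 1" by (simp add: cong_def)
  then show "8 * m dvd d" using g by (simp add: int_primroot_iff)
qed

lemma inverse_residue_idem:
  assumes g: "int_primroot p g" and "0 < g" "g < P"
  shows "inverse_residue (inverse_residue g) = g"
proof -
  have "inverse_residue (inverse_residue g) \<simeq> (g ^ (8 * m - 1)) ^ (8 * m - 1)"
    unfolding inverse_residue_def by (simp add: power_mod)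
  also have "(g ^ (8 * m - 1)) ^ (8 * m - 1) = g ^ ((8 * m - 1) * (8 * m - 1))"
    by (simp flip: power_mult)
  also have "g ^ ((8 * m - 1) * (8 * m - 1)) \<simeq> g ^ 1"
    unfolding primroot_power_cong_iff[OF g]
  proof -
    obtain q where q: "m = Suc q" using m_pos by (cases m) auto
    \<comment> \<open>The exponent \<open>8 * m - 1\<close> is -1 modulo the order
      \<open>8 * m\<close>, so applying it twice gives exponent 1.\<close>
    have e: "(8 * m - 1) * (8 * m - 1) = 1 + 8 * m * (8 * q + 6)"
      unfolding q by (simp add: algebra_simps)
    show "[(8 * m - 1) * (8 * m - 1) = 1] (mod 8 * m)"
      unfolding e cong_def by (rule mod_mult_self2)
  qed
  finally show ?thesis
    using assms F_mod(1) by (intro F_cong_eq) (auto simp: inverse_residue_def)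
qed

text \<open>By the congruence for the sign, a multiple of it is a product of powers of 2 and
  \<open>g\<close>, which are units. So it can be cancelled when signs are compared.\<close>

lemma square_differences_not_dvd: "\<not> P dvd square_differences"
proof
  assume d: "P dvd square_differences"
  obtain g where g: "int_primroot p g" using primroot_exists ..
  have "P dvd 2 ^ (2 * m) * (g ^ (2 * m)) ^ (3 * (m + 1))"
    using cong_dvd[OF sign_tau_cong[OF g]] d by simp
  then have "P dvd 2 ^ (2 * m) \<or> P dvd g ^ (2 * m)"
    by (auto simp: dvd_mult_iff dvd_power_iff simp del: power_Suc)
  then show False
    using primroot_not_dvd[OF g] not_dvd_small[of 2] P_ge m_pos
    by (auto simp: dvd_power_iff)
qed

lemma primroot_quarter_square:
  assumes g: "int_primroot p g"
  shows "(g ^ (2 * m))\<^sup>2 \<simeq> -1"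
  using primroot_power_4m[OF g] by (simp add: mult.commute flip: power_mult)

text \<open>For odd \<open>m\<close> the exponent \<open>3 * (m + 1)\<close> is even, so only the
  square of \<open>g ^ (2 * m)\<close> enters, and it is -1 for every primitive root.\<close>

lemma sign_tau_independent:
  assumes g: "int_primroot p g" and h: "int_primroot p h" and m: "odd m"
  shows "sign (tau p g) = sign (tau p h)"
proof -
  have "even (m + 1)" using m by simp
  then obtain q where q: "m + 1 = 2 * q" by (rule evenE)
  have "sign (tau p f) * square_differences \<simeq> 2 ^ (2 * m) * (-1) ^ (3 * q)"
    if f: "int_primroot p f" for f
  proof -
    have "(f ^ (2 * m)) ^ (3 * (m + 1)) = ((f ^ (2 * m))\<^sup>2) ^ (3 * q)"
      unfolding q by (simp add: algebra_simps flip: power_mult)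
    also have "((f ^ (2 * m))\<^sup>2) ^ (3 * q) \<simeq> (-1) ^ (3 * q)"
      by (intro cong_pow primroot_quarter_square f)
    finally show ?thesis
      using cong_trans[OF sign_tau_cong[OF f] cong_mult[OF cong_refl]] by blast
  qed
  from this[OF g] this[OF h]
  have "square_differences * sign (tau p g) \<simeq> square_differences * sign (tau p h)"
    by (simp add: cong_def mult.commute)
  then have "sign (tau p g) \<simeq> sign (tau p h)"
    by (simp only: cong_mult_cancel[OF square_differences_not_dvd])
  then show ?thesis
    by (rule cong_imp_eq) (use sign_tau_cases[of g] sign_tau_cases[of h] P_ge in auto)
qed

text \<open>Inversion negates \<open>g ^ (2 * m)\<close>, a square root of -1, and for even
  \<open>m\<close> this quantity enters to an odd power. Inversion therefore pairs the two
  signs.\<close>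

lemma sign_tau_inverse:
  assumes g: "int_primroot p g" and m: "even m"
  shows "sign (tau p (inverse_residue g)) = - sign (tau p g)"
proof -
  let ?h = "inverse_residue g" and ?e = "3 * (m + 1)"
  have I: "?h ^ (2 * m) \<simeq> - (g ^ (2 * m))"
  proof -
    have nd: "\<not> P dvd g ^ (2 * m)" using primroot_not_dvd[OF g] m_pos by (simp add: dvd_power_iff)
    have "g ^ (2 * m) * ?h ^ (2 * m) \<simeq> 1 ^ (2 * m)"
      unfolding power_mult_distrib[symmetric] by (intro cong_pow inverse_residue_mult g)
    moreover have "g ^ (2 * m) * - (g ^ (2 * m)) \<simeq> - (- 1)"
      using primroot_quarter_square[OF g]
      by (simp only: power2_eq_square mult_minus_right cong_minus_minus_iff)
    ultimately have "g ^ (2 * m) * ?h ^ (2 * m) \<simeq> g ^ (2 * m) * - (g ^ (2 * m))"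
      by (simp add: cong_def)
    then show ?thesis by (simp only: cong_mult_cancel[OF nd])
  qed
  have odd: "odd ?e" using m by simp
  have "sign (tau p ?h) * square_differences \<simeq> 2 ^ (2 * m) * (?h ^ (2 * m)) ^ ?e"
    by (rule sign_tau_cong[OF inverse_residue_primroot[OF g]])
  also have "2 ^ (2 * m) * (?h ^ (2 * m)) ^ ?e \<simeq> 2 ^ (2 * m) * (- (g ^ (2 * m))) ^ ?e"
    by (intro cong_mult[OF cong_refl] cong_pow I)
  also have "2 ^ (2 * m) * (- (g ^ (2 * m))) ^ ?e = - (2 ^ (2 * m) * (g ^ (2 * m)) ^ ?e)"
    by (simp only: power_minus_odd[OF odd] mult_minus_right)
  also have "- (2 ^ (2 * m) * (g ^ (2 * m)) ^ ?e) \<simeq> - (sign (tau p g) * square_differences)"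
    unfolding cong_minus_minus_iff by (rule cong_sym[OF sign_tau_cong[OF g]])
  finally have "square_differences * sign (tau p ?h) \<simeq> square_differences * - sign (tau p g)"
    by (simp add: mult.commute)
  then have "sign (tau p ?h) \<simeq> - sign (tau p g)"
    by (simp only: cong_mult_cancel[OF square_differences_not_dvd])
  then show ?thesis
    by (rule cong_imp_eq) (use sign_tau_cases[of g] sign_tau_cases[of ?h] P_ge in auto)
qed

lemma card_sign_tau_eq:
  assumes m: "even m"
  shows "card {g. 0 < g \<and> g < P \<and> int_primroot p g \<and> sign (tau p g) = 1} =
    card {g. 0 < g \<and> g < P \<and> int_primroot p g \<and> sign (tau p g) = -1}"
proof (rule bij_betw_same_card[of inverse_residue], rule bij_betw_byWitness[where f' = inverse_residue])
  have range: "0 < inverse_residue g \<and> inverse_residue g < P" if "int_primroot p g" for g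
  proof -
    have "inverse_residue g \<noteq> 0" using primroot_not_dvd[OF inverse_residue_primroot[OF that]] by auto
    then show ?thesis using P_ge pos_mod_bound[of P] pos_mod_sign[of P]
      by (auto simp: inverse_residue_def less_le)
  qed
  show "inverse_residue ` {g. 0 < g \<and> g < P \<and> int_primroot p g \<and> sign (tau p g) = 1}
      \<subseteq> {g. 0 < g \<and> g < P \<and> int_primroot p g \<and> sign (tau p g) = -1}"
    "inverse_residue ` {g. 0 < g \<and> g < P \<and> int_primroot p g \<and> sign (tau p g) = -1}
      \<subseteq> {g. 0 < g \<and> g < P \<and> int_primroot p g \<and> sign (tau p g) = 1}"
    using range inverse_residue_primroot sign_tau_inverse[OF _ m] by auto
qed (auto simp: inverse_residue_idem)

end

subsection \<open>The four cases\<close>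

context prime_two_squares begin

lemma chi4_2: "chi4 p 2 = (if even c then 1 else -1)"
proof -
  have nd: "\<not> P dvd 2" using P_ge by (intro not_dvd_small) auto
  have "(\<exists>y. y ^ 4 \<simeq> 2) \<longleftrightarrow> 2 ^ (2 * m) \<simeq> 1"
  proof
    assume "\<exists>y. y ^ 4 \<simeq> 2"
    then obtain y where y: "y ^ 4 \<simeq> 2" ..
    then have "\<not> P dvd y" using nd cong_dvd[OF y] by (simp add: dvd_power_iff)
    then have "(\<psi> y)\<^sup>2 = 1" using \<psi>_mult_self[of y] by (simp add: power2_eq_square)
    have "2 ^ (2 * m) \<simeq> (y ^ 4) ^ (2 * m)" by (intro cong_pow cong_sym[OF y])
    also have "(y ^ 4) ^ (2 * m) = (y ^ (4 * m))\<^sup>2"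
      by (simp add: mult.commute flip: power_mult)
    also have "(y ^ (4 * m))\<^sup>2 \<simeq> (\<psi> y)\<^sup>2" by (intro cong_pow cong_sym[OF \<psi>_euler])
    also note \<open>(\<psi> y)\<^sup>2 = 1\<close>
    finally show "2 ^ (2 * m) \<simeq> 1" .
  next
    assume "2 ^ (2 * m) \<simeq> 1"
    then obtain u where u: "u \<in> H" "u\<^sup>2 \<simeq> 2" by (rule fourth_power_root)
    then obtain y where y: "u \<simeq> y\<^sup>2" using \<psi>_eq_1_imp_square[of u] by (auto simp: H_iff)
    have "y ^ 4 = (y\<^sup>2)\<^sup>2" by simp
    also have "(y\<^sup>2)\<^sup>2 \<simeq> u\<^sup>2" by (intro cong_pow cong_sym[OF y])
    also note u(2)
    finally show "\<exists>y. y ^ 4 \<simeq> 2" ..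
  qed
  moreover have "2 ^ (2 * m) \<simeq> 1 \<longleftrightarrow> even c"
  proof -
    have "\<not> -1 \<simeq> 1" using nd by (simp add: cong_iff_dvd_diff)
    then show ?thesis using two_power_eq by (auto simp: cong_def split: if_splits)
  qed
  ultimately show ?thesis using nd by (simp add: chi4_def)
qed

text \<open>The residue \<open>2 * b / a\<close> with \<open>b = 2 * c\<close>, unsimplified so as
  to match \<open>gamma\<close>; it serves as \<open>J\<close>.\<close>

definition root_m1 :: int where
  "root_m1 = 2 * (2 * c) * modular_inverse P (4 * r - 1)"

lemma inverse_cong: "\<not> P dvd x \<Longrightarrow> x * modular_inverse P x \<simeq> 1"
  using cong_modular_inverse1[OF coprime_commute[THEN iffD1, OF prime_imp_coprime[OF prime_P]]] .

lemma a_not_dvd: "\<not> P dvd 4 * r - 1"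
proof
  assume d: "P dvd 4 * r - 1"
  have "4 * r - 1 \<noteq> 0" by presburger
  then have "1 \<le> \<bar>4 * r - 1\<bar>" by linarith
  moreover have "P \<le> \<bar>4 * r - 1\<bar>" using dvd_imp_le_int[OF \<open>4 * r - 1 \<noteq> 0\<close> d] by simp
  ultimately have "P * 1 \<le> \<bar>4 * r - 1\<bar> * \<bar>4 * r - 1\<bar>" by (intro mult_mono) auto
  then have "P \<le> (4 * r - 1)\<^sup>2" by (simp add: power2_eq_square)
  moreover have "(2 * c)\<^sup>2 > 0" using c_pos by simp
  ultimately show False using p_squares by linarith
qed

lemma root_m1_mult: "root_m1 * (4 * r - 1) \<simeq> 4 * c"
proof -
  have "root_m1 * (4 * r - 1) = 4 * c * ((4 * r - 1) * modular_inverse P (4 * r - 1))"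
    by (simp add: root_m1_def)
  also have "4 * c * ((4 * r - 1) * modular_inverse P (4 * r - 1)) \<simeq> 4 * c * 1"
    by (intro cong_mult[OF cong_refl] inverse_cong a_not_dvd)
  finally show ?thesis by simp
qed

lemma root_m1_square: "root_m1\<^sup>2 \<simeq> -1"
proof -
  have "(root_m1 * (4 * r - 1))\<^sup>2 \<simeq> (4 * c)\<^sup>2" by (intro cong_pow root_m1_mult)
  also have "(4 * c)\<^sup>2 = P + (4 * r - 1)\<^sup>2 * (-1)"
    unfolding p_squares by (simp add: power_mult_distrib)
  also have "P + (4 * r - 1)\<^sup>2 * (-1) \<simeq> (4 * r - 1)\<^sup>2 * (-1)" by (simp add: cong_iff_dvd_diff)
  finally have "(4 * r - 1)\<^sup>2 * root_m1\<^sup>2 \<simeq> (4 * r - 1)\<^sup>2 * (-1)"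
    by (simp only: power_mult_distrib mult.commute)
  then show ?thesis
    using a_not_dvd by (subst (asm) cong_mult_cancel) (simp_all add: dvd_power_iff)
qed

lemma A_square: "(A_prod p)\<^sup>2 \<simeq> (-1) ^ (m + 1)"
  using prod_Omega_cases[of 1] by (simp add: A_prod_def)

lemma B_square: "(B_prod p)\<^sup>2 \<simeq> (-1) ^ m"
  using prod_Omega_cases[of "-1"] by (simp add: B_prod_def)

text \<open>The counts become natural exponents once they are nonnegative: products of consecutive
  integers are nonnegative and even, and \<open>c \<ge> 1\<close>.\<close>

lemma exponents_exist:
  obtains n t w :: nat
  where "int n = r\<^sup>2 + r + c\<^sup>2 - 1" "int t = c" "2 * int w = r\<^sup>2 - r + c\<^sup>2 - c"
proof -
  have nonneg: "0 \<le> x * (x - 1)" for x :: int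
    by (cases "x \<le> 0") (auto intro: mult_nonneg_nonneg mult_nonpos_nonpos)
  have "r\<^sup>2 + r + c\<^sup>2 - 1 = (r + 1) * ((r + 1) - 1) + (c * (c - 1) + (c - 1))"
    by (simp add: power2_eq_square algebra_simps)
  then have 1: "0 \<le> r\<^sup>2 + r + c\<^sup>2 - 1"
    using nonneg[of "r + 1"] nonneg[of c] c_pos by linarith
  have e: "r\<^sup>2 - r + c\<^sup>2 - c = r * (r - 1) + c * (c - 1)"
    by (simp add: power2_eq_square algebra_simps)
  then have 2: "0 \<le> r\<^sup>2 - r + c\<^sup>2 - c"
    using nonneg[of r] nonneg[of c] by linarith
  have "even (r\<^sup>2 - r + c\<^sup>2 - c)" unfolding e by simp
  then obtain k where k: "r\<^sup>2 - r + c\<^sup>2 - c = 2 * k" by (rule evenE)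
  show thesis
    by (rule that[of "nat (r\<^sup>2 + r + c\<^sup>2 - 1)" "nat c" "nat k"]) (use 1 2 k c_pos in auto)
qed

lemma r_parity: "even r \<longleftrightarrow> even m"
proof -
  have "even (int m) \<longleftrightarrow> even r" unfolding m_eq by simp
  then show ?thesis by simp
qed

lemma signs_square: "((-1) ^ (m + 1) * root_m1)\<^sup>2 \<simeq> -1"
proof -
  have "((-1) ^ (m + 1) * root_m1)\<^sup>2 = root_m1\<^sup>2" by (cases "even m") simp_all
  then show ?thesis using root_m1_square by simp
qed

text \<open>\<open>x\<close> stands for the quotient \<open>y / d\<close>, and equal squares make it
  a sign. The four exponents use \<open>d = 1\<close> for \<open>beta\<close> and
  \<open>gamma\<close>, and \<open>d = g ^ (2 * m)\<close> for \<open>delta\<close> and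
  \<open>mu\<close>.\<close>

lemma sign_exponent_quotient:
  assumes "\<not> P dvd d" "x * d \<simeq> y" "y\<^sup>2 \<simeq> d\<^sup>2"
  shows "y \<simeq> (-1) ^ sign_exponent p x * d"
proof -
  have "d * x \<simeq> d * 1 \<or> d * x \<simeq> d * (-1)"
    using assms(2,3) unfolding cong_square_iff by (auto simp: mult.commute cong_def)
  then have "x \<simeq> 1 \<or> x \<simeq> -1" by (simp only: cong_mult_cancel[OF assms(1)])
  then have "(-1) ^ sign_exponent p x * d \<simeq> x * d"
    by (intro cong_mult[OF _ cong_refl] sign_exponent_cong)
  then show ?thesis using assms(2) by (simp add: cong_def)
qed

text \<open>Both sides of the sign relation are written as a sign times the same unit
  \<open>z\<close>, which is 1 for odd \<open>m\<close> and \<open>g ^ (2 * m)\<close> for even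
  \<open>m\<close>.\<close>

lemma sign_tau_parity:
  assumes g: "int_primroot p g"
    and ntw: "int n = r\<^sup>2 + r + c\<^sup>2 - 1" "int t = c" "2 * int w = r\<^sup>2 - r + c\<^sup>2 - c"
    and L: "A_prod p ^ n * B_prod p ^ (2 * w + t) * ((-1) ^ (m + 1) * root_m1) ^ t \<simeq> (-1) ^ x * z"
    and R: "(-1) ^ t * (g ^ (2 * m)) ^ (3 * (m + 1)) \<simeq> (-1) ^ y * z"
    and z: "\<not> P dvd z"
  shows "sign (tau p g) \<simeq> (-1) ^ (lam p + x + y)"
proof (rule sign_power_transfer)
  have "sign (tau p g) * ((-1) ^ lam p * ((-1) ^ x * z)) \<simeq> sign (tau p g) * ((-1) ^ lam p *
      (A_prod p ^ n * B_prod p ^ (2 * w + t) * ((-1) ^ (m + 1) * root_m1) ^ t))"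
    by (intro cong_mult[OF cong_refl] cong_sym[OF L])
  also note sign_tau_relation[OF root_m1_square root_m1_mult ntw g]
  also note R
  finally have "z * (sign (tau p g) * (-1) ^ (lam p + x)) \<simeq> z * (-1) ^ y"
    by (simp only: power_add mult_ac)
  then show "sign (tau p g) * (-1) ^ (lam p + x) \<simeq> (-1) ^ y"
    by (simp only: cong_mult_cancel[OF z])
qed

lemma signs_power_odd:
  "((-1) ^ (m + 1) * root_m1) ^ (2 * u + 1) \<simeq> (-1) ^ u * ((-1) ^ (m + 1) * root_m1)"
  unfolding power_add[of "(-1) ^ (m + 1) * root_m1"] power_mult power_one_right
  by (intro cong_mult[OF _ cong_refl] cong_pow signs_square)

lemma signs_power_even: "((-1) ^ (m + 1) * root_m1) ^ (2 * u) \<simeq> (-1) ^ u"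
  unfolding power_mult by (intro cong_pow signs_square)

lemma quarter_power_odd:
  assumes g: "int_primroot p g" and q: "m + 1 = 2 * q"
  shows "(-1) ^ t * (g ^ (2 * m)) ^ (3 * (m + 1)) \<simeq> (-1) ^ (t + 3 * q) * 1"
proof -
  have "(g ^ (2 * m)) ^ (3 * (m + 1)) = ((g ^ (2 * m))\<^sup>2) ^ (3 * q)"
    unfolding q by (simp add: algebra_simps flip: power_mult)
  also have "((g ^ (2 * m))\<^sup>2) ^ (3 * q) \<simeq> (-1) ^ (3 * q)"
    by (intro cong_pow primroot_quarter_square g)
  finally show ?thesis
    unfolding power_add mult_1_right by (rule cong_mult[OF cong_refl])
qed

lemma quarter_power_even:
  assumes g: "int_primroot p g" and q: "m = 2 * q"
  shows "(-1) ^ t * (g ^ (2 * m)) ^ (3 * (m + 1)) \<simeq> (-1) ^ (t + 3 * q + 1) * g ^ (2 * m)"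
proof -
  let ?I = "g ^ (2 * m)"
  have e: "3 * (m + 1) = 2 * (3 * q + 1) + 1" using q by simp
  have "?I ^ (3 * (m + 1)) = (?I\<^sup>2) ^ (3 * q + 1) * ?I"
    unfolding e power_add[of ?I] power_mult[of ?I] power_one_right ..
  also have "(?I\<^sup>2) ^ (3 * q + 1) * ?I \<simeq> (-1) ^ (3 * q + 1) * ?I"
    by (intro cong_mult[OF _ cong_refl] cong_pow primroot_quarter_square g)
  finally show ?thesis
    unfolding add.assoc power_add[of "-1" t] mult.assoc by (rule cong_mult[OF cong_refl])
qed

lemma quarter_not_dvd: "int_primroot p g \<Longrightarrow> \<not> P dvd g ^ (2 * m)"
  using primroot_not_dvd m_pos by (simp add: dvd_power_iff)

lemma root_B_square: "(root_m1 * B_prod p)\<^sup>2 \<simeq> (-1) ^ (m + 1)"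
proof -
  have "(root_m1 * B_prod p)\<^sup>2 \<simeq> (-1) * (-1) ^ m"
    unfolding power_mult_distrib by (intro cong_mult root_m1_square B_square)
  then show ?thesis by simp
qed

lemma sign_tau_9_chi4_1:
  assumes g: "int_primroot p g" and m: "odd m" and c: "even c"
  shows "is_sign_power (sign (tau p g)) (lam p + beta p)
    (3 * P + 11 - 2 * (4 * r - 1) + 8 * (2 * c))"
proof -
  obtain n t w where ntw: "int n = r\<^sup>2 + r + c\<^sup>2 - 1" "int t = c" "2 * int w = r\<^sup>2 - r + c\<^sup>2 - c"
    by (rule exponents_exist)
  obtain q where q: "m + 1 = 2 * q" using m by (metis even_Suc evenE Suc_eq_plus1)
  obtain u where u: "t = 2 * u" using c ntw(2) by (metis even_of_nat evenE)
  \<comment> \<open>Since \<open>c\<close> is even, \<open>A_prod p\<close> keeps an odd exponent,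
    while \<open>B_prod p\<close> and \<open>root_m1\<close> occur to even powers.\<close>
  have "odd (int n)" unfolding ntw(1) using c by simp
  then obtain k where k: "n = 2 * k + 1" by (metis even_of_nat oddE)
  let ?A = "A_prod p" and ?B = "B_prod p"
  have A2: "?A\<^sup>2 \<simeq> 1" using A_square unfolding q by simp
  have "?A \<simeq> (-1) ^ beta p * 1"
    unfolding beta_def using A2 not_dvd_small[of 1] P_ge by (intro sign_exponent_quotient) auto
  then have A: "?A ^ n \<simeq> 1 ^ k * ((-1) ^ beta p * 1)"
    unfolding k power_add power_mult power_one_right by (intro cong_mult cong_pow A2)
  have "?B\<^sup>2 \<simeq> -1" using B_square m by simp
  then have B: "?B ^ (2 * w + t) \<simeq> (-1) ^ (w + u)"
    unfolding u distrib_left[symmetric] power_mult by (rule cong_pow)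
  have L: "?A ^ n * ?B ^ (2 * w + t) * ((-1) ^ (m + 1) * root_m1) ^ t \<simeq> (-1) ^ (beta p + (w + u) + u) * 1"
    using cong_mult[OF cong_mult[OF A B] signs_power_even[of u]] unfolding u by (simp add: power_add)
  have "sign (tau p g) \<simeq> (-1) ^ (lam p + (beta p + (w + u) + u) + (t + 3 * q))"
    using not_dvd_small[of 1] P_ge by (intro sign_tau_parity[OF g ntw L quarter_power_odd[OF g q]]) auto
  then show ?thesis
  proof (rule is_sign_powerI[OF _ sign_tau_cases])
    have "int m + 1 = 2 * int q" using q by linarith
    \<comment> \<open>The quotient by 32 differs from the exponent found above by
      \<open>2 * u + 2 * q\<close>.\<close>
    then show "3 * P + 11 - 2 * (4 * r - 1) + 8 * (2 * c) = 32 * (int w + 2 * int u + int q)"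
      using ntw u m_eq P_eq by simp
  qed (simp add: u)
qed

lemma sign_tau_9_chi4_minus_1:
  assumes g: "int_primroot p g" and m: "odd m" and c: "odd c"
  shows "is_sign_power (sign (tau p g)) (lam p + gamma p (4 * r - 1) (2 * c))
    (3 * P - 21 - 2 * (4 * r - 1) - 8 * (2 * c))"
proof -
  obtain n t w where ntw: "int n = r\<^sup>2 + r + c\<^sup>2 - 1" "int t = c" "2 * int w = r\<^sup>2 - r + c\<^sup>2 - c"
    by (rule exponents_exist)
  obtain q where q: "m + 1 = 2 * q" using m by (metis even_Suc evenE Suc_eq_plus1)
  obtain u where u: "t = 2 * u + 1" using c ntw(2) by (metis even_of_nat oddE)
  \<comment> \<open>For odd \<open>c\<close> the roles change: \<open>A_prod p\<close> enters
    through its square, and one factor \<open>B_prod p\<close> is left together with one factor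
    \<open>root_m1\<close>.\<close>
  have "even (int n)" unfolding ntw(1) using c by simp
  then obtain k where k: "n = 2 * k" by (metis even_of_nat evenE)
  let ?A = "A_prod p" and ?B = "B_prod p" and ?\<gamma> = "gamma p (4 * r - 1) (2 * c)"
  have sgn: "(-1 :: int) ^ (m + 1) = 1" unfolding q by simp
  have "?A\<^sup>2 \<simeq> 1" using A_square unfolding sgn .
  then have A: "?A ^ n \<simeq> 1 ^ k"
    unfolding k power_mult by (rule cong_pow)
  have "?B\<^sup>2 \<simeq> -1" using B_square m by simp
  then have "(?B\<^sup>2) ^ (w + u) * ?B \<simeq> (-1) ^ (w + u) * ?B"
    by (intro cong_mult[OF _ cong_refl] cong_pow)
  then have B: "?B ^ (2 * w + t) \<simeq> (-1) ^ (w + u) * ?B"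
    unfolding u by (simp add: mult.commute flip: power_mult distrib_left)
  have "?\<gamma> = sign_exponent p (root_m1 * ?B)"
    unfolding gamma_def root_m1_def by (simp add: mult_ac)
  then have "root_m1 * ?B \<simeq> (-1) ^ ?\<gamma> * 1"
    using root_B_square not_dvd_small[of 1] P_ge unfolding sgn
    by (simp only:) (intro sign_exponent_quotient; simp)
  then have \<gamma>: "(-1) ^ (w + u + u) * (root_m1 * ?B) \<simeq> (-1) ^ (w + u + u) * ((-1) ^ ?\<gamma> * 1)"
    by (rule cong_mult[OF cong_refl])
  have "?A ^ n * ?B ^ (2 * w + t) * ((-1) ^ (m + 1) * root_m1) ^ t \<simeq>
      1 ^ k * ((-1) ^ (w + u) * ?B) * ((-1) ^ u * ((-1) ^ (m + 1) * root_m1))"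
    using A B signs_power_odd[of u] unfolding u by (intro cong_mult)
  also have "1 ^ k * ((-1) ^ (w + u) * ?B) * ((-1) ^ u * ((-1) ^ (m + 1) * root_m1)) =
      (-1) ^ (w + u + u) * (root_m1 * ?B)"
    unfolding sgn by (simp add: power_add)
  also note \<gamma>
  finally have L: "?A ^ n * ?B ^ (2 * w + t) * ((-1) ^ (m + 1) * root_m1) ^ t \<simeq>
      (-1) ^ (w + u + u + ?\<gamma>) * 1"
    unfolding power_add mult.assoc .
  have "sign (tau p g) \<simeq> (-1) ^ (lam p + (w + u + u + ?\<gamma>) + (t + 3 * q))"
    using not_dvd_small[of 1] P_ge by (intro sign_tau_parity[OF g ntw L quarter_power_odd[OF g q]]) auto
  then show ?thesis
  proof (rule is_sign_powerI[OF _ sign_tau_cases])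
    have "int m + 1 = 2 * int q" using q by linarith
    then show "3 * P - 21 - 2 * (4 * r - 1) - 8 * (2 * c) = 32 * (int w + int q - 1)"
      using ntw m_eq P_eq by simp
  qed (simp add: u)
qed

lemma sign_tau_1_chi4_1:
  assumes g: "int_primroot p g" and m: "even m" and c: "even c"
  shows "is_sign_power (sign (tau p g)) (lam p + delta p g)
    (3 * P - 5 - 2 * (4 * r - 1) + 8 * (2 * c))"
proof -
  obtain n t w where ntw: "int n = r\<^sup>2 + r + c\<^sup>2 - 1" "int t = c" "2 * int w = r\<^sup>2 - r + c\<^sup>2 - c"
    by (rule exponents_exist)
  obtain q where q: "m = 2 * q" using m by (rule evenE)
  obtain u where u: "t = 2 * u" using c ntw(2) by (metis even_of_nat evenE)
  have "odd (int n)" unfolding ntw(1) using c by simp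
  then obtain k where k: "n = 2 * k + 1" by (metis even_of_nat oddE)
  let ?A = "A_prod p" and ?B = "B_prod p" and ?I = "g ^ (2 * m)"
  have p4: "(p - 1) div 4 = 2 * m" using p_eq by simp
  have nd: "\<not> P dvd ?I" using g by (rule quarter_not_dvd)
  have A2: "?A\<^sup>2 \<simeq> -1" using A_square m by simp
  have "?A \<simeq> (-1) ^ delta p g * ?I"
    unfolding delta_def p4
  proof (rule sign_exponent_quotient[OF nd])
    show "?A * modular_inverse P ?I * ?I \<simeq> ?A"
      using cong_mult[OF cong_refl inverse_cong[OF nd], of ?A] by (simp add: mult_ac)
    show "?A\<^sup>2 \<simeq> ?I\<^sup>2" using A2 primroot_quarter_square[OF g] by (simp add: cong_def)
  qed
  then have A: "?A ^ n \<simeq> (-1) ^ k * ((-1) ^ delta p g * ?I)"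
    unfolding k power_add[of ?A] power_mult[of ?A] power_one_right by (intro cong_mult cong_pow A2)
  have "?B\<^sup>2 \<simeq> 1" using B_square m by simp
  then have B: "?B ^ (2 * w + t) \<simeq> 1 ^ (w + u)"
    unfolding u distrib_left[symmetric] power_mult by (rule cong_pow)
  have L: "?A ^ n * ?B ^ (2 * w + t) * ((-1) ^ (m + 1) * root_m1) ^ t \<simeq> (-1) ^ (k + delta p g + u) * ?I"
    using cong_mult[OF cong_mult[OF A B] signs_power_even[of u]] unfolding u
    by (simp only: power_add power_one mult_1_left mult_1_right mult_ac)
  have "sign (tau p g) \<simeq> (-1) ^ (lam p + (k + delta p g + u) + (t + 3 * q + 1))"
    by (rule sign_tau_parity[OF g ntw L quarter_power_even[OF g q] nd])
  then show ?thesis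
  proof (rule is_sign_powerI[OF _ sign_tau_cases])
    have "int m = 2 * int q" "int n = 2 * int k + 1" using q k by simp_all
    \<comment> \<open>Here \<open>A_prod p\<close> squares to -1 and \<open>B_prod p\<close> to 1,
      so \<open>k\<close> takes the place of \<open>w\<close>. The parities agree because
      \<open>r\<close> has the parity of \<open>m\<close>.\<close>
    then show "3 * P - 5 - 2 * (4 * r - 1) + 8 * (2 * c) = 32 * (int k + int u + int q + 1 - r)"
      using ntw u m_eq P_eq by simp
  qed (use m r_parity u in simp)
qed

lemma sign_tau_1_chi4_minus_1:
  assumes g: "int_primroot p g" and m: "even m" and c: "odd c"
  shows "is_sign_power (sign (tau p g)) (lam p + mu p (4 * r - 1) (2 * c) g)
    (3 * P + 27 - 2 * (4 * r - 1) - 8 * (2 * c))"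
proof -
  obtain n t w where ntw: "int n = r\<^sup>2 + r + c\<^sup>2 - 1" "int t = c" "2 * int w = r\<^sup>2 - r + c\<^sup>2 - c"
    by (rule exponents_exist)
  obtain q where q: "m = 2 * q" using m by (rule evenE)
  obtain u where u: "t = 2 * u + 1" using c ntw(2) by (metis even_of_nat oddE)
  have "even (int n)" unfolding ntw(1) using c by simp
  then obtain k where k: "n = 2 * k" by (metis even_of_nat evenE)
  let ?A = "A_prod p" and ?B = "B_prod p" and ?I = "g ^ (2 * m)" and ?a = "4 * r - 1"
  let ?\<mu> = "mu p ?a (2 * c) g"
  have p4: "(p - 1) div 4 = 2 * m" using p_eq by simp
  have sgn: "(-1 :: int) ^ (m + 1) = -1" using m by simp
  have nd: "\<not> P dvd ?I" using g by (rule quarter_not_dvd)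
  have "?A\<^sup>2 \<simeq> -1" using A_square unfolding sgn .
  then have A: "?A ^ n \<simeq> (-1) ^ k"
    unfolding k power_mult by (rule cong_pow)
  have "?B\<^sup>2 \<simeq> 1" using B_square m by simp
  then have "(?B\<^sup>2) ^ (w + u) * ?B \<simeq> 1 ^ (w + u) * ?B"
    by (intro cong_mult[OF _ cong_refl] cong_pow)
  then have B: "?B ^ (2 * w + t) \<simeq> 1 ^ (w + u) * ?B"
    unfolding u by (simp add: mult.commute flip: power_mult distrib_left)
  have "root_m1 * ?B \<simeq> (-1) ^ ?\<mu> * ?I"
    unfolding mu_def p4
  proof (rule sign_exponent_quotient[OF nd])
    let ?x = "2 * (2 * c) * ?B * modular_inverse P (?a * ?I)"
    have "\<not> P dvd ?a * ?I" using nd a_not_dvd by (simp only: dvd_mult_iff) simp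
    from cong_mult[OF cong_refl inverse_cong[OF this], of "4 * c * ?B"]
    have "?a * (?x * ?I) \<simeq> 4 * c * ?B" by (simp add: mult_ac)
    \<comment> \<open>Multiplying by \<open>a\<close> clears the denominator that \<open>mu\<close>
      combines with \<open>g ^ (2 * m)\<close>; it is cancelled at the end.\<close>
    also have "4 * c * ?B \<simeq> root_m1 * ?a * ?B"
      by (rule cong_mult[OF cong_sym[OF root_m1_mult] cong_refl])
    also have "root_m1 * ?a * ?B = ?a * (root_m1 * ?B)" by simp
    finally show "?x * ?I \<simeq> root_m1 * ?B" by (simp only: cong_mult_cancel[OF a_not_dvd])
    show "(root_m1 * ?B)\<^sup>2 \<simeq> ?I\<^sup>2"
      using root_B_square primroot_quarter_square[OF g] unfolding sgn by (simp add: cong_def)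
  qed
  then have \<mu>: "(-1) ^ (k + u + 1) * (root_m1 * ?B) \<simeq> (-1) ^ (k + u + 1) * ((-1) ^ ?\<mu> * ?I)"
    by (rule cong_mult[OF cong_refl])
  have "?A ^ n * ?B ^ (2 * w + t) * ((-1) ^ (m + 1) * root_m1) ^ t \<simeq>
      (-1) ^ k * (1 ^ (w + u) * ?B) * ((-1) ^ u * ((-1) ^ (m + 1) * root_m1))"
    using A B signs_power_odd[of u] unfolding u by (intro cong_mult)
  also have "(-1) ^ k * (1 ^ (w + u) * ?B) * ((-1) ^ u * ((-1) ^ (m + 1) * root_m1)) =
      (-1) ^ (k + u + 1) * (root_m1 * ?B)"
    unfolding sgn by (simp add: power_add)
  also note \<mu>
  finally have L: "?A ^ n * ?B ^ (2 * w + t) * ((-1) ^ (m + 1) * root_m1) ^ t \<simeq>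
      (-1) ^ (k + u + 1 + ?\<mu>) * ?I"
    unfolding power_add mult.assoc .
  have "sign (tau p g) \<simeq> (-1) ^ (lam p + (k + u + 1 + ?\<mu>) + (t + 3 * q + 1))"
    by (rule sign_tau_parity[OF g ntw L quarter_power_even[OF g q] nd])
  then show ?thesis
  proof (rule is_sign_powerI[OF _ sign_tau_cases])
    have "int m = 2 * int q" "int n = 2 * int k" using q k by simp_all
    then show "3 * P + 27 - 2 * ?a - 8 * (2 * c) = 32 * (int k + int q + 1 - r - int u)"
      using ntw u m_eq P_eq by simp
  qed (use m r_parity u in simp)
qed

end

theorem theorem1:
  fixes p :: nat and a b :: int
  assumes "prime p" and "[p = 1] (mod 8)"
    and "int p = a\<^sup>2 + 4 * b\<^sup>2" and "[a = -1] (mod 4)" and "b > 0"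
  shows
    "([p = 9] (mod 16) \<longrightarrow>
        (\<forall>g h. int_primroot p g \<and> int_primroot p h \<longrightarrow> sign (tau p g) = sign (tau p h)) \<and>
        (\<forall>g. int_primroot p g \<longrightarrow>
           (chi4 p 2 = 1 \<longrightarrow>
              is_sign_power (sign (tau p g)) (lam p + beta p)
                (3 * int p + 11 - 2 * a + 8 * b)) \<and>
           (chi4 p 2 = -1 \<longrightarrow>
              is_sign_power (sign (tau p g)) (lam p + gamma p a b)
                (3 * int p - 21 - 2 * a - 8 * b)))) \<and>
     ([p = 1] (mod 16) \<longrightarrow>
        (\<forall>g. int_primroot p g \<longrightarrow>
           (chi4 p 2 = 1 \<longrightarrow>
              is_sign_power (sign (tau p g)) (lam p + delta p g)
                (3 * int p - 5 - 2 * a + 8 * b)) \<and>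
           (chi4 p 2 = -1 \<longrightarrow>
              is_sign_power (sign (tau p g)) (lam p + mu p a b g)
                (3 * int p + 27 - 2 * a - 8 * b))) \<and>
        card {g. 0 < g \<and> g < int p \<and> int_primroot p g \<and> sign (tau p g) = 1} =
        card {g. 0 < g \<and> g < int p \<and> int_primroot p g \<and> sign (tau p g) = -1})"
proof -
  define m where "m = p div 8"
  have "p mod 8 = 1" using assms(2) by (simp add: cong_def)
  then have p_eq: "p = 8 * m + 1" unfolding m_def by presburger
  have m9: "odd m" if "[p = 9] (mod 16)"
  proof -
    have "p mod 16 = 9" using that by (simp add: cong_def)
    then show ?thesis using p_eq by presburger
  qed
  have m1: "even m" if "[p = 1] (mod 16)"
  proof -
    have "p mod 16 = 1" using that by (simp add: cong_def)
    then show ?thesis using p_eq by presburger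
  qed
  have "4 dvd a + 1" using assms(4) by (simp add: cong_iff_dvd_diff)
  then obtain r where "a + 1 = 4 * r" by (rule dvdE)
  then have a: "a = 4 * r - 1" by simp
  \<comment> \<open>Comparing the two expressions of \<open>p\<close> modulo 8 shows that
    \<open>b\<close> is even, which supplies \<open>c\<close>.\<close>
  have "8 * int m = 16 * r\<^sup>2 - 8 * r + 4 * b\<^sup>2"
    using assms(3) unfolding p_eq a by (simp add: power2_eq_square algebra_simps)
  then have "b\<^sup>2 = 2 * (int m - 2 * r\<^sup>2 + r)" by simp
  then have "even (b\<^sup>2)" by (metis dvd_triv_left)
  then obtain c where b: "b = 2 * c" by auto
  interpret prime_two_squares p m r c
    by unfold_locales (use assms p_eq a b in auto)
  have chi: "chi4 p 2 = 1 \<Longrightarrow> even c" "chi4 p 2 = -1 \<Longrightarrow> odd c"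
    by (auto simp: chi4_2 split: if_splits)
  show ?thesis
    unfolding a b
    using sign_tau_independent[OF _ _ m9] sign_tau_9_chi4_1[OF _ m9 chi(1)]
      sign_tau_9_chi4_minus_1[OF _ m9 chi(2)] sign_tau_1_chi4_1[OF _ m1 chi(1)]
      sign_tau_1_chi4_minus_1[OF _ m1 chi(2)] card_sign_tau_eq[OF m1]
    by blast
qed

end
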